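(* Let $\sigma>0$ and $p\ge1$. Suppose that the carrier $g_0(\mu)=\varphi_\sigma^M(\mu)$ is the Gaussian density with variance $\sigma^2$ wrapped over the interval $\Omega_M=[-M,M]$, and that the observations follow the cyclic convolution model over $\Omega_M$ with kernel $K_M$. Then, for any $p$-parameter statistic $T:\Omega_M\to\mathbb{R}^p$, $$\rho_0(T)\le\frac{1}{(1+\sigma^{-2})^p}+o_M(1),$$ where the residual term $o_M(1)$ tends to $0$ as $M\to\infty$. Moreover, this bound is attained by the model $g_\eta(\mu)=g_0(\mu)\exp[\eta\cdot T(\mu)-\psi(\eta)]$ whose statistics are the normalized Hermite polynomials $$\Gamma_j(\mu)=H_j\!\left(\frac{\mu}{\sigma}\right),\qquad H_j(\mu)=\frac{1}{\sqrt{j!}}\exp\!\Big(\frac{\mu^2}{2}\Big)\Big(\frac{\partial}{\partial\mu}\Big)^j\exp\!\Big(-\frac{\mu^2}{2}\Big),\qquad j=1,\ldots,p,$$ for which, up to terms that vanish as $M\to\infty$, $\mathcal{I}_\mu(0)=I_{p\times p}$ and $\mathcal{I}_X(0)$ is diagonal with entries $(1+\sigma^{-2})^{-1},\ldots,(1+\sigma^{-2})^{-p}$.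
   Context: $\varphi$ is the standard Gaussian density. The wrapped Gaussian density is $\varphi_\sigma^M(x)=\sum_{j=-\infty}^\infty\sigma^{-1}\varphi((x+2jM)/\sigma)$ for $x\in\Omega_M=[-M,M]$. Cyclic convolution model: $\mu$ has a density $g$ on $\Omega_M$, and given $\mu$ the observation $X\in\Omega_M$ has density $x\mapsto K_M(\mu,x)=\sum_{j=-\infty}^\infty\varphi(x-\mu+2jM)$; the marginal density of $X$ is $f(x)=\int_{\Omega_M}K_M(\mu,x)g(\mu)\,d\mu$. For a statistic $T:\Omega_M\to\mathbb{R}^p$, let $g_\eta(\mu)=g_0(\mu)\exp[\eta\cdot T(\mu)-\psi(\eta)]$, $\eta\in\mathbb{R}^p$, with $\psi$ the log-partition function, and let $f_\eta$ be the corresponding marginal density of $X$. The Fisher informations are $$\mathcal{I}_\mu(\eta)=-\mathbb{E}_\eta\Big[\tfrac{\partial^2}{\partial\eta^2}\log g_\eta(\mu)\Big],\qquad \mathcal{I}_X(\eta)=-\mathbb{E}_\eta\Big[\tfrac{\partial^2}{\partial\eta^2}\log f_\eta(X)\Big],$$ and the relative efficiency coefficient is $$\rho_\eta(T)=\inf_{a\in\mathbb{R}^p,\,a\ne0}\frac{a^\top\mathcal{I}_X(\eta)a}{a^\top\mathcal{I}_\mu(\eta)a}$$ (statistics considered are such that these quantities are well defined, in particular $\mathcal{I}_\mu$ is nonsingular). *)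

theory Defs
  imports "HOL-Probability.Probability"
begin

definition Omega :: "real \<Rightarrow> real set" where
  "Omega M = {-M..M}"

definition wrapped_gaussian :: "real \<Rightarrow> real \<Rightarrow> real \<Rightarrow> real" where
  "wrapped_gaussian \<sigma> M x =
     (\<Sum>\<^sub>\<infinity>j\<in>(UNIV :: int set). (1 / \<sigma>) * std_normal_density ((x + 2 * of_int j * M) / \<sigma>))"

definition cyclic_kernel :: "real \<Rightarrow> real \<Rightarrow> real \<Rightarrow> real" where
  "cyclic_kernel M \<mu> x =
     (\<Sum>\<^sub>\<infinity>j\<in>(UNIV :: int set). std_normal_density (x - \<mu> + 2 * of_int j * M))"

definition marginal_density :: "real \<Rightarrow> (real \<Rightarrow> real) \<Rightarrow> real \<Rightarrow> real" where
  "marginal_density M g x = (LINT \<mu>:Omega M|lborel. cyclic_kernel M \<mu> x * g \<mu>)"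

definition log_partition ::
  "real \<Rightarrow> (real \<Rightarrow> real) \<Rightarrow> (real \<Rightarrow> real ^ 'p) \<Rightarrow> real ^ 'p \<Rightarrow> real" where
  "log_partition M g0 T \<eta> = ln (LINT \<mu>:Omega M|lborel. g0 \<mu> * exp (\<eta> \<bullet> T \<mu>))"

definition exp_family ::
  "real \<Rightarrow> (real \<Rightarrow> real) \<Rightarrow> (real \<Rightarrow> real ^ 'p) \<Rightarrow> real ^ 'p \<Rightarrow> real \<Rightarrow> real" where
  "exp_family M g0 T \<eta> \<mu> = g0 \<mu> * exp (\<eta> \<bullet> T \<mu> - log_partition M g0 T \<eta>)"

definition marginal_family ::
  "real \<Rightarrow> (real \<Rightarrow> real) \<Rightarrow> (real \<Rightarrow> real ^ 'p) \<Rightarrow> real ^ 'p \<Rightarrow> real \<Rightarrow> real" where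
  "marginal_family M g0 T \<eta> = marginal_density M (exp_family M g0 T \<eta>)"

definition partial_deriv :: "'p \<Rightarrow> (real ^ 'p \<Rightarrow> real) \<Rightarrow> real ^ 'p \<Rightarrow> real" where
  "partial_deriv i F \<eta> = deriv (\<lambda>t. F (\<eta> + t *\<^sub>R axis i 1)) 0"

definition hessian :: "(real ^ 'p \<Rightarrow> real) \<Rightarrow> real ^ 'p \<Rightarrow> real ^ 'p ^ 'p" where
  "hessian F \<eta> = (\<chi> i j. partial_deriv i (partial_deriv j F) \<eta>)"

definition fisher_info ::
  "real \<Rightarrow> (real ^ 'p \<Rightarrow> real \<Rightarrow> real) \<Rightarrow> real ^ 'p \<Rightarrow> real ^ 'p ^ 'p" where
  "fisher_info M h \<eta> =
     (\<chi> i j. - (LINT x:Omega M|lborel. hessian (\<lambda>\<theta>. ln (h \<theta> x)) \<eta> $ i $ j * h \<eta> x))"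

definition fisher_info_mu ::
  "real \<Rightarrow> (real \<Rightarrow> real) \<Rightarrow> (real \<Rightarrow> real ^ 'p) \<Rightarrow> real ^ 'p \<Rightarrow> real ^ 'p ^ 'p" where
  "fisher_info_mu M g0 T = fisher_info M (exp_family M g0 T)"

definition fisher_info_X ::
  "real \<Rightarrow> (real \<Rightarrow> real) \<Rightarrow> (real \<Rightarrow> real ^ 'p) \<Rightarrow> real ^ 'p \<Rightarrow> real ^ 'p ^ 'p" where
  "fisher_info_X M g0 T = fisher_info M (marginal_family M g0 T)"

definition rel_efficiency ::
  "real \<Rightarrow> (real \<Rightarrow> real) \<Rightarrow> (real \<Rightarrow> real ^ 'p::finite) \<Rightarrow> real ^ 'p \<Rightarrow> real" where
  "rel_efficiency M g0 T \<eta> =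
     (INF a\<in>{a. a \<noteq> 0}. (a \<bullet> (fisher_info_X M g0 T \<eta> *v a)) / (a \<bullet> (fisher_info_mu M g0 T \<eta> *v a)))"

text \<open>
  A measurable statistic for which the efficiency at \<open>\<eta> = 0\<close> is meaningful. Finiteness of the
  partition function is required only near \<open>0\<close>: the kernel is bounded, so this already makes the
  log-likelihoods of \<open>\<mu>\<close> and \<open>X\<close> twice differentiable at \<open>0\<close> with integrable
  second derivatives.
\<close>

definition admissible_statistic ::
  "real \<Rightarrow> (real \<Rightarrow> real) \<Rightarrow> (real \<Rightarrow> real ^ 'p::finite) \<Rightarrow> bool" where
  "admissible_statistic M g0 T \<longleftrightarrow>
     T \<in> borel_measurable (restrict_space borel (Omega M)) \<and>
     (\<forall>\<^sub>F \<eta> in nhds 0. set_integrable lborel (Omega M) (\<lambda>\<mu>. g0 \<mu> * exp (\<eta> \<bullet> T \<mu>))) \<and>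
     invertible (fisher_info_mu M g0 T 0)"

definition hermite :: "nat \<Rightarrow> real \<Rightarrow> real" where
  "hermite j x = 1 / sqrt (fact j) * exp (x\<^sup>2 / 2) * (deriv ^^ j) (\<lambda>t. exp (- t\<^sup>2 / 2)) x"

text \<open>The bijection \<open>idx\<close> from \<open>'p\<close> to \<open>{1..CARD('p)}\<close> numbers the coordinates.\<close>

definition hermite_statistic :: "real \<Rightarrow> ('p::finite \<Rightarrow> nat) \<Rightarrow> real \<Rightarrow> real ^ 'p" where
  "hermite_statistic \<sigma> idx \<mu> = (\<chi> i. hermite (idx i) (\<mu> / \<sigma>))"

end

theory Submission imports Defs "HOL-Computational_Algebra.Polynomial"
begin

text \<open>
  Write \<open>\<gamma> = \<sigma>\<^sup>2 / (1 + \<sigma>\<^sup>2)\<close>. At \<open>\<eta> = 0\<close> both Fisher informations are covariance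
  matrices: \<open>I_\<mu>\<close> is the covariance of \<open>T(\<mu>)\<close>, and \<open>I_X\<close> is the covariance of the posterior mean
  \<open>E[T(\<mu>) | X]\<close>. Moving everything to \<open>L\<^sup>2\<close> of Lebesgue measure, a direction \<open>a\<close> corresponds to
  \<open>u = sqrt g\<^sub>0 * (a \<bullet> T - mean)\<close>, and the ratio of the two quadratic forms is \<open>\<parallel>A u\<parallel>\<^sup>2 / \<parallel>u\<parallel>\<^sup>2\<close> for the
  integral operator \<open>A\<close> with kernel \<open>K_M(\<mu>, x) * sqrt (g\<^sub>0 \<mu> / f\<^sub>0 x)\<close> (\<open>fisher_info_mu_eq\<close>,
  \<open>fisher_info_X_eq\<close>). The efficiency is thus the minimum of a Rayleigh quotient over a space of dimension
  \<open>p\<close> orthogonal to \<open>sqrt g\<^sub>0\<close>, and the theorem is a min-max statement about the singular values of \<open>A\<close>.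

  As \<open>M\<close> grows, the kernel converges in Hilbert--Schmidt norm to the kernel of the Gaussian channel on the
  whole line (\<open>tendsto_wrapped_kernel\<close>). The singular functions of the latter are Hermite functions, with
  singular values \<open>\<gamma> powr (j / 2)\<close>, because smoothing by a Gaussian maps Hermite functions to multiples of
  Hermite functions at a larger scale (\<open>gauss_kernel_hermite\<close>). The squares of these values sum to
  \<open>1 / (1 - \<gamma>)\<close>, which is the squared Hilbert--Schmidt norm of the kernel, so they are all of the singular
  values, and the operator contracts by \<open>\<gamma> powr (p / 2)\<close> on functions orthogonal to the first \<open>p\<close> Hermite
  functions (\<open>gauss_channel_contraction\<close>).

  For the upper bound, \<open>p - 1\<close> linear conditions on \<open>a \<in> \<real>\<^sup>p\<close> make \<open>u\<close> orthogonal to the Hermite functions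
  of index \<open>1, \<dots>, p - 1\<close>; orthogonality to the one of index \<open>0\<close> holds up to the distance between
  \<open>sqrt g\<^sub>0\<close> and its limit, since \<open>u\<close> is centred. The resulting error depends on two distances only, that of
  the kernels and that of the square roots of the carriers, hence on \<open>\<sigma>\<close> and \<open>M\<close> but not on \<open>T\<close>
  (\<open>rel_efficiency_le_bound\<close>). For the Hermite statistics, the functions \<open>u\<close> converge in \<open>L\<^sup>2\<close> to Hermite
  functions, so the Gram matrices \<open>I_\<mu>\<close> and \<open>I_X\<close> converge to the Gram matrices of the Hermite functions and
  of their images, and the Rayleigh quotients converge uniformly.
\<close>

section \<open>Square-integrable functions\<close>

text \<open>
  Functions are kept as genuine functions, without quotienting by equality almost everywhere, so that kernels
  can be evaluated at points.
\<close>

definition L2 :: "'a measure \<Rightarrow> ('a \<Rightarrow> real) set" where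
  "L2 N = {f \<in> borel_measurable N. integrable N (\<lambda>x. (f x)\<^sup>2)}"

definition l2_inner :: "'a measure \<Rightarrow> ('a \<Rightarrow> real) \<Rightarrow> ('a \<Rightarrow> real) \<Rightarrow> real" where
  "l2_inner N f g = (\<integral>x. f x * g x \<partial>N)"

definition l2_norm :: "'a measure \<Rightarrow> ('a \<Rightarrow> real) \<Rightarrow> real" where
  "l2_norm N f = sqrt (\<integral>x. (f x)\<^sup>2 \<partial>N)"

lemma L2_measurable: "f \<in> L2 N \<Longrightarrow> f \<in> borel_measurable N"
  and L2_integrable: "f \<in> L2 N \<Longrightarrow> integrable N (\<lambda>x. (f x)\<^sup>2)"
  by (auto simp: L2_def)

lemma l2_norm_nonneg [simp]: "0 \<le> l2_norm N f"
  by (simp add: l2_norm_def)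

lemma l2_norm_sq: "(l2_norm N f)\<^sup>2 = (\<integral>x. (f x)\<^sup>2 \<partial>N)"
  by (simp add: l2_norm_def)

lemma l2_inner_self: "l2_inner N f f = (l2_norm N f)\<^sup>2"
  unfolding l2_norm_sq by (simp add: l2_inner_def power2_eq_square)

lemma l2_inner_commute: "l2_inner N f g = l2_inner N g f"
  by (simp add: l2_inner_def mult.commute)

lemma integrable_dominated:
  fixes f g :: "'a \<Rightarrow> real"
  assumes "integrable N g" "f \<in> borel_measurable N" "\<And>x. x \<in> space N \<Longrightarrow> \<bar>f x\<bar> \<le> \<bar>g x\<bar>"
  shows "integrable N f"
  using assms(3) by (intro Bochner_Integration.integrable_bound[OF assms(1,2)] AE_I2) simp

lemma integrable_mult_bounded:
  fixes f g w :: "'a \<Rightarrow> real"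
  assumes "integrable N (\<lambda>x. w x * g x)" and m: "w \<in> borel_measurable N" "f \<in> borel_measurable N"
    and le: "\<And>x. \<bar>f x\<bar> \<le> C * \<bar>g x\<bar>"
  shows "integrable N (\<lambda>x. w x * f x)"
proof (rule integrable_dominated)
  show "integrable N (\<lambda>x. C * (w x * g x))" using assms(1) by simp
  show "(\<lambda>x. w x * f x) \<in> borel_measurable N" using m by measurable
  fix x
  have "\<bar>w x\<bar> * \<bar>f x\<bar> \<le> \<bar>w x\<bar> * (\<bar>C\<bar> * \<bar>g x\<bar>)"
    by (intro mult_left_mono order_trans[OF le] mult_right_mono) auto
  then show "\<bar>w x * f x\<bar> \<le> \<bar>C * (w x * g x)\<bar>" by (simp add: abs_mult ac_simps)
qed

lemma L2_bound:
  assumes "f \<in> borel_measurable N" "g \<in> L2 N" "\<And>x. x \<in> space N \<Longrightarrow> \<bar>f x\<bar> \<le> C * \<bar>g x\<bar>"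
  shows "f \<in> L2 N"
proof -
  have "integrable N (\<lambda>x. (f x)\<^sup>2)"
  proof (rule integrable_dominated)
    show "integrable N (\<lambda>x. C\<^sup>2 * (g x)\<^sup>2)"
      using L2_integrable[OF assms(2)] by simp
    fix x assume "x \<in> space N"
    then have "\<bar>f x\<bar>\<^sup>2 \<le> (C * \<bar>g x\<bar>)\<^sup>2"
      by (intro power_mono assms) auto
    then show "\<bar>(f x)\<^sup>2\<bar> \<le> \<bar>C\<^sup>2 * (g x)\<^sup>2\<bar>"
      by (simp add: power_mult_distrib)
  qed (use assms(1) in measurable)
  then show ?thesis using assms(1) by (simp add: L2_def)
qed

lemma L2_scale: "f \<in> L2 N \<Longrightarrow> (\<lambda>x. c * f x) \<in> L2 N"
  by (auto simp: L2_def power_mult_distrib)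

lemma L2_zero: "(\<lambda>x. 0) \<in> L2 N"
  by (simp add: L2_def)

lemma L2_add:
  assumes "f \<in> L2 N" "g \<in> L2 N"
  shows "(\<lambda>x. f x + g x) \<in> L2 N"
proof -
  have m[measurable]: "f \<in> borel_measurable N" "g \<in> borel_measurable N"
    using assms by (auto simp: L2_def)
  have "integrable N (\<lambda>x. (f x + g x)\<^sup>2)"
  proof (rule integrable_dominated)
    show "integrable N (\<lambda>x. 2 * (f x)\<^sup>2 + 2 * (g x)\<^sup>2)"
      using assms by (auto simp: L2_def)
    fix x
    have "0 \<le> (f x - g x)\<^sup>2" by simp
    then have "(f x + g x)\<^sup>2 \<le> 2 * (f x)\<^sup>2 + 2 * (g x)\<^sup>2"
      by (simp add: power2_sum power2_diff)
    then show "\<bar>(f x + g x)\<^sup>2\<bar> \<le> \<bar>2 * (f x)\<^sup>2 + 2 * (g x)\<^sup>2\<bar>"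
      by (simp only: abs_of_nonneg[OF zero_le_power2])
  qed measurable
  then show ?thesis by (simp add: L2_def)
qed

lemma L2_diff: "f \<in> L2 N \<Longrightarrow> g \<in> L2 N \<Longrightarrow> (\<lambda>x. f x - g x) \<in> L2 N"
  using L2_add[of f N "\<lambda>x. (-1) * g x"] L2_scale[of g N "-1"] by simp

lemma L2_sum: "(\<And>i. i \<in> I \<Longrightarrow> f i \<in> L2 N) \<Longrightarrow> (\<lambda>x. \<Sum>i\<in>I. f i x) \<in> L2 N"
  by (induction I rule: infinite_finite_induct) (auto simp: L2_zero intro!: L2_add)

lemma L2_mult_integrable:
  assumes "f \<in> L2 N" "g \<in> L2 N"
  shows "integrable N (\<lambda>x. f x * g x)"
proof -
  have m[measurable]: "f \<in> borel_measurable N" "g \<in> borel_measurable N"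
    using assms by (auto simp: L2_def)
  show ?thesis
  proof (rule integrable_dominated)
    show "integrable N (\<lambda>x. (f x)\<^sup>2 + (g x)\<^sup>2)"
      using assms by (auto simp: L2_def)
    fix x
    have "2 * (\<bar>f x\<bar> * \<bar>g x\<bar>) \<le> (f x)\<^sup>2 + (g x)\<^sup>2"
      using zero_le_power2[of "\<bar>f x\<bar> - \<bar>g x\<bar>"] by (simp add: power2_diff)
    moreover have "0 \<le> \<bar>f x\<bar> * \<bar>g x\<bar>" by simp
    ultimately have "\<bar>f x\<bar> * \<bar>g x\<bar> \<le> (f x)\<^sup>2 + (g x)\<^sup>2" by linarith
    then show "\<bar>f x * g x\<bar> \<le> \<bar>(f x)\<^sup>2 + (g x)\<^sup>2\<bar>" by (simp add: abs_mult)
  qed measurable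
qed

lemma l2_inner_add_left:
  "f \<in> L2 N \<Longrightarrow> g \<in> L2 N \<Longrightarrow> h \<in> L2 N \<Longrightarrow>
    l2_inner N (\<lambda>x. f x + g x) h = l2_inner N f h + l2_inner N g h"
  by (simp add: l2_inner_def distrib_right L2_mult_integrable)

lemma l2_inner_diff_left:
  "f \<in> L2 N \<Longrightarrow> g \<in> L2 N \<Longrightarrow> h \<in> L2 N \<Longrightarrow>
    l2_inner N (\<lambda>x. f x - g x) h = l2_inner N f h - l2_inner N g h"
  by (simp add: l2_inner_def left_diff_distrib L2_mult_integrable)

lemma l2_inner_scale_left: "l2_inner N (\<lambda>x. c * f x) h = c * l2_inner N f h"
  by (simp add: l2_inner_def mult.assoc)

lemma l2_inner_sum_left:
  assumes "\<And>i. i \<in> I \<Longrightarrow> f i \<in> L2 N" "h \<in> L2 N"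
  shows "l2_inner N (\<lambda>x. \<Sum>i\<in>I. c i * f i x) h = (\<Sum>i\<in>I. c i * l2_inner N (f i) h)"
  using assms
proof (induction I rule: infinite_finite_induct)
  case (insert i I)
  have "l2_inner N (\<lambda>x. c i * f i x + (\<Sum>i\<in>I. c i * f i x)) h
      = l2_inner N (\<lambda>x. c i * f i x) h + l2_inner N (\<lambda>x. \<Sum>i\<in>I. c i * f i x) h"
    using insert by (intro l2_inner_add_left L2_sum L2_scale) auto
  then show ?case using insert by (simp add: l2_inner_scale_left)
qed (auto simp: l2_inner_def)

lemma l2_norm_sq_sum:
  assumes "\<And>i. i \<in> I \<Longrightarrow> f i \<in> L2 N"
  shows "(l2_norm N (\<lambda>x. \<Sum>i\<in>I. c i * f i x))\<^sup>2
      = (\<Sum>i\<in>I. \<Sum>j\<in>I. c i * c j * l2_inner N (f i) (f j))"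
proof -
  have L: "(\<lambda>x. \<Sum>i\<in>I. c i * f i x) \<in> L2 N"
    using assms by (intro L2_sum L2_scale) auto
  have "(l2_norm N (\<lambda>x. \<Sum>i\<in>I. c i * f i x))\<^sup>2
      = (\<Sum>i\<in>I. c i * l2_inner N (f i) (\<lambda>x. \<Sum>i\<in>I. c i * f i x))"
    unfolding l2_inner_self[symmetric] using assms L by (subst l2_inner_sum_left) auto
  also have "\<dots> = (\<Sum>i\<in>I. c i * (\<Sum>j\<in>I. c j * l2_inner N (f j) (f i)))"
    using assms by (intro sum.cong refl, subst l2_inner_commute, subst l2_inner_sum_left) auto
  finally show ?thesis
    by (simp add: sum_distrib_left mult.assoc l2_inner_commute)
qed

lemma l2_norm_sq_add:
  assumes "f \<in> L2 N" "g \<in> L2 N"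
  shows "(l2_norm N (\<lambda>x. f x + g x))\<^sup>2
      = (l2_norm N f)\<^sup>2 + 2 * l2_inner N f g + (l2_norm N g)\<^sup>2"
proof -
  have i: "integrable N (\<lambda>x. f x * g x)" using assms by (rule L2_mult_integrable)
  have "(\<integral>x. (f x + g x)\<^sup>2 \<partial>N) = (\<integral>x. (f x)\<^sup>2 + 2 * (f x * g x) + (g x)\<^sup>2 \<partial>N)"
    by (simp add: power2_sum algebra_simps)
  also have "\<dots> = (\<integral>x. (f x)\<^sup>2 \<partial>N) + 2 * (\<integral>x. f x * g x \<partial>N) + (\<integral>x. (g x)\<^sup>2 \<partial>N)"
    using assms i by (simp add: L2_integrable)
  finally show ?thesis by (simp add: l2_norm_sq l2_inner_def)
qed

lemma l2_norm_scale: "l2_norm N (\<lambda>x. c * f x) = \<bar>c\<bar> * l2_norm N f"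
  by (simp add: l2_norm_def power_mult_distrib real_sqrt_mult)

lemma l2_norm_sq_diff:
  assumes "f \<in> L2 N" "g \<in> L2 N"
  shows "(l2_norm N (\<lambda>x. f x - g x))\<^sup>2
      = (l2_norm N f)\<^sup>2 - 2 * l2_inner N f g + (l2_norm N g)\<^sup>2"
  using l2_norm_sq_add[OF assms(1) L2_scale[OF assms(2), of "-1"]]
    l2_norm_scale[of N "-1" g] l2_inner_scale_left[of N "-1" g f]
  by (simp add: l2_inner_commute[of N f])

text \<open>
  The discriminant argument: \<open>\<parallel>t f - s g\<parallel>\<^sup>2\<close> is nonnegative for all \<open>s\<close> and \<open>t\<close>.
\<close>

lemma l2_cauchy_schwarz:
  assumes "f \<in> L2 N" "g \<in> L2 N"
  shows "\<bar>l2_inner N f g\<bar> \<le> l2_norm N f * l2_norm N g"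
proof -
  let ?a = "l2_norm N f" and ?b = "l2_norm N g" and ?c = "l2_inner N f g"
  have pos: "0 \<le> ?a\<^sup>2 * t\<^sup>2 - 2 * t * s * ?c + s\<^sup>2 * ?b\<^sup>2" for t s
  proof -
    have "(l2_norm N (\<lambda>x. t * f x - s * g x))\<^sup>2 = ?a\<^sup>2 * t\<^sup>2 - 2 * t * s * ?c + s\<^sup>2 * ?b\<^sup>2"
      unfolding l2_norm_sq_diff[OF L2_scale[OF assms(1), of t] L2_scale[OF assms(2), of s]]
      by (simp add: l2_norm_scale power_mult_distrib l2_inner_scale_left
          l2_inner_commute[of N f] l2_inner_commute[of N _ "\<lambda>x. s * g x"] algebra_simps)
    then show ?thesis by (metis zero_le_power2)
  qed
  have "?c\<^sup>2 \<le> ?a\<^sup>2 * ?b\<^sup>2"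
  proof (cases "?a\<^sup>2 = 0")
    case True
    (* a large first coefficient makes the cross term dominate unless it vanishes *)
    have "0 \<le> - 2 * ((?b\<^sup>2 + 1) * ?c) * ?c + ?c\<^sup>2 * ?b\<^sup>2 "
      using pos[of "?b\<^sup>2 + 1" ?c] True by (simp add: algebra_simps power2_eq_square)
    then have "0 \<le> - (?c\<^sup>2 * (?b\<^sup>2 + 2))"
      by (simp add: algebra_simps power2_eq_square)
    moreover have "?c\<^sup>2 \<le> ?c\<^sup>2 * (?b\<^sup>2 + 2)"
      using mult_left_mono[of 1 "?b\<^sup>2 + 2" "?c\<^sup>2"] by simp
    ultimately have "?c\<^sup>2 \<le> 0" by linarith
    then show ?thesis using True by simp
  next
    case False
    then have a: "0 < ?a\<^sup>2" by (simp add: zero_less_power2)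
    have "0 \<le> ?a\<^sup>2 * (?a\<^sup>2 * ?b\<^sup>2 - ?c\<^sup>2)"
      using pos[of ?c "?a\<^sup>2"] by (simp add: algebra_simps power2_eq_square)
    then show ?thesis using a by (simp add: zero_le_mult_iff)
  qed
  then have "\<bar>?c\<bar>\<^sup>2 \<le> (?a * ?b)\<^sup>2" by (simp add: power_mult_distrib)
  then show ?thesis by (rule power2_le_imp_le) simp
qed

lemma l2_norm_triangle:
  assumes "f \<in> L2 N" "g \<in> L2 N"
  shows "l2_norm N (\<lambda>x. f x + g x) \<le> l2_norm N f + l2_norm N g"
proof (rule power2_le_imp_le)
  show "(l2_norm N (\<lambda>x. f x + g x))\<^sup>2 \<le> (l2_norm N f + l2_norm N g)\<^sup>2"
    using l2_cauchy_schwarz[OF assms] by (simp add: l2_norm_sq_add[OF assms] power2_sum)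
qed simp

lemma l2_norm_triangle_sub:
  assumes "f \<in> L2 N" "g \<in> L2 N"
  shows "l2_norm N f \<le> l2_norm N g + l2_norm N (\<lambda>x. f x - g x)"
  using l2_norm_triangle[OF assms(2) L2_diff[OF assms]] by simp

lemma tendsto_l2_inner:
  assumes "\<forall>\<^sub>F M in F. f M \<in> L2 N" "\<forall>\<^sub>F M in F. g M \<in> L2 N" and f': "f' \<in> L2 N" and g': "g' \<in> L2 N"
    and "((\<lambda>M. l2_norm N (\<lambda>x. f M x - f' x)) \<longlongrightarrow> 0) F"
    and "((\<lambda>M. l2_norm N (\<lambda>x. g M x - g' x)) \<longlongrightarrow> 0) F"
  shows "((\<lambda>M. l2_inner N (f M) (g M)) \<longlongrightarrow> l2_inner N f' g') F"
proof (rule Lim_null[THEN iffD2], rule Lim_null_comparison)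
  let ?d = "\<lambda>M. l2_norm N (\<lambda>x. f M x - f' x)" and ?e = "\<lambda>M. l2_norm N (\<lambda>x. g M x - g' x)"
  show "\<forall>\<^sub>F M in F. norm (l2_inner N (f M) (g M) - l2_inner N f' g')
      \<le> ?d M * (l2_norm N g' + ?e M) + l2_norm N f' * ?e M"
    using assms(1,2)
  proof eventually_elim
    case (elim M)
    have "l2_inner N (f M) (g M) - l2_inner N f' g'
        = l2_inner N (\<lambda>x. f M x - f' x) (g M) + l2_inner N f' (\<lambda>x. g M x - g' x)"
      using elim f' g'
      by (simp add: l2_inner_diff_left l2_inner_commute[of N f'])
    moreover have "\<bar>l2_inner N (\<lambda>x. f M x - f' x) (g M)\<bar> \<le> ?d M * l2_norm N (g M)"
      using elim f' by (intro l2_cauchy_schwarz L2_diff) auto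
    moreover have "?d M * l2_norm N (g M) \<le> ?d M * (l2_norm N g' + ?e M)"
      using elim g' by (intro mult_left_mono l2_norm_triangle_sub) auto
    moreover have "\<bar>l2_inner N f' (\<lambda>x. g M x - g' x)\<bar> \<le> l2_norm N f' * ?e M"
      using elim f' g' by (intro l2_cauchy_schwarz L2_diff) auto
    ultimately show ?case by simp
  qed
  show "((\<lambda>M. ?d M * (l2_norm N g' + ?e M) + l2_norm N f' * ?e M) \<longlongrightarrow> 0) F"
    by (rule tendsto_eq_intros assms refl | simp)+
qed

lemma bessel_inequality:
  assumes "finite I" "\<And>i. i \<in> I \<Longrightarrow> e i \<in> L2 N"
    and "\<And>i j. i \<in> I \<Longrightarrow> j \<in> I \<Longrightarrow> l2_inner N (e i) (e j) = (if i = j then 1 else 0)"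
    and "f \<in> L2 N"
  shows "(\<Sum>i\<in>I. (l2_inner N f (e i))\<^sup>2) \<le> (l2_norm N f)\<^sup>2"
proof -
  let ?c = "\<lambda>i. l2_inner N f (e i)"
  let ?P = "\<lambda>x. \<Sum>i\<in>I. ?c i * e i x"
  have P: "?P \<in> L2 N" using assms by (intro L2_sum L2_scale) auto
  have "l2_inner N ?P f = (\<Sum>i\<in>I. ?c i * l2_inner N (e i) f)"
    using assms by (intro l2_inner_sum_left) auto
  then have 1: "l2_inner N f ?P = (\<Sum>i\<in>I. (?c i)\<^sup>2)"
    by (simp add: l2_inner_commute[of N f] power2_eq_square)
  have "(l2_norm N ?P)\<^sup>2 = (\<Sum>i\<in>I. \<Sum>j\<in>I. ?c i * ?c j * l2_inner N (e i) (e j))"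
    using assms by (intro l2_norm_sq_sum) auto
  also have "\<dots> = (\<Sum>i\<in>I. \<Sum>j\<in>I. if i = j then (?c i)\<^sup>2 else 0)"
    using assms by (intro sum.cong refl) (auto simp: power2_eq_square)
  also have "\<dots> = (\<Sum>i\<in>I. (?c i)\<^sup>2)" using assms(1) by (simp add: sum.delta)
  finally have 2: "(l2_norm N ?P)\<^sup>2 = (\<Sum>i\<in>I. (?c i)\<^sup>2)" .
  have "0 \<le> (l2_norm N (\<lambda>x. f x - ?P x))\<^sup>2" by simp
  then show ?thesis
    unfolding l2_norm_sq_diff[OF assms(4) P] 1 2 by simp
qed

section \<open>Hilbert--Schmidt integral operators\<close>

text \<open>
  Asking every section, and not just almost every one, to be square integrable makes the integral operator
  linear in the kernel at every point.
\<close>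

definition hs_kernel :: "(real \<Rightarrow> real \<Rightarrow> real) \<Rightarrow> bool" where
  "hs_kernel k \<longleftrightarrow> (\<lambda>(x, y). k x y) \<in> L2 (lborel \<Otimes>\<^sub>M lborel) \<and> (\<forall>x. k x \<in> L2 lborel)"

definition hs_norm :: "(real \<Rightarrow> real \<Rightarrow> real) \<Rightarrow> real" where
  "hs_norm k = l2_norm (lborel \<Otimes>\<^sub>M lborel) (\<lambda>(x, y). k x y)"

definition kernel_op :: "(real \<Rightarrow> real \<Rightarrow> real) \<Rightarrow> (real \<Rightarrow> real) \<Rightarrow> real \<Rightarrow> real" where
  "kernel_op k u x = l2_inner lborel (k x) u"

lemma hs_kernel_section: "hs_kernel k \<Longrightarrow> k x \<in> L2 lborel"
  and hs_kernel_L2: "hs_kernel k \<Longrightarrow> (\<lambda>(x, y). k x y) \<in> L2 (lborel \<Otimes>\<^sub>M lborel)"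
  by (auto simp: hs_kernel_def)

lemma hs_norm_nonneg [simp]: "0 \<le> hs_norm k" by (simp add: hs_norm_def)

lemma hs_kernel_diff: "hs_kernel k \<Longrightarrow> hs_kernel l \<Longrightarrow> hs_kernel (\<lambda>x y. k x y - l x y)"
  using L2_diff[of "\<lambda>(x, y). k x y" "lborel \<Otimes>\<^sub>M lborel" "\<lambda>(x, y). l x y"]
  by (auto simp: hs_kernel_def case_prod_beta' intro: L2_diff)

text \<open>
  Cauchy--Schwarz on each section, integrated over the first variable: the operator norm is at most the
  Hilbert--Schmidt norm.
\<close>

lemma kernel_op_L2_norm:
  assumes k: "hs_kernel k" and u: "u \<in> L2 lborel"
  shows "kernel_op k u \<in> L2 lborel" "l2_norm lborel (kernel_op k u) \<le> hs_norm k * l2_norm lborel u"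
proof -
  have km[measurable]: "(\<lambda>(x, y). k x y) \<in> borel_measurable (lborel \<Otimes>\<^sub>M lborel)"
    using hs_kernel_L2[OF k] by (rule L2_measurable)
  have um[measurable]: "u \<in> borel_measurable lborel" using u by (rule L2_measurable)
  have int: "integrable (lborel \<Otimes>\<^sub>M lborel) (\<lambda>(x, y). (k x y)\<^sup>2)"
    using L2_integrable[OF hs_kernel_L2[OF k]] by (simp add: case_prod_beta')
  have m: "kernel_op k u \<in> borel_measurable lborel"
    unfolding kernel_op_def[abs_def] l2_inner_def
    by (rule lborel.borel_measurable_lebesgue_integral) measurable
  have int1: "integrable lborel (\<lambda>x. (l2_norm lborel (k x))\<^sup>2)"
    unfolding l2_norm_sq by (rule lborel_pair.integrable_fst[OF int])
  have bd: "(kernel_op k u x)\<^sup>2 \<le> (l2_norm lborel (k x))\<^sup>2 * (l2_norm lborel u)\<^sup>2" for x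
  proof -
    have "\<bar>kernel_op k u x\<bar> \<le> l2_norm lborel (k x) * l2_norm lborel u"
      unfolding kernel_op_def using l2_cauchy_schwarz[OF hs_kernel_section[OF k] u] .
    then have "\<bar>kernel_op k u x\<bar>\<^sup>2 \<le> (l2_norm lborel (k x) * l2_norm lborel u)\<^sup>2"
      by (intro power_mono) auto
    then show ?thesis by (simp add: power_mult_distrib)
  qed
  have int2: "integrable lborel (\<lambda>x. (l2_norm lborel (k x))\<^sup>2 * (l2_norm lborel u)\<^sup>2)"
    using int1 by simp
  have int3: "integrable lborel (\<lambda>x. (kernel_op k u x)\<^sup>2)"
    by (rule integrable_dominated[OF int2]) (use m bd in auto)
  then show "kernel_op k u \<in> L2 lborel" using m by (simp add: L2_def)
  have "(l2_norm lborel (kernel_op k u))\<^sup>2 \<le> (LBINT x. (l2_norm lborel (k x))\<^sup>2 * (l2_norm lborel u)\<^sup>2)"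
    unfolding l2_norm_sq[of _ "kernel_op k u"] by (intro integral_mono int3 int2 bd)
  also have "\<dots> = (LBINT x. (l2_norm lborel (k x))\<^sup>2) * (l2_norm lborel u)\<^sup>2" by simp
  also have "(LBINT x. (l2_norm lborel (k x))\<^sup>2) = (hs_norm k)\<^sup>2"
    unfolding hs_norm_def l2_norm_sq
    using lborel_pair.integral_fst[OF int] by (simp add: case_prod_beta')
  finally show "l2_norm lborel (kernel_op k u) \<le> hs_norm k * l2_norm lborel u"
    unfolding power_mult_distrib[symmetric] by (rule power2_le_imp_le) simp
qed

lemma kernel_op_diff_kernel:
  assumes "hs_kernel k" "hs_kernel l" "u \<in> L2 lborel"
  shows "kernel_op (\<lambda>x y. k x y - l x y) u = (\<lambda>x. kernel_op k u x - kernel_op l u x)"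
  using assms(3) hs_kernel_section[OF assms(1)] hs_kernel_section[OF assms(2)]
  by (auto simp: kernel_op_def l2_inner_diff_left)

lemma kernel_op_diff:
  assumes "hs_kernel k" "u \<in> L2 lborel" "v \<in> L2 lborel"
  shows "kernel_op k (\<lambda>y. u y - v y) = (\<lambda>x. kernel_op k u x - kernel_op k v x)"
proof
  fix x
  show "kernel_op k (\<lambda>y. u y - v y) x = kernel_op k u x - kernel_op k v x"
    using l2_inner_diff_left[OF assms(2,3) hs_kernel_section[OF assms(1), of x]]
    by (simp add: kernel_op_def l2_inner_commute[of _ "k x"])
qed

lemma kernel_op_sum:
  assumes "hs_kernel k" "\<And>i. i \<in> I \<Longrightarrow> u i \<in> L2 lborel"
  shows "kernel_op k (\<lambda>y. \<Sum>i\<in>I. c i * u i y) = (\<lambda>x. \<Sum>i\<in>I. c i * kernel_op k (u i) x)"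
proof
  fix x
  show "kernel_op k (\<lambda>y. \<Sum>i\<in>I. c i * u i y) x = (\<Sum>i\<in>I. c i * kernel_op k (u i) x)"
    using l2_inner_sum_left[of I u lborel "k x" c] assms(2) hs_kernel_section[OF assms(1), of x]
    by (simp add: kernel_op_def l2_inner_commute[of _ "k x"])
qed

lemma kernel_op_perturb:
  assumes k: "hs_kernel k" and l: "hs_kernel l" and u: "u \<in> L2 lborel"
  shows "l2_norm lborel (kernel_op k u)
    \<le> l2_norm lborel (kernel_op l u) + hs_norm (\<lambda>x y. k x y - l x y) * l2_norm lborel u"
proof -
  have "l2_norm lborel (kernel_op k u) \<le> l2_norm lborel (kernel_op l u)
      + l2_norm lborel (\<lambda>x. kernel_op k u x - kernel_op l u x)"
    by (intro l2_norm_triangle_sub kernel_op_L2_norm assms)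
  also have "l2_norm lborel (\<lambda>x. kernel_op k u x - kernel_op l u x)
      \<le> hs_norm (\<lambda>x y. k x y - l x y) * l2_norm lborel u"
    using kernel_op_L2_norm(2)[OF hs_kernel_diff[OF k l] u] kernel_op_diff_kernel[OF k l u] by simp
  finally show ?thesis by simp
qed

lemma tendsto_kernel_op:
  assumes ev: "\<forall>\<^sub>F M in F. hs_kernel (k M)" "\<forall>\<^sub>F M in F. u M \<in> L2 lborel"
    and l: "hs_kernel l" and v: "v \<in> L2 lborel"
    and k: "((\<lambda>M. hs_norm (\<lambda>x y. k M x y - l x y)) \<longlongrightarrow> 0) F"
    and u: "((\<lambda>M. l2_norm lborel (\<lambda>x. u M x - v x)) \<longlongrightarrow> 0) F"
  shows "((\<lambda>M. l2_norm lborel (\<lambda>x. kernel_op (k M) (u M) x - kernel_op l v x)) \<longlongrightarrow> 0) F"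
proof (rule Lim_null_comparison)
  let ?d = "\<lambda>M. hs_norm (\<lambda>x y. k M x y - l x y)" and ?e = "\<lambda>M. l2_norm lborel (\<lambda>x. u M x - v x)"
  show "\<forall>\<^sub>F M in F. norm (l2_norm lborel (\<lambda>x. kernel_op (k M) (u M) x - kernel_op l v x))
      \<le> ?d M * (l2_norm lborel v + ?e M) + hs_norm l * ?e M"
    using ev
  proof eventually_elim
    case (elim M)
    let ?a = "kernel_op (\<lambda>x y. k M x y - l x y) (u M)" and ?b = "kernel_op l (\<lambda>x. u M x - v x)"
    have "(\<lambda>x. kernel_op (k M) (u M) x - kernel_op l v x) = (\<lambda>x. ?a x + ?b x)"
      using elim l v by (simp add: kernel_op_diff_kernel kernel_op_diff)
    moreover have "l2_norm lborel (\<lambda>x. ?a x + ?b x) \<le> l2_norm lborel ?a + l2_norm lborel ?b"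
      using elim l v by (intro l2_norm_triangle kernel_op_L2_norm hs_kernel_diff L2_diff)
    moreover have "l2_norm lborel ?a \<le> ?d M * l2_norm lborel (u M)"
      using elim l by (intro kernel_op_L2_norm hs_kernel_diff)
    moreover have "?d M * l2_norm lborel (u M) \<le> ?d M * (l2_norm lborel v + ?e M)"
      using elim v by (intro mult_left_mono l2_norm_triangle_sub) auto
    moreover have "l2_norm lborel ?b \<le> hs_norm l * ?e M"
      using elim l v by (intro kernel_op_L2_norm L2_diff)
    ultimately show ?case by simp
  qed
  show "((\<lambda>M. ?d M * (l2_norm lborel v + ?e M) + hs_norm l * ?e M) \<longlongrightarrow> 0) F"
    by (rule tendsto_eq_intros k u refl | simp)+
qed

section \<open>Hermite polynomials under the Gaussian law\<close>

text \<open>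
  The polynomial factor of the \<open>n\<close>-th derivative of \<open>exp (- t\<^sup>2 / 2)\<close>; the sign \<open>(- 1) ^ n\<close> of the
  leading coefficient is kept.
\<close>

fun hermite_poly :: "nat \<Rightarrow> real poly" where
  "hermite_poly 0 = 1"
| "hermite_poly (Suc n) = pderiv (hermite_poly n) - pCons 0 (hermite_poly n)"

lemma pderiv_hermite_poly: "pderiv (hermite_poly (Suc n)) = - smult (real (Suc n)) (hermite_poly n)"
proof (induction n)
  case 0
  then show ?case by (simp add: pderiv_pCons one_pCons pderiv_diff)
next
  case (Suc n)
  let ?h = "hermite_poly"
  have "pderiv (?h (Suc (Suc n))) = pderiv (pderiv (?h (Suc n))) - pderiv (pCons 0 (?h (Suc n)))"
    by (subst hermite_poly.simps) (simp only: pderiv_diff)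
  also have "pderiv (pderiv (?h (Suc n))) = - smult (real (Suc n)) (pderiv (?h n))"
    unfolding Suc by (simp add: pderiv_minus pderiv_smult)
  also have "pderiv (pCons 0 (?h (Suc n))) = ?h (Suc n) - pCons 0 (smult (real (Suc n)) (?h n))"
    unfolding pderiv_pCons Suc by simp
  also have "- smult (real (Suc n)) (pderiv (?h n)) - (?h (Suc n) - pCons 0 (smult (real (Suc n)) (?h n)))
      = - smult (real (Suc n)) (?h (Suc n)) - ?h (Suc n)"
  proof -
    have "smult (real (Suc n)) (?h (Suc n))
        = smult (real (Suc n)) (pderiv (?h n)) - pCons 0 (smult (real (Suc n)) (?h n))"
      unfolding hermite_poly.simps smult_diff_right by simp
    then show ?thesis by simp
  qed
  also have "\<dots> = - smult (real (Suc (Suc n))) (?h (Suc n))"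
  proof -
    have "real (Suc (Suc n)) = real (Suc n) + 1" by simp
    then show ?thesis by (simp only: smult_add_left smult_1_left minus_add_distrib diff_conv_add_uminus)
  qed
  finally show ?case .
qed

lemma hermite_poly_recurrence:
  "hermite_poly (Suc (Suc n)) = - pCons 0 (hermite_poly (Suc n)) - smult (real (Suc n)) (hermite_poly n)"
proof -
  have "hermite_poly (Suc (Suc n)) = pderiv (hermite_poly (Suc n)) - pCons 0 (hermite_poly (Suc n))"
    by (rule hermite_poly.simps)
  then show ?thesis unfolding pderiv_hermite_poly by (simp del: hermite_poly.simps)
qed

lemma deriv_funpow_gaussian:
  "(deriv ^^ n) (\<lambda>t::real. exp (- t\<^sup>2 / 2)) = (\<lambda>t. poly (hermite_poly n) t * exp (- t\<^sup>2 / 2))"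
proof (induction n)
  case (Suc n)
  have "deriv (\<lambda>t. poly (hermite_poly n) t * exp (- t\<^sup>2 / 2)) x
      = poly (hermite_poly (Suc n)) x * exp (- x\<^sup>2 / 2)" for x :: real
    by (rule DERIV_imp_deriv) (auto intro!: derivative_eq_intros simp: algebra_simps)
  then show ?case using Suc by auto
qed simp

lemma hermite_eq_poly: "hermite j x = poly (hermite_poly j) x / sqrt (fact j)"
proof -
  have "exp (x\<^sup>2 / 2) * exp (- x\<^sup>2 / 2) = 1" by (simp flip: exp_add)
  then have "exp (x\<^sup>2 / 2) * (poly (hermite_poly j) x * exp (- x\<^sup>2 / 2)) = poly (hermite_poly j) x"
    by (metis mult.left_commute mult.right_neutral)
  then show ?thesis
    unfolding hermite_def deriv_funpow_gaussian by (simp only: mult.assoc) simp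
qed

definition gauss_expect :: "(real \<Rightarrow> real) \<Rightarrow> real" where
  "gauss_expect f = (LBINT x. std_normal_density x * f x)"

lemma integrable_gauss_poly: "integrable lborel (\<lambda>x. std_normal_density x * poly p x)"
proof -
  have "integrable lborel (\<lambda>x. \<Sum>i\<le>degree p. coeff p i * (std_normal_density x * x ^ i))"
    by (intro Bochner_Integration.integrable_sum integrable_mult_right integrable_std_normal_moment)
  moreover have "(\<lambda>x. \<Sum>i\<le>degree p. coeff p i * (std_normal_density x * x ^ i))
      = (\<lambda>x. std_normal_density x * poly p x)"
    by (auto simp: poly_altdef sum_distrib_left algebra_simps)
  ultimately show ?thesis by simp
qed

lemma gauss_expect_poly:
  "gauss_expect (poly (p + q)) = gauss_expect (poly p) + gauss_expect (poly q)"
  "gauss_expect (poly (p - q)) = gauss_expect (poly p) - gauss_expect (poly q)"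
  "gauss_expect (poly (- p)) = - gauss_expect (poly p)"
  "gauss_expect (poly (smult c p)) = c * gauss_expect (poly p)"
  "gauss_expect (poly [:c:]) = c"
  by (simp_all add: gauss_expect_def distrib_left right_diff_distrib integrable_gauss_poly
      mult.left_commute[of _ c])

lemma gauss_expect_cmult: "gauss_expect (\<lambda>x. c * f x) = c * gauss_expect f"
  by (simp add: gauss_expect_def mult.left_commute[of _ c])

text \<open>Integration by parts for monomials, read off from the closed forms of the Gaussian moments.\<close>

lemma gauss_moment_step:
  "gauss_expect (\<lambda>x. x ^ Suc (Suc n)) = real (Suc n) * gauss_expect (\<lambda>x. x ^ n)"
proof (cases "even n")
  case True
  then obtain k where n: "n = 2 * k" by (elim evenE)
  have "Suc (Suc n) = 2 * Suc k" using n by simp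
  have "fact (2 * Suc k) / (2 ^ Suc k * fact (Suc k))
      = (2 * (real k + 1)) * ((2 * real k + 1) * fact (2 * k)) / ((2 * (real k + 1)) * (2 ^ k * fact k))"
    by (simp add: algebra_simps)
  also have "\<dots> = (2 * real k + 1) * fact (2 * k) / (2 ^ k * fact k)"
    by (rule mult_divide_mult_cancel_left) (simp add: add_nonneg_eq_0_iff)
  finally have "fact (2 * Suc k) / (2 ^ Suc k * fact (Suc k))
      = real (Suc n) * (fact (2 * k) / (2 ^ k * fact k))" by (simp add: n)
  then show ?thesis
    unfolding gauss_expect_def \<open>Suc (Suc n) = 2 * Suc k\<close>
    unfolding n integral_std_normal_moment_even .
next
  case False
  then obtain k where n: "n = 2 * k + 1" by (elim oddE)
  have "Suc (Suc n) = 2 * Suc k + 1" using n by simp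
  then show ?thesis
    unfolding gauss_expect_def n
    by (simp only: integral_std_normal_moment_odd mult_zero_right)
qed

lemma stein_identity: "gauss_expect (poly (pCons 0 p)) = gauss_expect (poly (pderiv p))"
proof -
  define S where "S q \<longleftrightarrow> gauss_expect (poly (pCons 0 q)) = gauss_expect (poly (pderiv q))" for q
  have mono: "S (monom 1 n)" for n
  proof -
    have p: "poly (monom c k) = (\<lambda>x. c * x ^ k)" for c :: real and k by (auto simp: poly_monom)
    show ?thesis
    proof (cases n)
      case 0
      then show ?thesis using integral_std_normal_moment_odd[of 0]
        by (simp add: S_def gauss_expect_def pderiv_monom monom_0)
    next
      case (Suc m)
      then show ?thesis using gauss_moment_step[of m]
        by (simp add: S_def pderiv_monom p gauss_expect_cmult flip: monom_Suc)
    qed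
  qed
  have lin: "S (smult a q + r)" if "S q" "S r" for a q r
  proof -
    have "pCons 0 (smult a q + r) = smult a (pCons 0 q) + pCons 0 r" by simp
    then show ?thesis using that by (simp only: S_def pderiv_add pderiv_smult gauss_expect_poly)
  qed
  have "\<forall>n. S (monom 1 n * p)"
  proof (induction p)
    case 0
    show ?case by (simp add: S_def)
  next
    case (pCons a p)
    have "monom 1 n * pCons a p = smult a (monom 1 n) + monom 1 (Suc n) * p" for n
      by (simp add: monom_Suc)
    then show ?case using pCons.IH by (simp only: lin mono simp_thms)
  qed
  then have "S (monom 1 0 * p)" by blast
  then show ?thesis by (simp add: S_def monom_0)
qed

text \<open>
  The recursion for \<open>hermite_poly\<close> is the adjoint of differentiation with respect to the Gaussian law, by
  Stein's identity. Moving derivatives across one at a time gives the orthogonality relations.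
\<close>

lemma hermite_poly_ibp:
  "gauss_expect (poly (hermite_poly (Suc n) * q)) = - gauss_expect (poly (hermite_poly n * pderiv q))"
proof -
  let ?h = "hermite_poly n"
  have "hermite_poly (Suc n) * q = pderiv ?h * q - pCons 0 (?h * q)"
    by (simp add: left_diff_distrib)
  then show ?thesis
    by (simp only: gauss_expect_poly stein_identity pderiv_mult mult.commute[of q] diff_add_eq_diff_diff_swap diff_self diff_0)
qed

lemma hermite_poly_orthogonal:
  "gauss_expect (poly (hermite_poly i * hermite_poly j)) = (if i = j then fact i else 0)"
proof (induction i arbitrary: j)
  case 0
  show ?case
  proof (cases j)
    case 0
    then show ?thesis by (simp add: gauss_expect_def)
  next
    case (Suc k)
    then show ?thesis using hermite_poly_ibp[of k 1] by (simp add: gauss_expect_def)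
  qed
next
  case (Suc i)
  show ?case
  proof (cases j)
    case 0
    then show ?thesis using hermite_poly_ibp[of i 1] by (simp add: gauss_expect_def)
  next
    case (Suc k)
    have "gauss_expect (poly (hermite_poly (Suc i) * hermite_poly j))
        = - gauss_expect (poly (hermite_poly i * - smult (real (Suc k)) (hermite_poly k)))"
      unfolding hermite_poly_ibp Suc pderiv_hermite_poly ..
    also have "\<dots> = real (Suc k) * gauss_expect (poly (hermite_poly i * hermite_poly k))"
      by (simp only: mult_minus_right mult_smult_right gauss_expect_poly minus_minus)
    also have "\<dots> = (if Suc i = j then fact (Suc i) else 0)"
      unfolding Suc.IH by (simp add: Suc)
    finally show ?thesis .
  qed
qed

lemma hermite_orthonormal:
  "gauss_expect (\<lambda>x. hermite i x * hermite j x) = (if i = j then 1 else 0)"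
proof -
  have "gauss_expect (\<lambda>x. hermite i x * hermite j x)
      = gauss_expect (\<lambda>x. (1 / (sqrt (fact i) * sqrt (fact j))) * poly (hermite_poly i * hermite_poly j) x)"
    by (simp add: hermite_eq_poly)
  then show ?thesis
    unfolding gauss_expect_cmult hermite_poly_orthogonal by simp
qed

text \<open>
  Hermite polynomials are eigenfunctions of the Ornstein--Uhlenbeck semigroup. The expectation satisfies the
  three-term recurrence of \<open>\<rho> ^ n * hermite_poly n\<close>: the factor \<open>z\<close> produced by the recurrence is removed by
  Stein's identity, which costs a factor \<open>1 - \<rho>\<^sup>2\<close> and one degree.
\<close>

lemma hermite_smoothing_poly:
  assumes "0 \<le> \<rho>" "\<rho> \<le> 1"
  shows "gauss_expect (\<lambda>z. poly (hermite_poly n) (\<rho> * y + sqrt (1 - \<rho>\<^sup>2) * z)) = \<rho> ^ n * poly (hermite_poly n) y"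
proof -
  let ?s = "sqrt (1 - \<rho>\<^sup>2)"
  have s2: "?s * ?s = 1 - \<rho>\<^sup>2"
    using assms by (simp add: power_le_one)
  define L where "L = [:\<rho> * y, ?s:]"
  let ?h = "\<lambda>n. pcompose (hermite_poly n) L"
  define E where "E n = gauss_expect (poly (?h n))" for n
  have E: "E n = gauss_expect (\<lambda>z. poly (hermite_poly n) (\<rho> * y + ?s * z))" for n
    unfolding E_def L_def
    by (intro arg_cong[where f=gauss_expect] ext) (simp add: poly_pcompose mult.commute)
  have L: "L * q = smult (\<rho> * y) q + pCons 0 (smult ?s q)" for q by (simp add: L_def)
  have E0: "E 0 = 1" using gauss_expect_poly(5)[of 1] by (simp add: E_def pcompose_1 one_pCons)
  have "?h (Suc 0) = - (L * 1)" by (simp add: one_pCons pcompose_diff pcompose_pCons)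
  then have "E (Suc 0) = - (\<rho> * y * gauss_expect (poly 1) + gauss_expect (poly (pderiv (smult ?s 1))))"
    unfolding E_def L by (simp only: gauss_expect_poly stein_identity)
  then have E1: "E (Suc 0) = - \<rho> * y"
    using gauss_expect_poly(5)[of 1] gauss_expect_poly(5)[of 0]
    by (simp add: one_pCons pderiv_smult pderiv_pCons)
  have step: "E (Suc (Suc n)) = - \<rho> * y * E (Suc n) - \<rho>\<^sup>2 * real (Suc n) * E n" for n
  proof -
    have "?h (Suc (Suc n)) = - (L * ?h (Suc n)) - smult (real (Suc n)) (?h n)"
      unfolding hermite_poly_recurrence
      by (simp add: pcompose_diff pcompose_uminus pcompose_pCons pcompose_smult del: hermite_poly.simps)
    moreover have "pderiv (smult c (?h (Suc n))) = smult (- (c * ?s) * real (Suc n)) (?h n)" for c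
      unfolding pderiv_smult pderiv_pcompose pderiv_hermite_poly
      by (simp add: L_def pderiv_pCons pcompose_smult pcompose_uminus ac_simps)
    ultimately have "E (Suc (Suc n))
        = - (\<rho> * y * E (Suc n) - (?s * ?s) * real (Suc n) * E n) - real (Suc n) * E n"
      unfolding E_def L by (simp only: gauss_expect_poly stein_identity) simp
    then show ?thesis unfolding s2 by (simp add: algebra_simps)
  qed
  have "E n = \<rho> ^ n * poly (hermite_poly n) y \<and> E (Suc n) = \<rho> ^ Suc n * poly (hermite_poly (Suc n)) y"
  proof (induction n)
    case 0
    then show ?case by (simp add: E0 E1)
  next
    case (Suc n)
    then show ?case unfolding step hermite_poly_recurrence
      by (simp add: algebra_simps power2_eq_square del: hermite_poly.simps)
  qed
  then show ?thesis by (simp add: E)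
qed

section \<open>Kernels with known singular functions\<close>

lemma hs_kernel_tensor:
  assumes f: "f \<in> L2 lborel" and g: "g \<in> L2 lborel"
  shows "hs_kernel (\<lambda>x y. f x * g y)"
proof -
  have m[measurable]: "f \<in> borel_measurable lborel" "g \<in> borel_measurable lborel"
    using f g by (auto simp: L2_def)
  have "integrable (lborel \<Otimes>\<^sub>M lborel) (\<lambda>(x, y). (f x)\<^sup>2 * (g y)\<^sup>2)"
  proof (rule lborel_pair.Fubini_integrable)
    show "AE x in lborel. integrable lborel (\<lambda>y. case (x, y) of (x, y) \<Rightarrow> (f x)\<^sup>2 * (g y)\<^sup>2)"
      using L2_integrable[OF g] by simp
    show "integrable lborel (\<lambda>x. LINT y|lborel. norm (case (x, y) of (x, y) \<Rightarrow> (f x)\<^sup>2 * (g y)\<^sup>2))"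
      using L2_integrable[OF f] by simp
  qed measurable
  then have "integrable (lborel \<Otimes>\<^sub>M lborel) (\<lambda>z. (case z of (x, y) \<Rightarrow> f x * g y)\<^sup>2)"
    by (simp add: case_prod_beta' power_mult_distrib)
  then show ?thesis
    unfolding hs_kernel_def using L2_scale[OF g] by (auto simp: L2_def)
qed

lemma kernel_op_tensor: "kernel_op (\<lambda>x y. f x * g y) h = (\<lambda>x. l2_inner lborel g h * f x)"
  by (rule ext) (simp add: kernel_op_def l2_inner_scale_left mult.commute)

text \<open>Pairing a kernel with a tensor product computes a matrix entry of its operator.\<close>

lemma l2_inner_tensor:
  assumes f: "f \<in> L2 lborel" and g: "g \<in> L2 lborel" and k: "hs_kernel k"
  shows "l2_inner (lborel \<Otimes>\<^sub>M lborel) (\<lambda>(x, y). f x * g y) (\<lambda>(x, y). k x y)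
    = l2_inner lborel f (kernel_op k g)"
proof -
  have "integrable (lborel \<Otimes>\<^sub>M lborel) (\<lambda>(x, y). f x * g y * k x y)"
    using L2_mult_integrable[OF hs_kernel_L2[OF hs_kernel_tensor[OF f g]] hs_kernel_L2[OF k]]
    by (simp add: case_prod_beta')
  from lborel_pair.integral_fst[OF this] show ?thesis
    by (simp add: l2_inner_def kernel_op_def case_prod_beta' algebra_simps)
qed

lemma hs_kernel_sum:
  assumes "\<And>i. i \<in> I \<Longrightarrow> hs_kernel (k i)"
  shows "hs_kernel (\<lambda>x y. \<Sum>i\<in>I. c i * k i x y)"
proof -
  have "(\<lambda>z. \<Sum>i\<in>I. c i * (case z of (x, y) \<Rightarrow> k i x y)) \<in> L2 (lborel \<Otimes>\<^sub>M lborel)"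
    using assms by (intro L2_sum L2_scale hs_kernel_L2)
  moreover have "(\<lambda>y. \<Sum>i\<in>I. c i * k i x y) \<in> L2 lborel" for x
    using assms hs_kernel_section by (intro L2_sum L2_scale) blast
  ultimately show ?thesis by (simp add: hs_kernel_def case_prod_beta')
qed

text \<open>
  The truncations \<open>\<Sum>j<N. \<rho> ^ j f\<^sub>j \<otimes> e\<^sub>j\<close> are the orthogonal projections of \<open>k\<close> in the Hilbert--Schmidt
  inner product, so their squared distance to \<open>k\<close> is \<open>1 / (1 - \<rho>\<^sup>2) - (\<Sum>j<N. \<rho> ^ (2 * j))\<close>, which tends to
  \<open>0\<close>. Each truncation satisfies the bound by Bessel's inequality, since \<open>\<rho> ^ (2 * j) \<le> \<rho> ^ (2 * p)\<close> from
  index \<open>p\<close> on, and the bound passes to the limit.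
\<close>

lemma kernel_op_spectral_bound:
  fixes \<rho> :: real
  assumes k: "hs_kernel k" and rho: "0 \<le> \<rho>" "\<rho> < 1"
    and e: "\<And>j. e j \<in> L2 lborel" "\<And>i j. l2_inner lborel (e i) (e j) = (if i = j then 1 else 0)"
    and f: "\<And>j. f j \<in> L2 lborel" "\<And>i j. l2_inner lborel (f i) (f j) = (if i = j then 1 else 0)"
    and ke: "\<And>j. kernel_op k (e j) = (\<lambda>x. \<rho> ^ j * f j x)"
    and hs: "(hs_norm k)\<^sup>2 = 1 / (1 - \<rho>\<^sup>2)"
    and u: "u \<in> L2 lborel"
  shows "(l2_norm lborel (kernel_op k u))\<^sup>2
    \<le> \<rho> ^ (2 * p) * (l2_norm lborel u)\<^sup>2 + (\<Sum>j<p. (l2_inner lborel u (e j))\<^sup>2)"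
proof -
  let ?P = "lborel \<Otimes>\<^sub>M lborel :: (real \<times> real) measure"
  let ?c = "\<lambda>j. l2_inner lborel u (e j)"
  let ?B = "\<rho> ^ (2 * p) * (l2_norm lborel u)\<^sup>2 + (\<Sum>j<p. (?c j)\<^sup>2)"
  define t where "t j = (\<lambda>x y. f j x * e j y)" for j
  define kN where "kN N = (\<lambda>x y. \<Sum>j<N. \<rho> ^ j * t j x y)" for N
  have t: "hs_kernel (t j)" for j
    unfolding t_def by (intro hs_kernel_tensor e f)
  have kN: "hs_kernel (kN N)" for N
    unfolding kN_def by (intro hs_kernel_sum t)
  have tt: "l2_inner ?P (\<lambda>(x, y). t i x y) (\<lambda>(x, y). t j x y) = (if i = j then 1 else 0)" for i j
    unfolding t_def
    by (subst l2_inner_tensor)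
      (auto simp: e f kernel_op_tensor l2_inner_commute[of _ "f _" "\<lambda>x. _ * f _ x"] l2_inner_scale_left
        intro!: hs_kernel_tensor)
  have tk: "l2_inner ?P (\<lambda>(x, y). t j x y) (\<lambda>(x, y). k x y) = \<rho> ^ j" for j
    unfolding t_def
    by (subst l2_inner_tensor)
      (auto simp: e f k ke l2_inner_commute[of _ "f _" "\<lambda>x. _ * f _ x"] l2_inner_scale_left)
  have kN_eq: "(\<lambda>(x, y). kN N x y) = (\<lambda>z. \<Sum>j<N. \<rho> ^ j * (\<lambda>(x, y). t j x y) z)" for N
    by (auto simp: kN_def)
  define q where "q = \<rho>\<^sup>2"
  have q: "0 \<le> q" "q < 1" using rho by (auto simp: q_def abs_square_less_1)
  have sumq: "(\<Sum>j<N. q ^ j) = (1 - q ^ N) / (1 - q)" for N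
    using q by (subst geometric_sum) (auto simp: field_simps)
  have rq: "\<rho> ^ j * \<rho> ^ j = q ^ j" for j by (simp add: q_def power2_eq_square power_mult_distrib)
  have dist: "(hs_norm (\<lambda>x y. k x y - kN N x y))\<^sup>2 = q ^ N / (1 - q)" for N
  proof -
    have "(hs_norm (\<lambda>x y. k x y - kN N x y))\<^sup>2
        = (l2_norm ?P (\<lambda>z. (\<lambda>(x, y). k x y) z - (\<lambda>(x, y). kN N x y) z))\<^sup>2"
      by (simp add: hs_norm_def case_prod_beta')
    also have "\<dots> = 1 / (1 - q) - 2 * l2_inner ?P (\<lambda>(x, y). k x y) (\<lambda>(x, y). kN N x y)
        + (l2_norm ?P (\<lambda>(x, y). kN N x y))\<^sup>2"
      unfolding l2_norm_sq_diff[OF hs_kernel_L2[OF k] hs_kernel_L2[OF kN]]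
      using hs by (simp add: hs_norm_def q_def)
    also have "l2_inner ?P (\<lambda>(x, y). k x y) (\<lambda>(x, y). kN N x y) = (\<Sum>j<N. q ^ j)"
      unfolding kN_eq
      by (subst l2_inner_commute, subst l2_inner_sum_left) (auto simp: t k hs_kernel_L2 tk rq)
    also have "(l2_norm ?P (\<lambda>(x, y). kN N x y))\<^sup>2 = (\<Sum>j<N. q ^ j)"
      unfolding kN_eq
      by (subst l2_norm_sq_sum)
        (auto simp: t hs_kernel_L2 tt rq if_distrib[of "\<lambda>x. _ * x"] sum.delta cong: if_cong)
    finally show ?thesis unfolding sumq by (simp add: diff_divide_distrib)
  qed
  have normN: "(l2_norm lborel (kernel_op (kN N) u))\<^sup>2 \<le> ?B" for N
  proof -
    have "kernel_op (kN N) u = (\<lambda>x. \<Sum>j<N. (\<rho> ^ j * ?c j) * f j x)"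
    proof
      fix x
      have "kernel_op (kN N) u x = (\<Sum>j<N. \<rho> ^ j * l2_inner lborel (t j x) u)"
        unfolding kernel_op_def kN_def
        by (rule l2_inner_sum_left) (auto simp: u hs_kernel_section t)
      then show "kernel_op (kN N) u x = (\<Sum>j<N. (\<rho> ^ j * ?c j) * f j x)"
        unfolding t_def l2_inner_scale_left by (simp add: l2_inner_commute[of _ u] ac_simps)
    qed
    then have "(l2_norm lborel (kernel_op (kN N) u))\<^sup>2
        = (\<Sum>i<N. \<Sum>j<N. (\<rho> ^ i * ?c i) * (\<rho> ^ j * ?c j) * l2_inner lborel (f i) (f j))"
      using f by (simp only: l2_norm_sq_sum)
    also have "\<dots> = (\<Sum>i<N. \<Sum>j<N. if i = j then (\<rho> ^ i * ?c i)\<^sup>2 else 0)"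
      by (intro sum.cong refl) (simp add: f power2_eq_square)
    also have "\<dots> = (\<Sum>j<N. (\<rho> ^ j * ?c j)\<^sup>2)"
      by (simp add: sum.delta)
    also have "\<dots> = (\<Sum>j<N. q ^ j * (?c j)\<^sup>2)"
      by (simp add: power_mult_distrib q_def power_mult[symmetric] mult.commute)
    also have "\<dots> \<le> (\<Sum>j<N. q ^ p * (?c j)\<^sup>2 + (if j < p then (?c j)\<^sup>2 else 0))"
    proof (rule sum_mono)
      fix j assume "j \<in> {..<N}"
      show "q ^ j * (?c j)\<^sup>2 \<le> q ^ p * (?c j)\<^sup>2 + (if j < p then (?c j)\<^sup>2 else 0)"
      proof (cases "j < p")
        case True
        have "q ^ j * (?c j)\<^sup>2 \<le> 1 * (?c j)\<^sup>2"
          using q by (intro mult_right_mono power_le_one) auto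
        moreover have "0 \<le> q ^ p * (?c j)\<^sup>2" using q by simp
        ultimately show ?thesis using True by simp
      next
        case False
        then show ?thesis using q by (simp add: mult_right_mono power_decreasing)
      qed
    qed
    also have "\<dots> = q ^ p * (\<Sum>j<N. (?c j)\<^sup>2) + (\<Sum>j<N. if j < p then (?c j)\<^sup>2 else 0)"
      by (simp add: sum.distrib sum_distrib_left)
    also have "\<dots> \<le> q ^ p * (l2_norm lborel u)\<^sup>2 + (\<Sum>j<p. (?c j)\<^sup>2)"
    proof (intro add_mono mult_left_mono)
      show "(\<Sum>j<N. (?c j)\<^sup>2) \<le> (l2_norm lborel u)\<^sup>2"
        using e u by (intro bessel_inequality) auto
      have "(\<Sum>j<N. if j < p then (?c j)\<^sup>2 else 0) = (\<Sum>j\<in>{..<N} \<inter> {..<p}. (?c j)\<^sup>2)"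
        by (simp add: sum.If_cases lessThan_def Int_def)
      also have "\<dots> \<le> (\<Sum>j<p. (?c j)\<^sup>2)" by (intro sum_mono2) auto
      finally show "(\<Sum>j<N. if j < p then (?c j)\<^sup>2 else 0) \<le> (\<Sum>j<p. (?c j)\<^sup>2)" .
    qed (use q in auto)
    finally show ?thesis by (simp add: q_def power_mult[symmetric])
  qed
  have B: "0 \<le> ?B" by (intro add_nonneg_nonneg sum_nonneg) (auto simp: rho)
  have "l2_norm lborel (kernel_op k u) \<le> sqrt ?B + sqrt (q ^ N / (1 - q)) * l2_norm lborel u" for N
  proof -
    have "l2_norm lborel (kernel_op (kN N) u) \<le> sqrt ?B"
      by (rule real_le_rsqrt) (rule normN)
    moreover have "hs_norm (\<lambda>x y. k x y - kN N x y) = sqrt (q ^ N / (1 - q))"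
      using dist[of N] by (metis hs_norm_nonneg real_sqrt_unique)
    ultimately show ?thesis using kernel_op_perturb[OF k kN u, of N] by simp
  qed
  moreover have "(\<lambda>N. sqrt ?B + sqrt (q ^ N / (1 - q)) * l2_norm lborel u)
      \<longlonglongrightarrow> sqrt ?B + sqrt (0 / (1 - q)) * l2_norm lborel u"
    using q by (intro tendsto_intros LIMSEQ_power_zero) auto
  ultimately have "l2_norm lborel (kernel_op k u) \<le> sqrt ?B"
    by (intro LIMSEQ_le_const[of "\<lambda>N. sqrt ?B + sqrt (q ^ N / (1 - q)) * l2_norm lborel u"]) auto
  then have "(l2_norm lborel (kernel_op k u))\<^sup>2 \<le> (sqrt ?B)\<^sup>2"
    by (intro power_mono) auto
  then show ?thesis using B by simp
qed

section \<open>The Gaussian channel\<close>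

text \<open>
  The square root of the normal density makes the Hermite polynomials orthonormal in \<open>L\<^sup>2\<close> of Lebesgue measure.
\<close>

definition hermite_fun :: "real \<Rightarrow> nat \<Rightarrow> real \<Rightarrow> real" where
  "hermite_fun s j x = sqrt (normal_density 0 s x) * hermite j (x / s)"

text \<open>
  The channel \<open>X = \<mu> + noise\<close> as an operator between unweighted \<open>L\<^sup>2\<close> spaces: \<open>\<mu>\<close> has variance \<open>s\<^sup>2\<close> and
  \<open>X\<close> has variance \<open>1 + s\<^sup>2\<close>, and the square roots of both densities are absorbed in the kernel.
\<close>

definition gauss_kernel :: "real \<Rightarrow> real \<Rightarrow> real \<Rightarrow> real" where
  "gauss_kernel s x \<mu> = std_normal_density (x - \<mu>) * sqrt (normal_density 0 s \<mu>)
     / sqrt (normal_density 0 (sqrt (1 + s\<^sup>2)) x)"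

lemma hermite_measurable [measurable]: "hermite j \<in> borel_measurable borel"
  unfolding hermite_eq_poly[abs_def]
  by (intro borel_measurable_continuous_onI continuous_intros) auto

lemma hermite_fun_measurable [measurable]: "hermite_fun s j \<in> borel_measurable borel"
  unfolding hermite_fun_def[abs_def] by measurable

lemma gauss_kernel_measurable [measurable]:
  "(\<lambda>(x, y). gauss_kernel s x y) \<in> borel_measurable (borel \<Otimes>\<^sub>M borel)"
  unfolding gauss_kernel_def by measurable

lemma normal_density_scale:
  assumes "0 < s"
  shows "s * normal_density 0 s (s * x) = std_normal_density x"
  using assms by (simp add: normal_density_def real_sqrt_mult power_mult_distrib)

lemma
  assumes s: "0 < s"
  shows integral_normal_scaled: "(LBINT x. normal_density 0 s x * f (x / s)) = gauss_expect f"
    and integrable_normal_scaled: "integrable lborel (\<lambda>x. normal_density 0 s x * f (x / s))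
      \<longleftrightarrow> integrable lborel (\<lambda>x. std_normal_density x * f x)"
proof -
  have eq: "normal_density 0 s (s * x) = std_normal_density x / s" for x
    using normal_density_scale[OF s, of x] s by (simp add: field_simps)
  show "(LBINT x. normal_density 0 s x * f (x / s)) = gauss_expect f"
    using s by (subst lborel_integral_real_affine[where c=s and t=0]) (auto simp: eq gauss_expect_def)
  have "integrable lborel (\<lambda>x. normal_density 0 s x * f (x / s))
      \<longleftrightarrow> integrable lborel (\<lambda>x. 1 / s * (std_normal_density x * f x))"
    using s lborel_integrable_real_affine_iff[of s "\<lambda>x. normal_density 0 s x * f (x / s)" 0]
    by (simp add: eq)
  moreover have "integrable lborel (\<lambda>x. 1 / s * (std_normal_density x * f x))
      \<longleftrightarrow> integrable lborel (\<lambda>x. std_normal_density x * f x)"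
    using s integrable_mult_left_iff[of lborel "1 / s" "\<lambda>x. std_normal_density x * f x"] by simp
  ultimately show "integrable lborel (\<lambda>x. normal_density 0 s x * f (x / s))
      \<longleftrightarrow> integrable lborel (\<lambda>x. std_normal_density x * f x)"
    by simp
qed

lemma integrable_hermite_mult: "integrable lborel (\<lambda>x. std_normal_density x * (hermite i x * hermite j x))"
proof -
  have "integrable lborel (\<lambda>x. (1 / (sqrt (fact i) * sqrt (fact j)))
      * (std_normal_density x * poly (hermite_poly i * hermite_poly j) x))"
    by (intro integrable_mult_right integrable_gauss_poly)
  then show ?thesis by (simp add: hermite_eq_poly mult.commute)
qed

lemma hermite_fun_mult:
  "hermite_fun s i x * hermite_fun s j x = normal_density 0 s x * (hermite i (x / s) * hermite j (x / s))"
  by (simp add: hermite_fun_def algebra_simps flip: real_sqrt_mult)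

lemma hermite_fun_L2: "0 < s \<Longrightarrow> hermite_fun s j \<in> L2 lborel"
  using integrable_normal_scaled[of s "\<lambda>x. hermite j x * hermite j x"] integrable_hermite_mult[of j j]
  by (simp add: L2_def power2_eq_square hermite_fun_mult)

lemma hermite_fun_orthonormal:
  "0 < s \<Longrightarrow> l2_inner lborel (hermite_fun s i) (hermite_fun s j) = (if i = j then 1 else 0)"
  using integral_normal_scaled[of s "\<lambda>x. hermite i x * hermite j x"]
  by (simp add: l2_inner_def hermite_fun_mult hermite_orthonormal)

context
  fixes s \<tau> \<rho> :: real
  assumes s: "0 < s" and tau: "\<tau> = sqrt (1 + s\<^sup>2)" and rho: "\<rho> = s / \<tau>"
begin

lemma tau_pos: "0 < \<tau>" and tau_sq: "\<tau>\<^sup>2 = 1 + s\<^sup>2"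
  using s by (auto simp: tau add_pos_nonneg)

lemma rho_sq: "\<rho>\<^sup>2 = 1 - 1 / \<tau>\<^sup>2"
proof -
  have "\<rho>\<^sup>2 = (\<tau>\<^sup>2 - 1) / \<tau>\<^sup>2" by (simp add: rho power_divide tau_sq)
  then show ?thesis using tau_pos by (simp add: diff_divide_distrib)
qed

lemma rho_bounds: "0 < \<rho>" "\<rho> < 1"
proof -
  show "0 < \<rho>" using s tau_pos by (simp add: rho)
  have "s\<^sup>2 < \<tau>\<^sup>2" using tau_sq by simp
  then have "s < \<tau>" using tau_pos by (simp add: power2_less_imp_less)
  then show "\<rho> < 1" using tau_pos by (simp add: rho)
qed

text \<open>
  Completing the square: given \<open>X = x\<close>, the posterior of \<open>\<mu>\<close> is normal with mean \<open>\<rho>\<^sup>2 x\<close> and variance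
  \<open>\<rho>\<^sup>2\<close>.
\<close>

lemma normal_density_bayes:
  "std_normal_density (x - \<mu>) * normal_density 0 s \<mu>
    = normal_density 0 \<tau> x * normal_density (\<rho>\<^sup>2 * x) \<rho> \<mu>"
proof -
  have pos: "0 < s\<^sup>2" "0 < \<tau>\<^sup>2" "0 < \<rho>\<^sup>2"
    using s tau_pos rho_bounds by auto
  have prod: "\<tau>\<^sup>2 * \<rho>\<^sup>2 = s\<^sup>2" using tau_pos by (simp add: rho power_divide)
  have "sqrt (2 * pi * 1\<^sup>2) * sqrt (2 * pi * s\<^sup>2) = sqrt (2 * pi * \<tau>\<^sup>2) * sqrt (2 * pi * \<rho>\<^sup>2)"
    unfolding real_sqrt_mult[symmetric] prod[symmetric] by (simp add: ac_simps)
  moreover have "- ((x - \<mu>) - 0)\<^sup>2 / (2 * 1\<^sup>2) + - (\<mu> - 0)\<^sup>2 / (2 * s\<^sup>2)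
      = - (x - 0)\<^sup>2 / (2 * \<tau>\<^sup>2) + - (\<mu> - \<rho>\<^sup>2 * x)\<^sup>2 / (2 * \<rho>\<^sup>2)"
  proof -
    have "(\<mu> - \<rho>\<^sup>2 * x)\<^sup>2 / (2 * \<rho>\<^sup>2)
        = \<mu>\<^sup>2 * (1 / \<rho>\<^sup>2) / 2 - \<mu> * x + \<rho>\<^sup>2 * x\<^sup>2 / 2"
      using rho_bounds(1) by (simp add: power2_eq_square algebra_simps add_divide_distrib diff_divide_distrib)
    also have "1 / \<rho>\<^sup>2 = 1 / s\<^sup>2 + 1"
    proof -
      have "1 / \<rho>\<^sup>2 = \<tau>\<^sup>2 / s\<^sup>2" using pos prod[symmetric] by simp
      then show ?thesis using pos(1) by (simp add: tau_sq add_divide_distrib)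
    qed
    finally show ?thesis unfolding rho_sq by (simp add: power2_diff algebra_simps add_divide_distrib diff_divide_distrib)
  qed
  ultimately show ?thesis
    unfolding normal_density_def
    by (simp only: times_divide_times_eq mult_1_left mult.assoc[symmetric] exp_add[symmetric]
        times_divide_eq_left times_divide_eq_right divide_divide_eq_left)
qed

lemma normal_density_shift: "normal_density m t x = normal_density 0 t (x - m)"
  by (simp add: normal_density_def)

text \<open>
  After completing the square, standardising \<open>\<mu>\<close> under the posterior turns \<open>\<mu> / s\<close> into
  \<open>\<rho> * (x / \<tau>) + sqrt (1 - \<rho>\<^sup>2) * z\<close>, which is an Ornstein--Uhlenbeck step.
\<close>

lemma hermite_smoothing:
  "(LBINT \<mu>. std_normal_density (x - \<mu>) * normal_density 0 s \<mu> * hermite j (\<mu> / s))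
    = \<rho> ^ j * (normal_density 0 \<tau> x * hermite j (x / \<tau>))"
proof -
  have r: "sqrt (1 - \<rho>\<^sup>2) = 1 / \<tau>"
    using tau_pos by (simp add: rho_sq real_sqrt_divide)
  have arg: "(\<rho>\<^sup>2 * x + \<rho> * z) / s = \<rho> * (x / \<tau>) + sqrt (1 - \<rho>\<^sup>2) * z" for z
    unfolding r using s tau_pos by (simp add: rho field_simps power2_eq_square)
  have "(LBINT \<mu>. std_normal_density (x - \<mu>) * normal_density 0 s \<mu> * hermite j (\<mu> / s))
      = normal_density 0 \<tau> x * (LBINT \<mu>. normal_density 0 \<rho> (\<mu> - \<rho>\<^sup>2 * x) * hermite j (\<mu> / s))"
    by (simp add: normal_density_bayes mult.assoc normal_density_shift[of "\<rho>\<^sup>2 * x"])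
  also have "(LBINT \<mu>. normal_density 0 \<rho> (\<mu> - \<rho>\<^sup>2 * x) * hermite j (\<mu> / s))
      = (LBINT z. \<rho> * normal_density 0 \<rho> (\<rho> * z) * hermite j (\<rho> * (x / \<tau>) + sqrt (1 - \<rho>\<^sup>2) * z))"
    unfolding arg[symmetric] using rho_bounds
    by (subst lborel_integral_real_affine[where c=\<rho> and t="\<rho>\<^sup>2 * x"]) (auto simp: mult.assoc)
  also have "\<dots> = gauss_expect (\<lambda>z. hermite j (\<rho> * (x / \<tau>) + sqrt (1 - \<rho>\<^sup>2) * z))"
    unfolding normal_density_scale[OF rho_bounds(1)] gauss_expect_def ..
  also have "\<dots> = gauss_expect (\<lambda>z. (1 / sqrt (fact j)) * poly (hermite_poly j) (\<rho> * (x / \<tau>) + sqrt (1 - \<rho>\<^sup>2) * z))"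
    by (simp add: hermite_eq_poly)
  also have "\<dots> = \<rho> ^ j * hermite j (x / \<tau>)"
    unfolding gauss_expect_cmult using rho_bounds hermite_smoothing_poly[of \<rho> j "x / \<tau>"]
    by (simp add: hermite_eq_poly)
  finally show ?thesis by simp
qed

lemma gauss_kernel_hermite:
  "kernel_op (gauss_kernel s) (hermite_fun s j) = (\<lambda>x. \<rho> ^ j * hermite_fun \<tau> j x)"
proof
  fix x
  have pos: "0 < normal_density 0 \<tau> x" using tau_pos by (rule normal_density_pos)
  have "kernel_op (gauss_kernel s) (hermite_fun s j) x
      = (LBINT \<mu>. std_normal_density (x - \<mu>) * normal_density 0 s \<mu> * hermite j (\<mu> / s)
          * (1 / sqrt (normal_density 0 \<tau> x)))"
    unfolding kernel_op_def l2_inner_def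
    by (intro Bochner_Integration.integral_cong refl)
      (simp add: gauss_kernel_def hermite_fun_def tau[symmetric] algebra_simps flip: real_sqrt_mult)
  also have "\<dots> = \<rho> ^ j * (normal_density 0 \<tau> x * hermite j (x / \<tau>)) * (1 / sqrt (normal_density 0 \<tau> x))"
    by (simp only: integral_mult_left_zero hermite_smoothing)
  also have "\<dots> = \<rho> ^ j * hermite j (x / \<tau>) * (normal_density 0 \<tau> x / sqrt (normal_density 0 \<tau> x))"
    by simp
  also have "normal_density 0 \<tau> x / sqrt (normal_density 0 \<tau> x) = sqrt (normal_density 0 \<tau> x)"
    by (rule real_div_sqrt) simp
  also have "\<rho> ^ j * hermite j (x / \<tau>) * sqrt (normal_density 0 \<tau> x) = \<rho> ^ j * hermite_fun \<tau> j x"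
    by (simp add: hermite_fun_def)
  finally show "kernel_op (gauss_kernel s) (hermite_fun s j) x = \<rho> ^ j * hermite_fun \<tau> j x" .
qed

text \<open>
  In this form the integral over \<open>\<mu>\<close> is a convolution of two centred normal densities.
\<close>

lemma gauss_kernel_sq:
  "(gauss_kernel s x \<mu>)\<^sup>2 = std_normal_density (x - \<mu>) * normal_density 0 \<rho> (\<mu> - \<rho>\<^sup>2 * x)"
proof -
  have pos: "0 < normal_density 0 \<tau> x" using tau_pos by (rule normal_density_pos)
  have "(gauss_kernel s x \<mu>)\<^sup>2 = std_normal_density (x - \<mu>)
      * (std_normal_density (x - \<mu>) * normal_density 0 s \<mu>) / normal_density 0 \<tau> x"
    using pos by (simp add: gauss_kernel_def tau[symmetric] power_divide power_mult_distrib power2_eq_square[of "std_normal_density _"])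
  then show ?thesis
    unfolding normal_density_bayes using pos by (simp add: normal_density_shift[of "\<rho>\<^sup>2 * x"])
qed

lemma nn_integral_gauss_kernel_sq:
  "(\<integral>\<^sup>+\<mu>. ennreal ((gauss_kernel s x \<mu>)\<^sup>2) \<partial>lborel)
    = ennreal (normal_density 0 (sqrt (1 + \<rho>\<^sup>2)) ((1 - \<rho>\<^sup>2) * x))"
proof -
  have "(\<integral>\<^sup>+\<mu>. ennreal ((gauss_kernel s x \<mu>)\<^sup>2) \<partial>lborel)
     = (\<integral>\<^sup>+\<nu>. ennreal (std_normal_density ((1 - \<rho>\<^sup>2) * x - \<nu>) * normal_density 0 \<rho> \<nu>) \<partial>lborel)"
    unfolding gauss_kernel_sq
    by (subst nn_integral_real_affine[where c=1 and t="\<rho>\<^sup>2 * x"]) (auto simp: algebra_simps)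
  then show ?thesis
    using fun_cong[OF conv_normal_density_zero_mean[of 1 \<rho>], of "(1 - \<rho>\<^sup>2) * x"] rho_bounds by simp
qed

lemma gauss_kernel_hs: "hs_kernel (gauss_kernel s)"
  and gauss_kernel_hs_norm: "(hs_norm (gauss_kernel s))\<^sup>2 = 1 / (1 - \<rho>\<^sup>2)"
proof -
  let ?P = "lborel \<Otimes>\<^sub>M lborel :: (real \<times> real) measure"
  let ?c = "1 - \<rho>\<^sup>2"
  have c: "0 < ?c" using tau_pos by (simp add: rho_sq)
  have "(\<integral>\<^sup>+z. ennreal ((case z of (x, y) \<Rightarrow> gauss_kernel s x y)\<^sup>2) \<partial>?P)
      = (\<integral>\<^sup>+x. (\<integral>\<^sup>+y. ennreal ((gauss_kernel s x y)\<^sup>2) \<partial>lborel) \<partial>lborel)"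
    by (subst lborel.nn_integral_fst[symmetric]) (auto simp: case_prod_beta')
  also have "\<dots> = (\<integral>\<^sup>+x. ennreal (normal_density 0 (sqrt (1 + \<rho>\<^sup>2)) (?c * x)) \<partial>lborel)"
    unfolding nn_integral_gauss_kernel_sq ..
  also have "\<dots> = (\<integral>\<^sup>+x. ennreal (1 / ?c) * ennreal (?c * normal_density 0 (sqrt (1 + \<rho>\<^sup>2)) (?c * x)) \<partial>lborel)"
    using c by (intro nn_integral_cong) (simp add: ennreal_mult'[symmetric])
  also have "\<dots> = ennreal (1 / ?c) * (\<integral>\<^sup>+x. ennreal (?c * normal_density 0 (sqrt (1 + \<rho>\<^sup>2)) (?c * x)) \<partial>lborel)"
    by (rule nn_integral_cmult) simp
  also have "(\<integral>\<^sup>+x. ennreal (?c * normal_density 0 (sqrt (1 + \<rho>\<^sup>2)) (?c * x)) \<partial>lborel)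
      = (\<integral>\<^sup>+x. ennreal (normal_density 0 (sqrt (1 + \<rho>\<^sup>2)) x) \<partial>lborel)"
    using c by (subst (2) nn_integral_real_affine[where c="?c" and t=0])
      (auto simp: ennreal_mult' nn_integral_cmult)
  also have "\<dots> = 1"
    by (subst nn_integral_eq_integral) (auto simp: add_pos_nonneg)
  finally have nn: "(\<integral>\<^sup>+z. ennreal ((case z of (x, y) \<Rightarrow> gauss_kernel s x y)\<^sup>2) \<partial>?P) = ennreal (1 / ?c)"
    by simp
  have "integrable ?P (\<lambda>z. (case z of (x, y) \<Rightarrow> gauss_kernel s x y)\<^sup>2)"
    by (rule integrableI_nonneg) (auto simp: nn)
  moreover have m[measurable]: "gauss_kernel s x \<in> borel_measurable lborel" for x
    unfolding gauss_kernel_def[abs_def] by measurable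
  moreover have "integrable lborel (\<lambda>y. (gauss_kernel s x y)\<^sup>2)" for x
    by (rule integrableI_nonneg) (auto simp: nn_integral_gauss_kernel_sq)
  ultimately show "hs_kernel (gauss_kernel s)" by (simp add: hs_kernel_def L2_def)
  show "(hs_norm (gauss_kernel s))\<^sup>2 = 1 / (1 - \<rho>\<^sup>2)"
    unfolding hs_norm_def l2_norm_sq using c by (subst integral_eq_nn_integral) (auto simp: nn)
qed

text \<open>
  The sum measures the failure of \<open>u\<close> to be orthogonal to the first \<open>p\<close> singular functions. Keeping it in the
  bound allows approximate orthogonality, which is all that a centred function on the interval satisfies with
  respect to the function of index \<open>0\<close>.
\<close>

theorem gauss_channel_contraction:
  assumes "u \<in> L2 lborel"
  shows "(l2_norm lborel (kernel_op (gauss_kernel s) u))\<^sup>2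
    \<le> \<rho> ^ (2 * p) * (l2_norm lborel u)\<^sup>2 + (\<Sum>j<p. (l2_inner lborel u (hermite_fun s j))\<^sup>2)"
  using rho_bounds
  by (intro kernel_op_spectral_bound[where f="hermite_fun \<tau>"] gauss_kernel_hs gauss_kernel_hs_norm
      gauss_kernel_hermite hermite_fun_L2 hermite_fun_orthonormal s tau_pos assms) auto

end

section \<open>Wrapped Gaussian densities\<close>

definition wrapped_normal :: "real \<Rightarrow> real \<Rightarrow> real \<Rightarrow> real" where
  "wrapped_normal s M y = (\<Sum>\<^sub>\<infinity>j\<in>(UNIV :: int set). normal_density 0 s (y + 2 * of_int j * M))"

text \<open>
  The total of the geometric series that dominates the contribution of all images \<open>j \<noteq> 0\<close>, relative to the
  density at the reflected point.
\<close>

definition image_mass :: "real \<Rightarrow> real \<Rightarrow> real" where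
  "image_mass s m = 2 / (1 - exp (- 2 * m\<^sup>2 / s\<^sup>2))"

lemma wrapped_gaussian_eq: "0 < s \<Longrightarrow> wrapped_gaussian s M = wrapped_normal s M"
proof (rule ext)
  fix x assume s: "0 < s"
  have "1 / s * std_normal_density (z / s) = normal_density 0 s z" for z
    using normal_density_scale[OF s, of "z / s"] s by (simp add: field_simps)
  then show "wrapped_gaussian s M x = wrapped_normal s M x"
    by (simp add: wrapped_gaussian_def wrapped_normal_def)
qed

lemma cyclic_kernel_eq: "cyclic_kernel M \<mu> x = wrapped_normal 1 M (x - \<mu>)"
  by (simp add: cyclic_kernel_def wrapped_normal_def)

lemma has_sum_geometric_int:
  fixes q :: real
  assumes q: "0 \<le> q" "q < 1"
  shows "((\<lambda>j::int. q ^ nat (\<bar>j\<bar> - 1)) has_sum (2 / (1 - q))) (- {0})"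
proof -
  have g: "((\<lambda>n. q ^ n) has_sum (1 / (1 - q))) UNIV"
    using q geometric_sums[of q] by (intro sums_nonneg_imp_has_sum) auto
  have "((\<lambda>j::int. q ^ nat (\<bar>j\<bar> - 1)) has_sum (1 / (1 - q))) (range (\<lambda>n. int n + 1))"
    using g by (subst has_sum_reindex) (auto simp: inj_on_def o_def)
  moreover have "((\<lambda>j::int. q ^ nat (\<bar>j\<bar> - 1)) has_sum (1 / (1 - q))) (range (\<lambda>n. - (int n + 1)))"
    using g by (subst has_sum_reindex) (auto simp: inj_on_def o_def)
  ultimately have "((\<lambda>j::int. q ^ nat (\<bar>j\<bar> - 1)) has_sum (1 / (1 - q) + 1 / (1 - q)))
      (range (\<lambda>n. int n + 1) \<union> range (\<lambda>n. - (int n + 1)))"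
    by (rule has_sum_Un_disjoint) auto
  moreover have "range (\<lambda>n. int n + 1) \<union> range (\<lambda>n. - (int n + 1)) = - {0}"
  proof -
    have "j \<in> range (\<lambda>n. int n + 1) \<union> range (\<lambda>n. - (int n + 1))" if "j \<noteq> 0" for j
      using that by (cases "j > 0") (auto intro: image_eqI[of _ _ "nat (j - 1)"] image_eqI[of _ _ "nat (- j - 1)"])
    then show ?thesis by auto
  qed
  ultimately show ?thesis by simp
qed

text \<open>
  Reflecting at the boundary of the interval is shorter than going around: for \<open>x\<close> and \<open>\<mu>\<close> in the interval,
  every nontrivial image of \<open>x - \<mu>\<close> is at least as far from \<open>0\<close> as \<open>x + \<mu>\<close>, with an excess of
  \<open>2 * (\<bar>j\<bar> - 1) * M\<close>. The point \<open>x + \<mu>\<close> depends on neither \<open>M\<close> nor \<open>j\<close>, and this is what makes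
  dominated convergence possible.
\<close>

lemma image_term_bound:
  fixes j :: int
  assumes s: "0 < s" and m: "0 < m" "m \<le> M" and x: "\<bar>x\<bar> \<le> M" and mu: "\<bar>\<mu>\<bar> \<le> M" and j: "j \<noteq> 0"
  shows "normal_density 0 s (x - \<mu> + 2 * of_int j * M)
    \<le> normal_density 0 s (x + \<mu>) * exp (- 2 * m\<^sup>2 / s\<^sup>2) ^ nat (\<bar>j\<bar> - 1)"
proof -
  define n where "n = nat (\<bar>j\<bar> - 1)"
  have n: "real_of_int \<bar>j\<bar> = real n + 1" using j by (simp add: n_def)
  have nM: "0 \<le> real n * M" using m by simp
  have low: "\<bar>x + \<mu>\<bar> + 2 * real n * M \<le> \<bar>x - \<mu> + 2 * of_int j * M\<bar>"
  proof (cases "j > 0")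
    case True
    then have "real_of_int j = real n + 1" using n by simp
    then have "2 * of_int j * M = 2 * (real n * M) + 2 * M" by (simp add: algebra_simps)
    then show ?thesis using x mu nM by linarith
  next
    case False
    then have "real_of_int j = - (real n + 1)" using n j by simp
    then have "2 * of_int j * M = - 2 * (real n * M) - 2 * M" by (simp only: ring_distribs) (simp add: algebra_simps)
    then show ?thesis using x mu nM by linarith
  qed
  have "(x + \<mu>)\<^sup>2 + 4 * real n * m\<^sup>2 \<le> \<bar>x + \<mu>\<bar>\<^sup>2 + (2 * real n * M)\<^sup>2"
  proof -
    have "real n \<le> real n * real n"
      by (metis le_square of_nat_le_iff of_nat_mult)
    then have "real n * m\<^sup>2 \<le> (real n)\<^sup>2 * M\<^sup>2"
      using m by (intro mult_mono power_mono) (auto simp: power2_eq_square)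
    then show ?thesis by (simp add: power_mult_distrib)
  qed
  also have "\<dots> \<le> (\<bar>x + \<mu>\<bar> + 2 * real n * M)\<^sup>2"
    using nM by (simp add: power2_sum)
  also have "\<dots> \<le> \<bar>x - \<mu> + 2 * of_int j * M\<bar>\<^sup>2"
    using low nM by (intro power_mono) auto
  finally have sq: "(x + \<mu>)\<^sup>2 + 4 * real n * m\<^sup>2 \<le> (x - \<mu> + 2 * of_int j * M)\<^sup>2" by simp
  have "exp (- (x - \<mu> + 2 * of_int j * M - 0)\<^sup>2 / (2 * s\<^sup>2))
      \<le> exp (- (x + \<mu> - 0)\<^sup>2 / (2 * s\<^sup>2) + real n * (- 2 * m\<^sup>2 / s\<^sup>2))"
  proof -
    have "- (x - \<mu> + 2 * of_int j * M)\<^sup>2 / (2 * s\<^sup>2) \<le> - ((x + \<mu>)\<^sup>2 + 4 * real n * m\<^sup>2) / (2 * s\<^sup>2)"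
      using sq s by (intro divide_right_mono) auto
    also have "\<dots> = - (x + \<mu>)\<^sup>2 / (2 * s\<^sup>2) + real n * (- 2 * m\<^sup>2 / s\<^sup>2)"
      using s by (simp add: field_simps)
    finally show ?thesis unfolding diff_0_right exp_le_cancel_iff .
  qed
  then have "1 / sqrt (2 * pi * s\<^sup>2) * exp (- (x - \<mu> + 2 * of_int j * M - 0)\<^sup>2 / (2 * s\<^sup>2))
      \<le> 1 / sqrt (2 * pi * s\<^sup>2) * (exp (- (x + \<mu> - 0)\<^sup>2 / (2 * s\<^sup>2)) * exp (- 2 * m\<^sup>2 / s\<^sup>2) ^ n)"
    unfolding exp_add exp_of_nat_mult by (rule mult_left_mono) simp
  then show ?thesis by (simp only: normal_density_def n_def mult.assoc)
qed

lemma image_mass_pos: "0 < s \<Longrightarrow> 0 < m \<Longrightarrow> 0 < image_mass s m"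
  by (simp add: image_mass_def)

lemma
  assumes s: "0 < s" and m: "0 < m" "m \<le> M" and x: "\<bar>x\<bar> \<le> M" and mu: "\<bar>\<mu>\<bar> \<le> M"
  shows wrapped_normal_summable_box:
      "(\<lambda>j::int. normal_density 0 s (x - \<mu> + 2 * of_int j * M)) summable_on UNIV"
    and wrapped_normal_bound: "wrapped_normal s M (x - \<mu>)
      \<le> normal_density 0 s (x - \<mu>) + image_mass s m * normal_density 0 s (x + \<mu>)"
proof -
  let ?f = "\<lambda>j::int. normal_density 0 s (x - \<mu> + 2 * of_int j * M)"
  define q where "q = exp (- 2 * m\<^sup>2 / s\<^sup>2)"
  let ?g = "\<lambda>j::int. normal_density 0 s (x + \<mu>) * q ^ nat (\<bar>j\<bar> - 1)"
  have q: "0 \<le> q" "q < 1" using s m by (auto simp: q_def)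
  have g: "(?g has_sum (normal_density 0 s (x + \<mu>) * image_mass s m)) (- {0})"
    unfolding image_mass_def q_def[symmetric] by (intro has_sum_cmult_right has_sum_geometric_int q)
  have le: "?f j \<le> ?g j" if "j \<in> - {0}" for j
    unfolding q_def using that by (intro image_term_bound assms) auto
  have f0: "?f summable_on (- {0})"
    by (rule summable_on_comparison_test[OF has_sum_imp_summable[OF g]]) (use le in auto)
  have U: "insert 0 (- {0}) = (UNIV :: int set)" by auto
  show "?f summable_on UNIV"
    using f0 unfolding U[symmetric] by (simp add: summable_on_insert_iff)
  have "infsum ?f (insert 0 (- {0})) = ?f 0 + infsum ?f (- {0})"
    by (intro infsum_insert f0) auto
  moreover have "infsum ?f (- {0}) \<le> normal_density 0 s (x + \<mu>) * image_mass s m"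
    using g infsum_mono[OF f0 has_sum_imp_summable[OF g] le] infsumI[OF g] by simp
  ultimately show "wrapped_normal s M (x - \<mu>)
      \<le> normal_density 0 s (x - \<mu>) + image_mass s m * normal_density 0 s (x + \<mu>)"
    by (simp add: wrapped_normal_def U mult.commute)
qed

lemma bij_shift_int: "bij_betw (\<lambda>j::int. j + k) UNIV UNIV"
  by (rule bij_betwI[of _ _ _ "\<lambda>j. j - k"]) auto

lemma wrapped_normal_periodic: "wrapped_normal s M (y + 2 * of_int k * M) = wrapped_normal s M y"
  unfolding wrapped_normal_def
  by (subst (2) infsum_reindex_bij_betw[OF bij_shift_int[of k], symmetric]) (simp add: algebra_simps)

definition wrap_index :: "real \<Rightarrow> real \<Rightarrow> int" where
  "wrap_index M y = \<lfloor>(y + M) / (2 * M)\<rfloor>"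

lemma wrap_index_iff: "0 < M \<Longrightarrow> y - 2 * of_int j * M \<in> {-M..<M} \<longleftrightarrow> j = wrap_index M y"
proof -
  assume M: "0 < M"
  have "j = wrap_index M y \<longleftrightarrow> of_int j \<le> (y + M) / (2 * M) \<and> (y + M) / (2 * M) < of_int j + 1"
    unfolding wrap_index_def by (metis floor_eq_iff)
  also have "\<dots> \<longleftrightarrow> y - 2 * of_int j * M \<in> {-M..<M}"
    using M by (auto simp: field_simps)
  finally show ?thesis by simp
qed

lemma wrapped_normal_summable:
  assumes s: "0 < s" and M: "0 < M"
  shows "(\<lambda>j::int. normal_density 0 s (y + 2 * of_int j * M)) summable_on UNIV"
proof -
  define k where "k = wrap_index M y"
  have "\<bar>y - 2 * of_int k * M\<bar> \<le> M"
    using wrap_index_iff[OF M, of y k] by (auto simp: k_def)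
  then have "(\<lambda>j::int. normal_density 0 s (y - 2 * of_int k * M - 0 + 2 * of_int j * M)) summable_on UNIV"
    using s M by (intro wrapped_normal_summable_box[of s M M]) auto
  then have "(\<lambda>j::int. normal_density 0 s (y - 2 * of_int k * M - 0 + 2 * of_int (j + k) * M)) summable_on UNIV"
    by (subst summable_on_reindex_bij_betw[OF bij_shift_int[of k],
        of "\<lambda>j. normal_density 0 s (y - 2 * of_int k * M - 0 + 2 * of_int j * M)"])
  then show ?thesis by (simp add: algebra_simps)
qed

lemma wrapped_normal_sums:
  assumes "0 < s" "0 < M"
  shows "(\<lambda>n. normal_density 0 s (y + 2 * of_int (int_decode n) * M)) sums wrapped_normal s M y"
proof -
  have "((\<lambda>j::int. normal_density 0 s (y + 2 * of_int j * M)) has_sum wrapped_normal s M y) (range int_decode)"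
    using wrapped_normal_summable[OF assms] bij_int_decode
    by (simp add: wrapped_normal_def bij_is_surj)
  then have "((\<lambda>n. normal_density 0 s (y + 2 * of_int (int_decode n) * M)) has_sum wrapped_normal s M y) UNIV"
    using bij_int_decode by (subst (asm) has_sum_reindex) (auto simp: bij_def o_def)
  then show ?thesis by (rule has_sum_imp_sums)
qed

lemma wrapped_normal_measurable [measurable]:
  assumes "0 < s" "0 < M"
  shows "wrapped_normal s M \<in> borel_measurable borel"
proof -
  have "wrapped_normal s M = (\<lambda>y. \<Sum>n. normal_density 0 s (y + 2 * of_int (int_decode n) * M))"
    using wrapped_normal_sums[OF assms] by (auto simp: sums_iff)
  then show ?thesis by simp
qed

lemma ennreal_wrapped_normal:
  assumes "0 < s" "0 < M"
  shows "ennreal (wrapped_normal s M y)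
    = (\<Sum>n. ennreal (normal_density 0 s (y + 2 * of_int (int_decode n) * M)))"
  using wrapped_normal_sums[OF assms, of y] by (subst suminf_ennreal2) (auto simp: sums_iff)

lemma wrapped_normal_ge: "0 < s \<Longrightarrow> 0 < M \<Longrightarrow> normal_density 0 s y \<le> wrapped_normal s M y"
  using finite_sum_le_infsum[OF wrapped_normal_summable[of s M y], of "{0}"]
  by (simp add: wrapped_normal_def)

lemma wrapped_normal_pos: "0 < s \<Longrightarrow> 0 < M \<Longrightarrow> 0 < wrapped_normal s M y"
  using wrapped_normal_ge[of s M y] normal_density_pos[of s 0 y] by simp

lemma normal_density_le_peak: "normal_density 0 s y \<le> normal_density 0 s 0"
  by (auto simp: normal_density_def intro!: divide_right_mono)

definition wrapped_peak :: "real \<Rightarrow> real \<Rightarrow> real" where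
  "wrapped_peak s m = normal_density 0 s 0 * (1 + image_mass s m)"

text \<open>By periodicity the argument may be moved into the fundamental interval.\<close>

lemma wrapped_normal_le_peak:
  assumes s: "0 < s" and m: "0 < m" "m \<le> M"
  shows "wrapped_normal s M y \<le> wrapped_peak s m"
proof -
  have M: "0 < M" using m by simp
  define z where "z = y - 2 * of_int (wrap_index M y) * M"
  have z: "\<bar>z\<bar> \<le> M" using wrap_index_iff[OF M, of y "wrap_index M y"] by (auto simp: z_def)
  have "wrapped_normal s M y = wrapped_normal s M (z - 0)"
    using wrapped_normal_periodic[of s M y "- wrap_index M y"] by (simp add: z_def)
  also have "\<dots> \<le> normal_density 0 s (z - 0) + image_mass s m * normal_density 0 s (z + 0)"
    using assms z by (intro wrapped_normal_bound) auto
  also have "\<dots> \<le> normal_density 0 s 0 + image_mass s m * normal_density 0 s 0"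
    using image_mass_pos[OF s m(1)] by (intro add_mono mult_left_mono normal_density_le_peak) auto
  finally show ?thesis by (simp add: wrapped_peak_def algebra_simps)
qed

lemma tendsto_normal_density_at_top:
  assumes s: "0 < s"
  shows "(normal_density 0 s \<longlongrightarrow> 0) at_top"
proof -
  have "((\<lambda>M. 1 / sqrt (2 * pi * s\<^sup>2) * exp (- (M\<^sup>2 / (2 * s\<^sup>2)))) \<longlongrightarrow> 1 / sqrt (2 * pi * s\<^sup>2) * 0) at_top"
  proof (intro tendsto_mult tendsto_const filterlim_compose[OF exp_at_bot] filterlim_compose[OF filterlim_uminus_at_bot_at_top])
    have "LIM M at_top. (M::real)\<^sup>2 :> at_top" by (rule filterlim_pow_at_top) (auto simp: filterlim_ident)
    then have "LIM M at_top. (1 / (2 * s\<^sup>2)) * (M::real)\<^sup>2 :> at_top"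
      using s by (intro filterlim_tendsto_pos_mult_at_top[OF tendsto_const]) auto
    then show "LIM M at_top. (M::real)\<^sup>2 / (2 * s\<^sup>2) :> at_top" by simp
  qed
  then show ?thesis unfolding normal_density_def[abs_def] by simp
qed

lemma tendsto_wrapped_normal:
  assumes s: "0 < s"
  shows "((\<lambda>M. wrapped_normal s M y) \<longlongrightarrow> normal_density 0 s y) at_top"
proof (rule tendsto_sandwich)
  show "\<forall>\<^sub>F M in at_top. normal_density 0 s y \<le> wrapped_normal s M y"
    using eventually_gt_at_top[of 0] by eventually_elim (rule wrapped_normal_ge[OF s])
  show "\<forall>\<^sub>F M in at_top. wrapped_normal s M y
      \<le> normal_density 0 s y + image_mass s 1 * normal_density 0 s M"
    using eventually_ge_at_top[of "max 1 \<bar>y\<bar>"]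
  proof eventually_elim
    case (elim M)
    (* the two points (M + y) / 2 and (M - y) / 2 differ by y and add up to M *)
    have "wrapped_normal s M ((M + y) / 2 - (M - y) / 2)
        \<le> normal_density 0 s ((M + y) / 2 - (M - y) / 2)
          + image_mass s 1 * normal_density 0 s ((M + y) / 2 + (M - y) / 2)"
      using elim s by (intro wrapped_normal_bound) (auto simp: abs_le_iff)
    then show ?case by (simp add: field_simps)
  qed
  have "((\<lambda>M. normal_density 0 s y + image_mass s 1 * normal_density 0 s M)
      \<longlongrightarrow> normal_density 0 s y + image_mass s 1 * 0) at_top"
    by (intro tendsto_intros tendsto_normal_density_at_top s)
  then show "((\<lambda>M. normal_density 0 s y + image_mass s 1 * normal_density 0 s M)
      \<longlongrightarrow> normal_density 0 s y) at_top" by simp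
qed simp

text \<open>The translates of the half-open fundamental interval tile the line.\<close>

lemma nn_integral_unwrap:
  fixes F :: "real \<Rightarrow> ennreal"
  assumes F[measurable]: "F \<in> borel_measurable borel" and M: "0 < M"
  shows "(\<integral>\<^sup>+x. indicator (Omega M) x * (\<Sum>n. F (x + 2 * of_int (int_decode n) * M)) \<partial>lborel)
    = (\<integral>\<^sup>+x. F x \<partial>lborel)"
proof -
  let ?d = "\<lambda>n. 2 * of_int (int_decode n) * M :: real"
  \<comment> \<open>passing to the half-open interval makes the translates disjoint\<close>
  have "AE x in lborel. x \<noteq> M" by (rule AE_lborel_singleton)
  then have "AE x in lborel. indicator (Omega M) x * (\<Sum>n. F (x + ?d n)) = (\<Sum>n. indicator {-M..<M} x * F (x + ?d n))"
    by eventually_elim (auto simp: Omega_def indicator_def)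
  then have "(\<integral>\<^sup>+x. indicator (Omega M) x * (\<Sum>n. F (x + ?d n)) \<partial>lborel)
      = (\<integral>\<^sup>+x. (\<Sum>n. indicator {-M..<M} x * F (x + ?d n)) \<partial>lborel)"
    by (rule nn_integral_cong_AE)
  also have "\<dots> = (\<Sum>n. \<integral>\<^sup>+x. indicator {-M..<M} x * F (x + ?d n) \<partial>lborel)"
    by (rule nn_integral_suminf) simp
  also have "\<dots> = (\<Sum>n. \<integral>\<^sup>+x. indicator {-M..<M} (x - ?d n) * F x \<partial>lborel)"
  proof (intro suminf_cong)
    fix n
    show "(\<integral>\<^sup>+x. indicator {-M..<M} x * F (x + ?d n) \<partial>lborel)
        = (\<integral>\<^sup>+x. indicator {-M..<M} (x - ?d n) * F x \<partial>lborel)"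
      by (subst (2) nn_integral_real_affine[where c=1 and t="?d n"]) (auto simp: add.commute)
  qed
  also have "\<dots> = (\<integral>\<^sup>+x. (\<Sum>n. indicator {-M..<M} (x - ?d n) * F x) \<partial>lborel)"
    by (rule nn_integral_suminf[symmetric]) simp
  also have "\<dots> = (\<integral>\<^sup>+x. F x \<partial>lborel)"
  proof (intro nn_integral_cong)
    fix x
    have ind: "indicator {-M..<M} (x - ?d n) * F x = (if n = int_encode (wrap_index M x) then F x else 0)" for n
    proof -
      have "int_decode n = k \<longleftrightarrow> n = int_encode k" for k
        by (metis int_decode_inverse int_encode_inverse)
      then show ?thesis
        using wrap_index_iff[OF M, of x "int_decode n"] by (auto simp: indicator_def)
    qed
    show "(\<Sum>n. indicator {-M..<M} (x - ?d n) * F x) = F x"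
      unfolding ind using sums_single[of "int_encode (wrap_index M x)" "\<lambda>_. F x"]
      by (simp add: sums_iff)
  qed
  finally show ?thesis .
qed

lemma nn_integral_normal_density_shift: "0 < s \<Longrightarrow> (\<integral>\<^sup>+x. ennreal (normal_density 0 s (x - \<mu>)) \<partial>lborel) = 1"
proof -
  assume s: "0 < s"
  have "normal_density 0 s (x - \<mu>) = normal_density \<mu> s x" for x by (simp add: normal_density_def)
  then show ?thesis
    using s by (simp add: nn_integral_eq_integral)
qed

lemma nn_integral_wrapped_normal:
  assumes s: "0 < s" and M: "0 < M"
  shows "(\<integral>\<^sup>+x. indicator (Omega M) x * ennreal (wrapped_normal s M (x - \<mu>)) \<partial>lborel) = 1"
proof -
  have "(\<integral>\<^sup>+x. indicator (Omega M) x * ennreal (wrapped_normal s M (x - \<mu>)) \<partial>lborel)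
      = (\<integral>\<^sup>+x. indicator (Omega M) x * (\<Sum>n. (\<lambda>x. ennreal (normal_density 0 s (x - \<mu>))) (x + 2 * of_int (int_decode n) * M)) \<partial>lborel)"
    by (simp add: ennreal_wrapped_normal[OF assms] algebra_simps)
  also have "\<dots> = (\<integral>\<^sup>+x. ennreal (normal_density 0 s (x - \<mu>)) \<partial>lborel)"
    by (intro nn_integral_unwrap M) simp
  finally show ?thesis using s by (simp add: nn_integral_normal_density_shift)
qed

text \<open>
  The marginal density \<open>f\<^sub>0\<close> of \<open>X\<close>, with the carrier already unwrapped to the whole line; in this form it is
  visibly at least the Gaussian marginal density.
\<close>

definition wrapped_marginal :: "real \<Rightarrow> real \<Rightarrow> real \<Rightarrow> real" where
  "wrapped_marginal s M x = (LBINT \<mu>. wrapped_normal 1 M (x - \<mu>) * normal_density 0 s \<mu>)"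

lemma integrable_wrapped_marginal:
  assumes s: "0 < s" and M: "0 < M"
  shows "integrable lborel (\<lambda>\<mu>. wrapped_normal 1 M (x - \<mu>) * normal_density 0 s \<mu>)"
proof -
  have "integrable lborel (\<lambda>\<mu>. normal_density 0 s \<mu> * wrapped_normal 1 M (x - \<mu>))"
  proof (rule integrable_mult_bounded[where g="\<lambda>_. 1" and C="wrapped_peak 1 M"])
    show "(\<lambda>\<mu>. wrapped_normal 1 M (x - \<mu>)) \<in> borel_measurable lborel"
      using M by (intro measurable_compose[OF _ wrapped_normal_measurable]) auto
    show "\<bar>wrapped_normal 1 M (x - \<mu>)\<bar> \<le> wrapped_peak 1 M * \<bar>1\<bar>" for \<mu>
      using wrapped_normal_pos[of 1 M "x - \<mu>"] wrapped_normal_le_peak[of 1 M M "x - \<mu>"] M by simp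
  qed (use s in auto)
  then show ?thesis by (simp add: mult.commute)
qed

text \<open>
  The cyclic kernel is periodic in \<open>\<mu>\<close>, so only the carrier has to be unwrapped.
\<close>

lemma nn_integral_wrapped_marginal:
  assumes s: "0 < s" and M: "0 < M"
  shows "(\<integral>\<^sup>+\<mu>. indicator (Omega M) \<mu> * ennreal (wrapped_normal 1 M (x - \<mu>) * wrapped_normal s M \<mu>) \<partial>lborel)
    = ennreal (wrapped_marginal s M x)"
proof -
  define F where "F \<mu> = ennreal (wrapped_normal 1 M (x - \<mu>) * normal_density 0 s \<mu>)" for \<mu>
  have pos: "0 \<le> wrapped_normal 1 M z" for z using wrapped_normal_pos[of 1 M z] M by simp
  have "ennreal (wrapped_normal 1 M (x - \<mu>) * wrapped_normal s M \<mu>)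
      = (\<Sum>n. F (\<mu> + 2 * of_int (int_decode n) * M))" for \<mu>
  proof -
    have per: "wrapped_normal 1 M (x - (\<mu> + 2 * of_int k * M)) = wrapped_normal 1 M (x - \<mu>)" for k
      using wrapped_normal_periodic[of 1 M "x - \<mu>" "- k"] by (simp add: algebra_simps)
    show ?thesis
      unfolding F_def per ennreal_mult'[OF pos] ennreal_wrapped_normal[OF s M] ennreal_suminf_cmult ..
  qed
  then have "(\<integral>\<^sup>+\<mu>. indicator (Omega M) \<mu> * ennreal (wrapped_normal 1 M (x - \<mu>) * wrapped_normal s M \<mu>) \<partial>lborel)
      = (\<integral>\<^sup>+\<mu>. indicator (Omega M) \<mu> * (\<Sum>n. F (\<mu> + 2 * of_int (int_decode n) * M)) \<partial>lborel)"
    by simp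
  also have "\<dots> = (\<integral>\<^sup>+\<mu>. F \<mu> \<partial>lborel)"
    unfolding F_def using M
    by (intro nn_integral_unwrap measurable_compose[OF _ measurable_ennreal] borel_measurable_times
        measurable_compose[OF _ wrapped_normal_measurable]) auto
  also have "\<dots> = ennreal (wrapped_marginal s M x)"
    unfolding F_def wrapped_marginal_def
    by (intro nn_integral_eq_integral integrable_wrapped_marginal assms) (auto simp: pos)
  finally show ?thesis .
qed

lemma normal_density_convolution:
  "0 < s \<Longrightarrow> (LBINT \<mu>. std_normal_density (x - \<mu>) * normal_density 0 s \<mu>) = normal_density 0 (sqrt (1 + s\<^sup>2)) x"
  using hermite_smoothing[of s _ _ x 0] by (simp add: hermite_eq_poly)

lemma integrable_normal_convolution:
  assumes "0 < s" shows "integrable lborel (\<lambda>\<mu>. std_normal_density (x - \<mu>) * normal_density 0 s \<mu>)"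
  using integrable_mult_bounded[of lborel "normal_density 0 s" "\<lambda>_. 1" "\<lambda>\<mu>. std_normal_density (x - \<mu>)" "std_normal_density 0"]
    assms normal_density_le_peak[of 1] by (simp add: mult.commute)

lemma wrapped_marginal_ge:
  assumes s: "0 < s" and M: "0 < M"
  shows "normal_density 0 (sqrt (1 + s\<^sup>2)) x \<le> wrapped_marginal s M x"
  unfolding normal_density_convolution[OF s, symmetric] wrapped_marginal_def
  using M by (intro integral_mono integrable_normal_convolution integrable_wrapped_marginal assms
      mult_right_mono wrapped_normal_ge) auto

lemma wrapped_marginal_pos: "0 < s \<Longrightarrow> 0 < M \<Longrightarrow> 0 < wrapped_marginal s M x"
  using wrapped_marginal_ge[of s M x] normal_density_pos[of "sqrt (1 + s\<^sup>2)" 0 x]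
  by (simp add: add_pos_nonneg)

text \<open>
  The functions in question are known to be measurable and bounded only for \<open>M\<close> away from \<open>0\<close>, so dominated
  convergence is applied to the parameter \<open>max M 1\<close>.
\<close>

lemma dominated_convergence_from_1:
  fixes f :: "real \<Rightarrow> 'a \<Rightarrow> real"
  assumes f: "\<And>M. 1 \<le> M \<Longrightarrow> f M \<in> borel_measurable N" and g: "g \<in> borel_measurable N" and w: "integrable N w"
    and dom: "\<And>M x. 1 \<le> M \<Longrightarrow> x \<in> space N \<Longrightarrow> \<bar>f M x\<bar> \<le> w x"
    and lim: "\<And>x. x \<in> space N \<Longrightarrow> ((\<lambda>M. f M x) \<longlongrightarrow> g x) at_top"
  shows "((\<lambda>M. \<integral>x. f M x \<partial>N) \<longlongrightarrow> (\<integral>x. g x \<partial>N)) at_top"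
proof -
  have ev: "\<forall>\<^sub>F M in at_top. max M 1 = (M :: real)"
    using eventually_ge_at_top[of 1] by eventually_elim simp
  have "((\<lambda>M. \<integral>x. f (max M 1) x \<partial>N) \<longlongrightarrow> (\<integral>x. g x \<partial>N)) at_top"
  proof (rule integral_dominated_convergence_at_top[OF g _ w])
    show "AE x in N. ((\<lambda>M. f (max M 1) x) \<longlongrightarrow> g x) at_top"
    proof (rule AE_I2)
      fix x assume "x \<in> space N"
      moreover have "\<forall>\<^sub>F M in at_top. f M x = f (max M 1) x" using ev by eventually_elim simp
      ultimately show "((\<lambda>M. f (max M 1) x) \<longlongrightarrow> g x) at_top" by (blast intro: Lim_transform_eventually lim)
    qed
    show "\<forall>\<^sub>F M in at_top. AE x in N. norm (f (max M 1) x) \<le> w x"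
      by (rule always_eventually, rule allI, rule AE_I2) (simp add: dom)
  qed (simp add: f)
  moreover have "\<forall>\<^sub>F M in at_top. (\<integral>x. f (max M 1) x \<partial>N) = (\<integral>x. f M x \<partial>N)"
    using ev by eventually_elim simp
  ultimately show ?thesis by (rule Lim_transform_eventually)
qed

lemma tendsto_wrapped_marginal:
  assumes s: "0 < s"
  shows "((\<lambda>M. wrapped_marginal s M x) \<longlongrightarrow> normal_density 0 (sqrt (1 + s\<^sup>2)) x) at_top"
  unfolding wrapped_marginal_def normal_density_convolution[OF s, symmetric]
proof (rule dominated_convergence_from_1)
  show "integrable lborel (\<lambda>\<mu>. wrapped_peak 1 1 * normal_density 0 s \<mu>)" using s by simp
  fix M \<mu> :: real assume M: "1 \<le> M"
  then show "\<bar>wrapped_normal 1 M (x - \<mu>) * normal_density 0 s \<mu>\<bar> \<le> wrapped_peak 1 1 * normal_density 0 s \<mu>"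
    using wrapped_normal_pos[of 1 M "x - \<mu>"] wrapped_normal_le_peak[of 1 1 M "x - \<mu>"]
    by (simp add: abs_mult mult_right_mono)
next
  show "((\<lambda>M. wrapped_normal 1 M (x - \<mu>) * normal_density 0 s \<mu>)
      \<longlongrightarrow> std_normal_density (x - \<mu>) * normal_density 0 s \<mu>) at_top" for \<mu>
    by (intro tendsto_mult tendsto_const tendsto_wrapped_normal) simp
  show "(\<lambda>\<mu>. wrapped_normal 1 M (x - \<mu>) * normal_density 0 s \<mu>) \<in> borel_measurable lborel" if "1 \<le> M" for M
    using that by (intro borel_measurable_times measurable_compose[OF _ wrapped_normal_measurable]) auto
qed auto

lemma wrapped_marginal_measurable [measurable]:
  assumes s: "0 < s" and M: "0 < M"
  shows "wrapped_marginal s M \<in> borel_measurable borel"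
proof -
  have [measurable]: "wrapped_normal 1 M \<in> borel_measurable borel" using M by simp
  have "wrapped_marginal s M \<in> borel_measurable lborel"
    unfolding wrapped_marginal_def[abs_def]
    by (rule lborel.borel_measurable_lebesgue_integral) measurable
  then show ?thesis by simp
qed

section \<open>Convergence of the wrapped channel\<close>

lemma tendsto_l2_norm_dominated:
  fixes f :: "real \<Rightarrow> 'a \<Rightarrow> real"
  assumes f[measurable]: "\<And>M. 1 \<le> M \<Longrightarrow> f M \<in> borel_measurable N"
    and D: "D \<in> L2 N" and g: "g \<in> L2 N"
    and dom: "\<And>M x. 1 \<le> M \<Longrightarrow> x \<in> space N \<Longrightarrow> \<bar>f M x\<bar> \<le> C * \<bar>D x\<bar>"
    and lim: "\<And>x. x \<in> space N \<Longrightarrow> ((\<lambda>M. f M x) \<longlongrightarrow> g x) at_top"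
  shows "((\<lambda>M. l2_norm N (\<lambda>x. f M x - g x)) \<longlongrightarrow> 0) at_top"
proof -
  have gm: "g \<in> borel_measurable N" using g by (rule L2_measurable)
  have "((\<lambda>M. \<integral>x. (f M x - g x)\<^sup>2 \<partial>N) \<longlongrightarrow> (\<integral>x. 0 \<partial>N)) at_top"
  proof (rule dominated_convergence_from_1)
    show "(\<lambda>x. (f M x - g x)\<^sup>2) \<in> borel_measurable N" if "1 \<le> M" for M
      by (intro borel_measurable_power borel_measurable_diff f gm that)
    show "integrable N (\<lambda>x. 2 * C\<^sup>2 * (D x)\<^sup>2 + 2 * (g x)\<^sup>2)"
      using L2_integrable[OF D] L2_integrable[OF g] by simp
    show "((\<lambda>M. (f M x - g x)\<^sup>2) \<longlongrightarrow> 0) at_top" if "x \<in> space N" for x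
      using tendsto_power[OF tendsto_diff[OF lim[OF that] tendsto_const[of "g x"]], of 2] by simp
    fix M :: real and x assume "1 \<le> M" "x \<in> space N"
    then have "\<bar>f M x\<bar>\<^sup>2 \<le> (C * \<bar>D x\<bar>)\<^sup>2" by (intro power_mono dom) auto
    moreover have "0 \<le> (f M x + g x)\<^sup>2" by simp
    ultimately have "(f M x - g x)\<^sup>2 \<le> 2 * C\<^sup>2 * (D x)\<^sup>2 + 2 * (g x)\<^sup>2"
      by (simp add: power2_sum power2_diff power_mult_distrib)
    then show "\<bar>(f M x - g x)\<^sup>2\<bar> \<le> 2 * C\<^sup>2 * (D x)\<^sup>2 + 2 * (g x)\<^sup>2" by simp
  qed auto
  then show ?thesis unfolding l2_norm_def by (intro tendsto_real_sqrt[where x=0, unfolded real_sqrt_zero]) simp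
qed

lemma hs_kernel_reflect:
  assumes k: "hs_kernel k"
  shows "hs_kernel (\<lambda>x y. k x (- y))"
proof -
  have km[measurable]: "(\<lambda>(x, y). k x y) \<in> borel_measurable (borel \<Otimes>\<^sub>M borel)"
    using L2_measurable[OF hs_kernel_L2[OF k]]
    by (simp add: measurable_cong_sets[OF sets_pair_measure_cong[OF sets_lborel sets_lborel] refl])
  have sm[measurable]: "k x \<in> borel_measurable borel" for x
    using L2_measurable[OF hs_kernel_section[OF k, of x]] by simp
  have nn: "(\<integral>\<^sup>+y. ennreal ((k x (- y))\<^sup>2) \<partial>lborel) = (\<integral>\<^sup>+y. ennreal ((k x y)\<^sup>2) \<partial>lborel)" for x
    by (subst (2) nn_integral_real_affine[where c="-1" and t=0]) auto
  have "(\<integral>\<^sup>+z. ennreal ((case z of (x, y) \<Rightarrow> k x (- y))\<^sup>2) \<partial>(lborel \<Otimes>\<^sub>M lborel))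
      = (\<integral>\<^sup>+x. (\<integral>\<^sup>+y. ennreal ((k x (- y))\<^sup>2) \<partial>lborel) \<partial>lborel)"
    by (subst lborel.nn_integral_fst[symmetric]) (auto simp: case_prod_beta')
  also have "\<dots> = (\<integral>\<^sup>+z. ennreal ((case z of (x, y) \<Rightarrow> k x y)\<^sup>2) \<partial>(lborel \<Otimes>\<^sub>M lborel))"
    unfolding nn by (subst lborel.nn_integral_fst[symmetric]) (auto simp: case_prod_beta')
  also have "\<dots> < \<infinity>"
    using L2_integrable[OF hs_kernel_L2[OF k]] by (simp add: integrable_iff_bounded)
  finally have "integrable (lborel \<Otimes>\<^sub>M lborel) (\<lambda>z. (case z of (x, y) \<Rightarrow> k x (- y))\<^sup>2)"
    by (intro integrableI_nonneg) auto
  moreover have "integrable lborel (\<lambda>y. (k x (- y))\<^sup>2)" for x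
    using L2_integrable[OF hs_kernel_section[OF k, of x]]
    by (intro integrableI_nonneg) (auto simp: nn integrable_iff_bounded)
  ultimately show ?thesis by (simp add: hs_kernel_def L2_def)
qed

text \<open>
  The cyclic channel as an operator on \<open>L\<^sup>2\<close> of the whole line, so that channels of different lengths and the
  Gaussian channel can be compared.
\<close>

definition wrapped_kernel :: "real \<Rightarrow> real \<Rightarrow> real \<Rightarrow> real \<Rightarrow> real" where
  "wrapped_kernel s M x \<mu> = indicator (Omega M) x * indicator (Omega M) \<mu> *
     (wrapped_normal 1 M (x - \<mu>) * sqrt (wrapped_normal s M \<mu>) / sqrt (wrapped_marginal s M x))"

definition wrapped_hermite :: "real \<Rightarrow> real \<Rightarrow> nat \<Rightarrow> real \<Rightarrow> real" where
  "wrapped_hermite s M j \<mu> = indicator (Omega M) \<mu> * sqrt (wrapped_normal s M \<mu>) * hermite j (\<mu> / s)"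

lemma Omega_measurable [measurable]: "Omega M \<in> sets borel"
  by (simp add: Omega_def)

lemma wrapped_normal_le_normal:
  assumes "0 < s" "0 < m" "m \<le> M" "x \<in> Omega M"
  shows "wrapped_normal s M x \<le> (1 + image_mass s m) * normal_density 0 s x"
  using wrapped_normal_bound[of s m M x 0] assms by (auto simp: Omega_def abs_le_iff algebra_simps)

lemma gauss_kernel_nonneg [simp]: "0 \<le> gauss_kernel s x y"
  by (simp add: gauss_kernel_def)

lemma normal_density_minus: "normal_density 0 s (- x) = normal_density 0 s x"
  by (simp add: normal_density_def)

text \<open>
  The reflected copy of the Gaussian kernel accounts for the pairs near opposite ends of the interval, which
  are neighbours on the circle. The Gaussian kernel is square integrable and so is its reflection, whence a
  dominating function that is the same for all \<open>M \<ge> m\<close>.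
\<close>

lemma wrapped_kernel_bound:
  assumes s: "0 < s" and m: "0 < m" "m \<le> M"
  shows "\<bar>wrapped_kernel s M x \<mu>\<bar>
    \<le> ((1 + image_mass 1 m) * sqrt (1 + image_mass s m)) * \<bar>gauss_kernel s x \<mu> + gauss_kernel s x (- \<mu>)\<bar>"
proof (cases "x \<in> Omega M \<and> \<mu> \<in> Omega M")
  case True
  have M: "0 < M" using m by simp
  let ?\<tau> = "sqrt (1 + s\<^sup>2)"
  have tau: "0 < ?\<tau>" using s by (simp add: add_pos_nonneg)
  have S: "0 < image_mass 1 m" "0 < image_mass s m" using s m by (auto intro: image_mass_pos)
  have "wrapped_normal 1 M (x - \<mu>) \<le> std_normal_density (x - \<mu>) + image_mass 1 m * std_normal_density (x + \<mu>)"
    using True m by (intro wrapped_normal_bound) (auto simp: Omega_def)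
  also have "\<dots> \<le> (1 + image_mass 1 m) * (std_normal_density (x - \<mu>) + std_normal_density (x + \<mu>))"
    using S(1) normal_density_nonneg[of 0 1] by (simp add: algebra_simps)
  finally have 1: "wrapped_normal 1 M (x - \<mu>)
      \<le> (1 + image_mass 1 m) * (std_normal_density (x - \<mu>) + std_normal_density (x + \<mu>))" .
  have 2: "sqrt (wrapped_normal s M \<mu>) \<le> sqrt (1 + image_mass s m) * sqrt (normal_density 0 s \<mu>)"
    unfolding real_sqrt_mult[symmetric] using True s m
    by (intro real_sqrt_le_mono wrapped_normal_le_normal) auto
  have 3: "1 / sqrt (wrapped_marginal s M x) \<le> 1 / sqrt (normal_density 0 ?\<tau> x)"
    using wrapped_marginal_ge[OF s M, of x] normal_density_pos[OF tau, of 0 x]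
    by (intro divide_left_mono real_sqrt_le_mono) auto
  have nn: "0 \<le> wrapped_normal 1 M (x - \<mu>)" "0 \<le> wrapped_normal s M \<mu>" "0 \<le> wrapped_marginal s M x"
    using wrapped_normal_pos[of 1 M "x - \<mu>"] wrapped_normal_pos[of s M \<mu>] wrapped_marginal_pos[of s M x] s M
    by auto
  have "\<bar>wrapped_kernel s M x \<mu>\<bar> = wrapped_normal 1 M (x - \<mu>) * sqrt (wrapped_normal s M \<mu>)
      * (1 / sqrt (wrapped_marginal s M x))"
    using True nn by (simp add: wrapped_kernel_def)
  also have "\<dots> \<le> ((1 + image_mass 1 m) * (std_normal_density (x - \<mu>) + std_normal_density (x + \<mu>)))
      * (sqrt (1 + image_mass s m) * sqrt (normal_density 0 s \<mu>)) * (1 / sqrt (normal_density 0 ?\<tau> x))"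
    using S nn by (intro mult_mono 1 2 3 mult_nonneg_nonneg) auto
  also have "\<dots> = ((1 + image_mass 1 m) * sqrt (1 + image_mass s m)) * (gauss_kernel s x \<mu> + gauss_kernel s x (- \<mu>))"
    unfolding gauss_kernel_def minus_minus diff_minus_eq_add normal_density_minus
    by (simp add: algebra_simps add_divide_distrib)
  finally show ?thesis by simp
next
  case False
  have "0 \<le> (1 + image_mass 1 m) * sqrt (1 + image_mass s m)"
    using image_mass_pos[of 1 m] image_mass_pos[of s m] s m by simp
  then show ?thesis using False by (auto simp: wrapped_kernel_def)
qed

lemma wrapped_kernel_measurable [measurable]:
  assumes s: "0 < s" and M: "0 < M"
  shows "(\<lambda>(x, y). wrapped_kernel s M x y) \<in> borel_measurable (borel \<Otimes>\<^sub>M borel)"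
    "wrapped_kernel s M x \<in> borel_measurable borel"
proof -
  have [measurable]: "wrapped_normal 1 M \<in> borel_measurable borel" "wrapped_normal s M \<in> borel_measurable borel"
    "wrapped_marginal s M \<in> borel_measurable borel"
    using s M by auto
  show "(\<lambda>(x, y). wrapped_kernel s M x y) \<in> borel_measurable (borel \<Otimes>\<^sub>M borel)"
    "wrapped_kernel s M x \<in> borel_measurable borel"
    unfolding wrapped_kernel_def[abs_def] by measurable
qed

lemma borel_pair_lborel: "borel_measurable (lborel \<Otimes>\<^sub>M lborel) = borel_measurable (borel \<Otimes>\<^sub>M borel)"
  by (intro measurable_cong_sets sets_pair_measure_cong) auto

lemma gauss_kernel_dominating:
  assumes s: "0 < s"
  shows "(\<lambda>(x, y). gauss_kernel s x y + gauss_kernel s x (- y)) \<in> L2 (lborel \<Otimes>\<^sub>M lborel)"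
    "(\<lambda>y. gauss_kernel s x y + gauss_kernel s x (- y)) \<in> L2 lborel"
proof -
  have k: "hs_kernel (gauss_kernel s)" using gauss_kernel_hs[OF s refl refl] .
  show "(\<lambda>(x, y). gauss_kernel s x y + gauss_kernel s x (- y)) \<in> L2 (lborel \<Otimes>\<^sub>M lborel)"
    using L2_add[OF hs_kernel_L2[OF k] hs_kernel_L2[OF hs_kernel_reflect[OF k]]]
    by (simp add: case_prod_beta')
  show "(\<lambda>y. gauss_kernel s x y + gauss_kernel s x (- y)) \<in> L2 lborel"
    by (rule L2_add[OF hs_kernel_section[OF k] hs_kernel_section[OF hs_kernel_reflect[OF k]]])
qed

lemma wrapped_kernel_hs:
  assumes s: "0 < s" and M: "0 < M"
  shows "hs_kernel (wrapped_kernel s M)"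
  unfolding hs_kernel_def
proof (intro conjI allI)
  show "(\<lambda>(x, y). wrapped_kernel s M x y) \<in> L2 (lborel \<Otimes>\<^sub>M lborel)"
    using wrapped_kernel_measurable(1)[OF s M] wrapped_kernel_bound[OF s M order_refl]
    by (intro L2_bound[OF _ gauss_kernel_dominating(1)[OF s]]) (auto simp: borel_pair_lborel)
  show "wrapped_kernel s M x \<in> L2 lborel" for x
    using wrapped_kernel_measurable(2)[OF s M] wrapped_kernel_bound[OF s M order_refl]
    by (intro L2_bound[OF _ gauss_kernel_dominating(2)[OF s]]) auto
qed

lemma eventually_mem_Omega: "\<forall>\<^sub>F M in at_top. x \<in> Omega M"
  using eventually_ge_at_top[of "\<bar>x\<bar>"] by eventually_elim (auto simp: Omega_def)

lemma tendsto_indicator_Omega: "((\<lambda>M. indicator (Omega M) x :: real) \<longlongrightarrow> 1) at_top"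
  by (rule tendsto_eventually) (use eventually_mem_Omega[of x] in eventually_elim, simp)

lemma tendsto_wrapped_kernel:
  assumes s: "0 < s"
  shows "((\<lambda>M. hs_norm (\<lambda>x y. wrapped_kernel s M x y - gauss_kernel s x y)) \<longlongrightarrow> 0) at_top"
proof -
  have tau: "0 < sqrt (1 + s\<^sup>2)" using s by (simp add: add_pos_nonneg)
  have lim: "((\<lambda>M. wrapped_kernel s M x y) \<longlongrightarrow> gauss_kernel s x y) at_top" for x y
  proof -
    have "((\<lambda>M. wrapped_kernel s M x y) \<longlongrightarrow> 1 * 1 * (std_normal_density (x - y)
        * sqrt (normal_density 0 s y) / sqrt (normal_density 0 (sqrt (1 + s\<^sup>2)) x))) at_top"
      unfolding wrapped_kernel_def using s normal_density_pos[OF tau, of 0 x]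
      by (intro tendsto_mult tendsto_divide tendsto_real_sqrt tendsto_indicator_Omega
          tendsto_wrapped_normal tendsto_wrapped_marginal) auto
    then show ?thesis by (simp add: gauss_kernel_def)
  qed
  have "((\<lambda>M. l2_norm (lborel \<Otimes>\<^sub>M lborel)
      (\<lambda>z. (\<lambda>(x, y). wrapped_kernel s M x y) z - (\<lambda>(x, y). gauss_kernel s x y) z)) \<longlongrightarrow> 0) at_top"
  proof (rule tendsto_l2_norm_dominated)
    show "(\<lambda>(x, y). wrapped_kernel s M x y) \<in> borel_measurable (lborel \<Otimes>\<^sub>M lborel)" if "1 \<le> M" for M
      unfolding borel_pair_lborel using wrapped_kernel_measurable(1)[of s M] s that by simp
    show "\<bar>(\<lambda>(x, y). wrapped_kernel s M x y) z\<bar> \<le> ((1 + image_mass 1 1) * sqrt (1 + image_mass s 1))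
        * \<bar>(\<lambda>(x, y). gauss_kernel s x y + gauss_kernel s x (- y)) z\<bar>" if "1 \<le> M" for M z
      using wrapped_kernel_bound[OF s _ that, of "fst z" "snd z"] by (simp add: case_prod_beta)
    show "((\<lambda>M. (\<lambda>(x, y). wrapped_kernel s M x y) z) \<longlongrightarrow> (\<lambda>(x, y). gauss_kernel s x y) z) at_top" for z
      using lim by (simp add: case_prod_beta)
  qed (use gauss_kernel_dominating(1)[OF s] hs_kernel_L2[OF gauss_kernel_hs[OF s refl refl]] in auto)
  then show ?thesis by (simp add: hs_norm_def case_prod_beta')
qed

lemma wrapped_hermite_measurable [measurable]:
  "0 < s \<Longrightarrow> 0 < M \<Longrightarrow> wrapped_hermite s M j \<in> borel_measurable borel"
  using wrapped_normal_measurable[of s M] unfolding wrapped_hermite_def[abs_def] by measurable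

lemma wrapped_hermite_bound:
  assumes s: "0 < s" and m: "0 < m" "m \<le> M"
  shows "\<bar>wrapped_hermite s M j x\<bar> \<le> sqrt (1 + image_mass s m) * \<bar>hermite_fun s j x\<bar>"
proof (cases "x \<in> Omega M")
  case True
  have "sqrt (wrapped_normal s M x) \<le> sqrt (1 + image_mass s m) * sqrt (normal_density 0 s x)"
    unfolding real_sqrt_mult[symmetric] using True s m
    by (intro real_sqrt_le_mono wrapped_normal_le_normal) auto
  then have "sqrt (wrapped_normal s M x) * \<bar>hermite j (x / s)\<bar>
      \<le> sqrt (1 + image_mass s m) * sqrt (normal_density 0 s x) * \<bar>hermite j (x / s)\<bar>"
    by (intro mult_right_mono) auto
  moreover have "0 \<le> wrapped_normal s M x" using wrapped_normal_pos[of s M x] s m by simp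
  ultimately show ?thesis
    using True by (simp add: wrapped_hermite_def hermite_fun_def abs_mult)
next
  case False
  have "0 \<le> sqrt (1 + image_mass s m)" using image_mass_pos[OF s m(1)] by simp
  then show ?thesis using False by (simp add: wrapped_hermite_def)
qed

lemma wrapped_hermite_L2:
  assumes "0 < s" "0 < M" shows "wrapped_hermite s M j \<in> L2 lborel"
  using wrapped_hermite_bound[OF assms order_refl] wrapped_hermite_measurable[OF assms]
  by (intro L2_bound[OF _ hermite_fun_L2[OF assms(1)]]) auto

lemma tendsto_wrapped_hermite:
  assumes s: "0 < s"
  shows "((\<lambda>M. l2_norm lborel (\<lambda>x. wrapped_hermite s M j x - hermite_fun s j x)) \<longlongrightarrow> 0) at_top"
proof (rule tendsto_l2_norm_dominated)
  show "((\<lambda>M. wrapped_hermite s M j x) \<longlongrightarrow> hermite_fun s j x) at_top" for x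
  proof -
    have "((\<lambda>M. wrapped_hermite s M j x) \<longlongrightarrow> 1 * sqrt (normal_density 0 s x) * hermite j (x / s)) at_top"
      unfolding wrapped_hermite_def
      by (intro tendsto_mult tendsto_real_sqrt tendsto_const tendsto_indicator_Omega tendsto_wrapped_normal s)
    then show ?thesis by (simp add: hermite_fun_def)
  qed
  show "\<bar>wrapped_hermite s M j x\<bar> \<le> sqrt (1 + image_mass s 1) * \<bar>hermite_fun s j x\<bar>" if "1 \<le> M" for M x
    using wrapped_hermite_bound[OF s _ that] by simp
  show "wrapped_hermite s M j \<in> borel_measurable lborel" if "1 \<le> M" for M
    using wrapped_hermite_measurable[of s M j] s that by simp
qed (use hermite_fun_L2[OF s] in auto)

section \<open>Differentiating log-partition functions\<close>

lemma exp_minus_linear_bound: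
  fixes z :: real
  shows "\<bar>exp z - 1 - z\<bar> \<le> z\<^sup>2 * exp \<bar>z\<bar>"
proof -
  have key: "exp y - 1 \<le> y * exp y" for y :: real
  proof -
    have "exp y * (1 - y) \<le> exp y * exp (- y)"
      using exp_ge_add_one_self[of "- y"] by (intro mult_left_mono) auto
    then show ?thesis by (simp add: algebra_simps flip: exp_add)
  qed
  have "exp z - 1 - z \<le> z * (exp z - 1)" using key[of z] by (simp add: algebra_simps)
  also have "z * (exp z - 1) \<le> z\<^sup>2 * exp \<bar>z\<bar>"
  proof (cases "0 \<le> z")
    case True
    then show ?thesis using mult_left_mono[OF key[of z] True] by (simp add: power2_eq_square mult.assoc)
  next
    case False
    have "z * (exp z - 1) \<le> z * z"
      using exp_ge_add_one_self[of z] False by (intro mult_left_mono_neg) linarith+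
    also have "\<dots> \<le> z * z * exp \<bar>z\<bar>" using mult_left_mono[of 1 "exp \<bar>z\<bar>" "z * z"] by simp
    finally show ?thesis by (simp add: power2_eq_square)
  qed
  finally show ?thesis using exp_ge_add_one_self[of z] by linarith
qed

lemma le_exp: "(z :: real) \<le> exp z"
  using exp_ge_add_one_self[of z] by linarith

text \<open>
  Differentiation under the integral at \<open>0\<close>. The remainder \<open>\<bar>exp (h v) - 1 - h v\<bar>\<close> is at most
  \<open>h\<^sup>2 v\<^sup>2 exp \<bar>h v\<bar>\<close>, and both \<open>v\<^sup>2\<close> and \<open>exp \<bar>h v\<bar>\<close> are absorbed by half of the exponential
  moment each. Derivatives at other points follow by changing \<open>Y\<close>.
\<close>

lemma has_derivative_exp_integral:
  fixes Y v :: "'a \<Rightarrow> real"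
  assumes Y[measurable]: "Y \<in> borel_measurable N" and v[measurable]: "v \<in> borel_measurable N" and a: "0 < a"
    and int: "integrable N (\<lambda>x. Y x * exp (a * \<bar>v x\<bar>))"
  shows "((\<lambda>t. \<integral>x. Y x * exp (t * v x) \<partial>N) has_real_derivative (\<integral>x. Y x * v x \<partial>N)) (at 0)"
proof -
  let ?J = "\<lambda>h. \<integral>x. Y x * exp (h * v x) \<partial>N" and ?J1 = "\<integral>x. Y x * v x \<partial>N"
  define B where "B = (\<integral>x. \<bar>Y x * exp (a * \<bar>v x\<bar>)\<bar> \<partial>N)"
  have bnd: "integrable N (\<lambda>x. Y x * f x)"
    if "f \<in> borel_measurable N" "\<And>x. \<bar>f x\<bar> \<le> C * exp (a * \<bar>v x\<bar>)" for f C
    by (rule integrable_mult_bounded[OF int]) (use that in auto)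
  have i0: "integrable N Y" using bnd[of "\<lambda>_. 1" 1] a by simp
  have i1: "integrable N (\<lambda>x. Y x * v x)"
  proof (rule bnd[of v "1 / a"])
    fix x show "\<bar>v x\<bar> \<le> 1 / a * exp (a * \<bar>v x\<bar>)"
      using le_exp[of "a * \<bar>v x\<bar>"] a by (simp add: field_simps)
  qed simp
  have ih: "integrable N (\<lambda>x. Y x * exp (h * v x))" if "\<bar>h\<bar> \<le> a" for h
  proof (rule bnd[of _ 1])
    fix x
    have "h * v x \<le> \<bar>h\<bar> * \<bar>v x\<bar>" by (metis abs_ge_self abs_mult)
    also have "\<dots> \<le> a * \<bar>v x\<bar>" using that by (intro mult_right_mono) auto
    finally show "\<bar>exp (h * v x)\<bar> \<le> 1 * exp (a * \<bar>v x\<bar>)" by simp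
  qed measurable
  have est: "\<bar>?J h - ?J 0 - h * ?J1\<bar> \<le> h\<^sup>2 * (8 / a\<^sup>2 * B)"
    if h: "\<bar>h\<bar> \<le> a / 2" for h
  proof -
    have ha: "\<bar>h\<bar> \<le> a" using h a by linarith
    have pt: "\<bar>Y x * exp (h * v x) - Y x - h * (Y x * v x)\<bar> \<le> h\<^sup>2 * (8 / a\<^sup>2) * \<bar>Y x * exp (a * \<bar>v x\<bar>)\<bar>" for x
    proof -
      let ?z = "a * \<bar>v x\<bar> / 2"
      have z0: "0 \<le> ?z" using a by simp
      have "?z\<^sup>2 / 2 \<le> exp ?z" using exp_lower_Taylor_quadratic[OF z0] z0 by linarith
      then have v2: "(v x)\<^sup>2 \<le> 8 / a\<^sup>2 * exp ?z" using a by (simp add: power_divide power_mult_distrib field_simps)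
      have hv: "\<bar>h * v x\<bar> \<le> ?z"
        using mult_right_mono[OF h abs_ge_zero[of "v x"]] by (simp add: abs_mult)
      have "\<bar>exp (h * v x) - 1 - h * v x\<bar> \<le> (h * v x)\<^sup>2 * exp \<bar>h * v x\<bar>"
        by (rule exp_minus_linear_bound)
      also have "\<dots> \<le> (h\<^sup>2 * (8 / a\<^sup>2 * exp ?z)) * exp ?z"
        unfolding power_mult_distrib using hv v2 by (intro mult_mono mult_left_mono) auto
      also have "\<dots> = h\<^sup>2 * (8 / a\<^sup>2) * exp (a * \<bar>v x\<bar>)"
        by (simp add: mult.assoc flip: exp_add)
      finally have "\<bar>Y x\<bar> * \<bar>exp (h * v x) - 1 - h * v x\<bar> \<le> \<bar>Y x\<bar> * (h\<^sup>2 * (8 / a\<^sup>2) * exp (a * \<bar>v x\<bar>))"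
        by (rule mult_left_mono) simp
      moreover have "\<bar>Y x * exp (h * v x) - Y x - h * (Y x * v x)\<bar> = \<bar>Y x\<bar> * \<bar>exp (h * v x) - 1 - h * v x\<bar>"
        unfolding abs_mult[symmetric] by (simp add: algebra_simps)
      ultimately show ?thesis by (simp add: abs_mult algebra_simps)
    qed
    have intd: "integrable N (\<lambda>x. Y x * exp (h * v x) - Y x - h * (Y x * v x))"
      using i0 i1 ih[OF ha] by simp
    have "?J h - ?J 0 - h * ?J1
        = (\<integral>x. Y x * exp (h * v x) - Y x - h * (Y x * v x) \<partial>N)"
      using i0 i1 ih[OF ha] by simp
    also have "\<bar>\<dots>\<bar> \<le> (\<integral>x. \<bar>Y x * exp (h * v x) - Y x - h * (Y x * v x)\<bar> \<partial>N)"
      by (rule integral_abs_bound)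
    also have "\<dots> \<le> (\<integral>x. h\<^sup>2 * (8 / a\<^sup>2) * \<bar>Y x * exp (a * \<bar>v x\<bar>)\<bar> \<partial>N)"
      using intd int by (intro integral_mono pt) auto
    finally show ?thesis by (simp add: B_def)
  qed
  have "((\<lambda>h. (?J h - ?J 0) / h - ?J1) \<longlongrightarrow> 0) (at 0)"
  proof (rule Lim_null_comparison)
    show "\<forall>\<^sub>F h in at 0. norm ((?J h - ?J 0) / h - ?J1)
        \<le> \<bar>h\<bar> * (8 / a\<^sup>2 * B)"
      unfolding eventually_at
    proof (intro exI[of _ "a / 2"] conjI ballI impI)
      fix h :: real assume h: "h \<noteq> 0 \<and> dist h 0 < a / 2"
      have "(?J h - ?J 0) / h - ?J1
          = (?J h - ?J 0 - h * ?J1) / h"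
        using h by (simp add: field_simps)
      also have "\<bar>\<dots>\<bar> \<le> h\<^sup>2 * (8 / a\<^sup>2 * B) / \<bar>h\<bar>"
        unfolding abs_divide using h by (intro divide_right_mono est) auto
      also have "\<dots> = \<bar>h\<bar> * (8 / a\<^sup>2 * B)"
      proof -
        have sq: "h\<^sup>2 = \<bar>h\<bar> * \<bar>h\<bar>" by (simp add: power2_eq_square)
        show ?thesis unfolding sq using h by (simp del: abs_mult_self_eq)
      qed
      finally show "norm ((?J h - ?J 0) / h - ?J1)
          \<le> \<bar>h\<bar> * (8 / a\<^sup>2 * B)" by simp
    qed (use a in auto)
    show "((\<lambda>h. \<bar>h\<bar> * (8 / a\<^sup>2 * B)) \<longlongrightarrow> 0) (at 0)"
      using a by (auto intro!: tendsto_eq_intros)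
  qed
  then show ?thesis
    unfolding DERIV_def by (subst Lim_null) simp
qed

text \<open>
  The definition of \<open>hessian\<close> nests \<open>deriv\<close>, so the inner derivative has to exist on a neighbourhood for the
  outer one to be meaningful.
\<close>

definition has_mixed_deriv :: "'p::finite \<Rightarrow> 'p \<Rightarrow> (real ^ 'p \<Rightarrow> real) \<Rightarrow> real \<Rightarrow> bool" where
  "has_mixed_deriv i j F H \<longleftrightarrow> (\<exists>D.
     (\<forall>\<^sub>F s in nhds 0. ((\<lambda>t. F (s *\<^sub>R axis i 1 + t *\<^sub>R axis j 1)) has_real_derivative D s) (at 0)) \<and>
     (D has_real_derivative H) (at 0))"

lemma has_mixed_deriv_hessian:
  assumes "has_mixed_deriv i j F H"
  shows "hessian F 0 $ i $ j = H"
proof -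
  from assms obtain D where
    ev: "\<forall>\<^sub>F s in nhds 0. ((\<lambda>t. F (s *\<^sub>R axis i 1 + t *\<^sub>R axis j 1)) has_real_derivative D s) (at 0)"
    and D: "(D has_real_derivative H) (at 0)"
    by (auto simp: has_mixed_deriv_def)
  from ev have "\<forall>\<^sub>F s in nhds 0. partial_deriv j F (s *\<^sub>R axis i 1) = D s"
    by eventually_elim (auto simp: partial_deriv_def intro: DERIV_imp_deriv)
  then have "deriv (\<lambda>s. partial_deriv j F (s *\<^sub>R axis i 1)) 0 = deriv D 0"
    by (rule deriv_cong_ev) simp
  then show ?thesis
    using D by (simp add: hessian_def partial_deriv_def[of i] DERIV_imp_deriv)
qed

lemma has_mixed_deriv_linear: "has_mixed_deriv i j (\<lambda>\<theta>. c + \<theta> \<bullet> b) 0"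
  unfolding has_mixed_deriv_def
proof (intro exI[of _ "\<lambda>_. axis j 1 \<bullet> b"] conjI always_eventually allI)
  fix s :: real
  show "((\<lambda>t. c + (s *\<^sub>R axis i 1 + t *\<^sub>R axis j 1) \<bullet> b) has_real_derivative axis j 1 \<bullet> b) (at 0)"
    unfolding inner_add_left inner_scaleR_left by (auto intro!: derivative_eq_intros)
qed auto

lemma has_mixed_deriv_diff:
  assumes "has_mixed_deriv i j F A" "has_mixed_deriv i j G B"
  shows "has_mixed_deriv i j (\<lambda>\<theta>. F \<theta> - G \<theta>) (A - B)"
proof -
  from assms obtain D E where
    ev: "\<forall>\<^sub>F s in nhds 0. ((\<lambda>t. F (s *\<^sub>R axis i 1 + t *\<^sub>R axis j 1)) has_real_derivative D s) (at 0)"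
      "\<forall>\<^sub>F s in nhds 0. ((\<lambda>t. G (s *\<^sub>R axis i 1 + t *\<^sub>R axis j 1)) has_real_derivative E s) (at 0)"
    and DE: "(D has_real_derivative A) (at 0)" "(E has_real_derivative B) (at 0)"
    by (auto simp: has_mixed_deriv_def)
  from ev have "\<forall>\<^sub>F s in nhds 0. ((\<lambda>t. F (s *\<^sub>R axis i 1 + t *\<^sub>R axis j 1) - G (s *\<^sub>R axis i 1 + t *\<^sub>R axis j 1))
      has_real_derivative D s - E s) (at 0)"
    by eventually_elim (rule DERIV_diff)
  then show ?thesis
    unfolding has_mixed_deriv_def using DERIV_diff[OF DE] by (intro exI[of _ "\<lambda>s. D s - E s"] conjI)
qed

lemma has_mixed_deriv_cong:
  assumes F: "has_mixed_deriv i j F H" and eq: "\<forall>\<^sub>F \<theta> in nhds 0. F \<theta> = G \<theta>"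
  shows "has_mixed_deriv i j G H"
proof -
  from F obtain D where
    ev: "\<forall>\<^sub>F s in nhds 0. ((\<lambda>t. F (s *\<^sub>R axis i 1 + t *\<^sub>R axis j 1)) has_real_derivative D s) (at 0)"
    and D: "(D has_real_derivative H) (at 0)"
    by (auto simp: has_mixed_deriv_def)
  have "filterlim (\<lambda>s::real. s *\<^sub>R axis i 1 :: real ^ 'a) (nhds 0) (nhds 0)"
    by (rule tendsto_eq_intros filterlim_ident | simp)+
  then have "\<forall>\<^sub>F s in nhds 0. \<forall>\<^sub>F \<theta> in nhds (s *\<^sub>R axis i 1). F \<theta> = G \<theta>"
    using eq by (subst (asm) eventually_eventually[symmetric]) (rule filterlim_iff[THEN iffD1, rule_format])
  with ev have "\<forall>\<^sub>F s in nhds 0. ((\<lambda>t. G (s *\<^sub>R axis i 1 + t *\<^sub>R axis j 1)) has_real_derivative D s) (at 0)"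
  proof eventually_elim
    case (elim s)
    have "filterlim (\<lambda>t::real. s *\<^sub>R axis i 1 + t *\<^sub>R axis j 1 :: real ^ 'a) (nhds (s *\<^sub>R axis i 1)) (nhds 0)"
      by (rule tendsto_eq_intros filterlim_ident | simp)+
    with elim(2) have "\<forall>\<^sub>F t in nhds 0. F (s *\<^sub>R axis i 1 + t *\<^sub>R axis j 1) = G (s *\<^sub>R axis i 1 + t *\<^sub>R axis j 1)"
      by (auto simp: filterlim_iff)
    then show ?case using elim(1) by (subst (asm) DERIV_cong_ev) auto
  qed
  then show ?thesis unfolding has_mixed_deriv_def using D by blast
qed

lemma borel_measurable_vec_nth_comp [measurable (raw)]:
  fixes V :: "'a \<Rightarrow> real ^ 'p::finite"
  assumes "V \<in> borel_measurable N"
  shows "(\<lambda>x. V x $ i) \<in> borel_measurable N"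
  by (rule measurable_compose[OF assms]) (intro borel_measurable_continuous_onI continuous_intros)

text \<open>
  The norm is at most the dimension times the largest coordinate in absolute value, so \<open>exp (c * norm (V x))\<close>
  is at most a sum of exponentials of single signed coordinates, each of which is integrable by hypothesis.
\<close>

lemma exp_moment_norm:
  fixes V :: "real \<Rightarrow> real ^ 'p::finite" and w :: "real \<Rightarrow> real"
  assumes w[measurable]: "w \<in> borel_measurable borel" and V[measurable]: "V \<in> borel_measurable borel"
    and w0: "\<And>x. 0 \<le> w x"
    and ev: "\<forall>\<^sub>F \<theta> in nhds 0. integrable lborel (\<lambda>x. w x * exp (\<theta> \<bullet> V x))"
  shows "\<exists>c>0. integrable lborel (\<lambda>x. w x * exp (c * norm (V x)))"
proof -
  obtain d where d: "0 < d" and int: "\<And>\<theta>. dist \<theta> 0 < d \<Longrightarrow> integrable lborel (\<lambda>x. w x * exp (\<theta> \<bullet> V x))"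
    using ev unfolding eventually_nhds_metric by blast
  define e where "e = d / 2"
  define c where "c = e / real CARD('p)"
  have e: "0 < e" "0 < c" using d by (auto simp: e_def c_def)
  have i: "integrable lborel (\<lambda>x. w x * exp (r * V x $ i))" if "\<bar>r\<bar> = e" for r and i :: 'p
  proof -
    have "dist (r *\<^sub>R axis i 1 :: real ^ 'p) 0 < d"
      using that d by (simp add: e_def norm_axis_1)
    from int[OF this] show ?thesis by (simp add: cart_eq_inner_axis inner_commute)
  qed
  have "integrable lborel (\<lambda>x. w x * exp (c * norm (V x)))"
  proof (rule integrable_dominated)
    show "integrable lborel (\<lambda>x. \<Sum>i\<in>UNIV. w x * exp (e * V x $ i) + w x * exp (- e * V x $ i))"
      using i[of e] i[of "- e"] e
      by (intro Bochner_Integration.integrable_sum Bochner_Integration.integrable_add) auto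
    fix x
    obtain i where i: "c * norm (V x) \<le> e * \<bar>V x $ i\<bar>"
    proof (rule ccontr)
      assume "\<not> thesis"
      then have lt: "e * \<bar>V x $ i\<bar> < c * norm (V x)" for i using that by (meson not_le)
      have "e * norm (V x) \<le> e * (\<Sum>i\<in>UNIV. \<bar>V x $ i\<bar>)"
        using e norm_le_l1_cart[of "V x"] by (intro mult_left_mono) auto
      also have "\<dots> = (\<Sum>i\<in>UNIV. e * \<bar>V x $ i\<bar>)" by (rule sum_distrib_left)
      also have "\<dots> < (\<Sum>i\<in>(UNIV :: 'p set). c * norm (V x))"
        using lt by (intro sum_strict_mono) auto
      also have "\<dots> = e * norm (V x)" by (simp add: c_def)
      finally show False by simp
    qed
    have "exp (c * norm (V x)) \<le> exp (e * V x $ i) + exp (- e * V x $ i)"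
    proof (cases "0 \<le> V x $ i")
      case True
      then have "exp (c * norm (V x)) \<le> exp (e * V x $ i)" using i by simp
      then show ?thesis by (simp add: add_increasing2)
    next
      case False
      then have "exp (c * norm (V x)) \<le> exp (- e * V x $ i)" using i by simp
      then show ?thesis by (simp add: add_increasing)
    qed
    then have "w x * exp (c * norm (V x)) \<le> w x * (exp (e * V x $ i) + exp (- e * V x $ i))"
      using w0 by (intro mult_left_mono) auto
    also have "\<dots> = w x * exp (e * V x $ i) + w x * exp (- e * V x $ i)" by (rule distrib_left)
    also have "\<dots> \<le> (\<Sum>i\<in>UNIV. w x * exp (e * V x $ i) + w x * exp (- e * V x $ i))"
      using w0 by (intro member_le_sum) auto
    finally show "\<bar>w x * exp (c * norm (V x))\<bar>
      \<le> \<bar>\<Sum>i\<in>UNIV. w x * exp (e * V x $ i) + w x * exp (- e * V x $ i)\<bar>"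
      using w0 by simp
  qed measurable
  then show ?thesis using e by blast
qed

lemma exp_moment_integrable:
  fixes V :: "real \<Rightarrow> real ^ 'p::finite" and w :: "real \<Rightarrow> real"
  assumes w[measurable]: "w \<in> borel_measurable borel" and V[measurable]: "V \<in> borel_measurable borel"
    and int: "integrable lborel (\<lambda>x. w x * exp (c * norm (V x)))"
    and f[measurable]: "f \<in> borel_measurable borel" and bd: "\<And>x. \<bar>f x\<bar> \<le> C * exp (c * norm (V x))"
  shows "integrable lborel (\<lambda>x. w x * f x)"
  by (rule integrable_mult_bounded[OF int]) (use bd in auto)

lemma exp_moment_poly_integrable:
  fixes V :: "real \<Rightarrow> real ^ 'p::finite" and w :: "real \<Rightarrow> real"
  assumes w: "w \<in> borel_measurable borel" and V[measurable]: "V \<in> borel_measurable borel"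
    and c: "0 < c" and int: "integrable lborel (\<lambda>x. w x * exp (c * norm (V x)))"
  shows "integrable lborel w" "integrable lborel (\<lambda>x. w x * V x $ i)"
    "integrable lborel (\<lambda>x. w x * (V x $ i * V x $ j))"
proof -
  note I = exp_moment_integrable[OF w V int]
  show "integrable lborel w" using I[of "\<lambda>_. 1" 1] c by simp
  show "integrable lborel (\<lambda>x. w x * V x $ i)"
  proof (rule I[of _ "1 / c"])
    fix x show "\<bar>V x $ i\<bar> \<le> 1 / c * exp (c * norm (V x))"
    proof -
      have "c * \<bar>V x $ i\<bar> \<le> c * norm (V x)"
        using c by (intro mult_left_mono component_le_norm_cart) auto
      also have "\<dots> \<le> exp (c * norm (V x))" by (rule le_exp)
      finally show ?thesis using c by (simp add: field_simps)
    qed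
  qed measurable
  show "integrable lborel (\<lambda>x. w x * (V x $ i * V x $ j))"
  proof (rule I[of _ "2 / c\<^sup>2"])
    fix x
    have "(c * norm (V x))\<^sup>2 / 2 \<le> exp (c * norm (V x))"
      using exp_lower_Taylor_quadratic[of "c * norm (V x)"] c by (smt (verit) mult_nonneg_nonneg norm_ge_zero)
    then have "(norm (V x))\<^sup>2 \<le> 2 / c\<^sup>2 * exp (c * norm (V x))"
      using c by (simp add: field_simps power_mult_distrib)
    moreover have "\<bar>V x $ i * V x $ j\<bar> \<le> norm (V x) * norm (V x)"
      unfolding abs_mult by (intro mult_mono component_le_norm_cart) auto
    ultimately show "\<bar>V x $ i * V x $ j\<bar> \<le> 2 / c\<^sup>2 * exp (c * norm (V x))"
      by (simp add: power2_eq_square)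
  qed measurable
qed

lemma exp_moment_pos:
  fixes V :: "real \<Rightarrow> real ^ 'p::finite" and w :: "real \<Rightarrow> real"
  assumes w: "w \<in> borel_measurable borel" and V[measurable]: "V \<in> borel_measurable borel" and w0: "\<And>x. 0 \<le> w x"
    and int: "integrable lborel (\<lambda>x. w x * exp (c * norm (V x)))"
    and pos: "0 < (LBINT x. w x)" and th: "norm \<theta> \<le> c"
  shows "integrable lborel (\<lambda>x. w x * exp (\<theta> \<bullet> V x))" "0 < (LBINT x. w x * exp (\<theta> \<bullet> V x))"
proof -
  have "\<theta> \<bullet> V x \<le> c * norm (V x)" for x
    using norm_cauchy_schwarz[of \<theta> "V x"] mult_right_mono[OF th norm_ge_zero[of "V x"]] by linarith
  then show i: "integrable lborel (\<lambda>x. w x * exp (\<theta> \<bullet> V x))"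
    by (intro exp_moment_integrable[OF w V int, of _ 1]) auto
  have "(LBINT x. w x * exp (\<theta> \<bullet> V x)) \<noteq> 0"
  proof
    assume "(LBINT x. w x * exp (\<theta> \<bullet> V x)) = 0"
    then have "AE x in lborel. w x * exp (\<theta> \<bullet> V x) = 0"
      using i w0 by (subst (asm) integral_nonneg_eq_0_iff_AE) auto
    then have "AE x in lborel. w x = 0" by eventually_elim simp
    then have "(LBINT x. w x) = 0" by (rule integral_eq_zero_AE)
    then show False using pos by simp
  qed
  moreover have "0 \<le> (LBINT x. w x * exp (\<theta> \<bullet> V x))"
    using w0 by (intro integral_nonneg_AE) auto
  ultimately show "0 < (LBINT x. w x * exp (\<theta> \<bullet> V x))" by linarith
qed

text \<open>
  The second derivative of a cumulant generating function is a covariance. Covariances do not change under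
  shifts, and the formula allows arbitrary centring constants \<open>a\<close> and \<open>b\<close>, which may differ from the means
  under the weight \<open>w\<close>; posterior covariances can then be centred at the prior mean.
\<close>

lemma has_mixed_deriv_log_partition:
  fixes V :: "real \<Rightarrow> real ^ 'p::finite" and w :: "real \<Rightarrow> real"
  assumes w[measurable]: "w \<in> borel_measurable borel" and V[measurable]: "V \<in> borel_measurable borel"
    and w0: "\<And>x. 0 \<le> w x" and c: "0 < c"
    and int: "integrable lborel (\<lambda>x. w x * exp (c * norm (V x)))"
    and pos: "0 < (LBINT x. w x)"
  defines "W \<equiv> (LBINT x. w x)"
  shows "has_mixed_deriv i j (\<lambda>\<theta>. ln (LBINT x. w x * exp (\<theta> \<bullet> V x)))
    ((LBINT x. w x * ((V x $ i - a) * (V x $ j - b))) / W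
      - (LBINT x. w x * (V x $ i - a)) * (LBINT x. w x * (V x $ j - b)) / W\<^sup>2)"
proof -
  let ?Z = "\<lambda>s t. LBINT x. w x * exp ((s *\<^sub>R axis i 1 + t *\<^sub>R axis j 1) \<bullet> V x)"
  note P = exp_moment_pos[OF w V w0 int pos]
  note Q = exp_moment_poly_integrable[OF w V c int]
  define Z where "Z s = (LBINT x. w x * exp (s * V x $ i))" for s
  define G where "G s = (LBINT x. w x * V x $ j * exp (s * V x $ i))" for s
  have ax: "axis k 1 \<bullet> V x = V x $ k" for k x
    by (simp add: cart_eq_inner_axis inner_commute)
  have dom: "integrable lborel (\<lambda>x. w x * f x)"
    if "f \<in> borel_measurable borel" "\<And>x. \<bar>f x\<bar> \<le> C * exp (c * norm (V x))" for f C
    by (rule exp_moment_integrable[OF w V int that])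
  have Zpos: "0 < Z s" if "\<bar>s\<bar> \<le> c" for s
    using P(2)[of "s *\<^sub>R axis i 1"] that by (simp add: Z_def ax norm_axis_1)
  have first: "((\<lambda>t. ln (?Z s t))
      has_real_derivative G s / Z s) (at 0)" if s: "\<bar>s\<bar> \<le> c / 2" for s
  proof -
    have sc: "\<bar>s\<bar> \<le> c" using s c by linarith
    have "((\<lambda>t. LBINT x. (w x * exp (s * V x $ i)) * exp (t * V x $ j))
        has_real_derivative (LBINT x. (w x * exp (s * V x $ i)) * V x $ j)) (at 0)"
    proof (rule has_derivative_exp_integral[where a="c / 2"])
      have "integrable lborel (\<lambda>x. w x * (exp (s * V x $ i) * exp (c / 2 * \<bar>V x $ j\<bar>)))"
      proof (rule dom[of _ 1])
        fix x
        have "s * V x $ i \<le> \<bar>s\<bar> * \<bar>V x $ i\<bar>" by (metis abs_ge_self abs_mult)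
        also have "\<dots> \<le> c / 2 * norm (V x)"
          using s by (intro mult_mono component_le_norm_cart) auto
        finally have "s * V x $ i + c / 2 * \<bar>V x $ j\<bar> \<le> c / 2 * norm (V x) + c / 2 * norm (V x)"
          using c by (intro add_mono mult_left_mono component_le_norm_cart) auto
        then show "\<bar>exp (s * V x $ i) * exp (c / 2 * \<bar>V x $ j\<bar>)\<bar> \<le> 1 * exp (c * norm (V x))"
          by (simp flip: exp_add)
      qed measurable
      then show "integrable lborel (\<lambda>x. (w x * exp (s * V x $ i)) * exp (c / 2 * \<bar>V x $ j\<bar>))"
        by (simp add: mult.assoc)
    qed (use c in auto)
    moreover have "(?Z s t)
        = (LBINT x. (w x * exp (s * V x $ i)) * exp (t * V x $ j))" for t
      by (simp add: inner_add_left ax exp_add mult.assoc)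
    moreover have "(LBINT x. (w x * exp (s * V x $ i)) * V x $ j) = G s"
      by (simp add: G_def ac_simps)
    ultimately have d: "((\<lambda>t. ?Z s t)
        has_real_derivative G s) (at 0)" by simp
    have "(?Z s 0) = Z s"
      by (simp add: Z_def ax)
    then have "(ln has_real_derivative 1 / Z s)
        (at (?Z s 0))"
      using DERIV_ln_divide[OF Zpos[OF sc]] by (simp only:)
    from DERIV_chain2[where f=ln and g="\<lambda>t. ?Z s t", OF this d]
    show ?thesis by simp
  qed
  have dZ: "(Z has_real_derivative (LBINT x. w x * V x $ i)) (at 0)"
    unfolding Z_def[abs_def]
  proof (rule has_derivative_exp_integral[where a="c"])
    show "integrable lborel (\<lambda>x. w x * exp (c * \<bar>V x $ i\<bar>))"
      using c by (intro dom[of _ 1]) (auto intro: component_le_norm_cart)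
  qed (use c in auto)
  have dG: "(G has_real_derivative (LBINT x. w x * V x $ j * V x $ i)) (at 0)"
    unfolding G_def[abs_def]
  proof (rule has_derivative_exp_integral[where a="c / 2"])
    have "integrable lborel (\<lambda>x. w x * (V x $ j * exp (c / 2 * \<bar>V x $ i\<bar>)))"
    proof (rule dom[of _ "2 / c"])
      fix x
      have "c / 2 * \<bar>V x $ j\<bar> \<le> exp (c / 2 * norm (V x))"
        using le_exp[of "c / 2 * norm (V x)"] mult_left_mono[OF component_le_norm_cart[of "V x" j], of "c / 2"] c
        by linarith
      then have "\<bar>V x $ j\<bar> \<le> 2 / c * exp (c / 2 * norm (V x))" using c by (simp add: field_simps)
      then have "\<bar>V x $ j\<bar> * exp (c / 2 * \<bar>V x $ i\<bar>) \<le> 2 / c * exp (c / 2 * norm (V x)) * exp (c / 2 * norm (V x))"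
        using c by (intro mult_mono) (auto intro: component_le_norm_cart)
      then show "\<bar>V x $ j * exp (c / 2 * \<bar>V x $ i\<bar>)\<bar> \<le> 2 / c * exp (c * norm (V x))"
        by (simp add: abs_mult mult.assoc flip: exp_add)
    qed measurable
    then show "integrable lborel (\<lambda>x. w x * V x $ j * exp (c / 2 * \<bar>V x $ i\<bar>))" by (simp add: mult.assoc)
  qed (use c in auto)
  have W: "Z 0 = W" "0 < W" using pos by (auto simp: Z_def W_def)
  define mi mj mij where "mi = (LBINT x. w x * V x $ i)" and "mj = (LBINT x. w x * V x $ j)"
    and "mij = (LBINT x. w x * (V x $ i * V x $ j))"
  have G0: "G 0 = mj" by (simp add: G_def mj_def)
  have sec: "((\<lambda>s. G s / Z s) has_real_derivative (mij * W - mj * mi) / (W * W)) (at 0)"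
  proof -
    have "(LBINT x. w x * V x $ j * V x $ i) = mij" by (simp add: mij_def ac_simps)
    with DERIV_divide[OF dG dZ] W show ?thesis by (simp add: G0 mi_def)
  qed
  have "(mij * W - mj * mi) / (W * W)
     = (LBINT x. w x * ((V x $ i - a) * (V x $ j - b))) / W
      - (LBINT x. w x * (V x $ i - a)) * (LBINT x. w x * (V x $ j - b)) / W\<^sup>2"
  proof -
    have "(LBINT x. w x * (V x $ i - a)) = (LBINT x. w x * V x $ i - a * w x)"
      by (simp add: algebra_simps)
    then have 1: "(LBINT x. w x * (V x $ i - a)) = mi - a * W"
      using Q by (simp add: mi_def W_def)
    have "(LBINT x. w x * (V x $ j - b)) = (LBINT x. w x * V x $ j - b * w x)"
      by (simp add: algebra_simps)
    then have 2: "(LBINT x. w x * (V x $ j - b)) = mj - b * W"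
      using Q by (simp add: mj_def W_def)
    have "(LBINT x. w x * ((V x $ i - a) * (V x $ j - b)))
        = (LBINT x. w x * (V x $ i * V x $ j) - b * (w x * V x $ i) - a * (w x * V x $ j) + a * b * w x)"
      by (simp add: algebra_simps)
    then have 3: "(LBINT x. w x * ((V x $ i - a) * (V x $ j - b))) = mij - b * mi - a * mj + a * b * W"
      using Q by (simp add: mi_def mj_def mij_def W_def)
    show ?thesis unfolding 1 2 3 using W by (simp add: field_simps power2_eq_square)
  qed
  moreover have "\<forall>\<^sub>F s in nhds 0. \<bar>s\<bar> \<le> c / 2"
    unfolding eventually_nhds_metric using c by (intro exI[of _ "c / 2"]) auto
  then have "\<forall>\<^sub>F s in nhds 0. ((\<lambda>t. ln (?Z s t))
      has_real_derivative G s / Z s) (at 0)"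
    by eventually_elim (rule first)
  ultimately show ?thesis
    unfolding has_mixed_deriv_def using sec by (intro exI[of _ "\<lambda>s. G s / Z s"]) simp
qed

section \<open>Fisher information as a Gram matrix\<close>

definition statistic_mean :: "real \<Rightarrow> real \<Rightarrow> (real \<Rightarrow> real ^ 'p::finite) \<Rightarrow> 'p \<Rightarrow> real" where
  "statistic_mean s M T i = (LBINT \<mu>. indicator (Omega M) \<mu> * wrapped_normal s M \<mu> * T \<mu> $ i)"

text \<open>
  The score of the family in direction \<open>i\<close> at \<open>\<eta> = 0\<close>, multiplied by \<open>sqrt g\<^sub>0\<close>.
\<close>

definition score :: "real \<Rightarrow> real \<Rightarrow> (real \<Rightarrow> real ^ 'p::finite) \<Rightarrow> 'p \<Rightarrow> real \<Rightarrow> real" where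
  "score s M T i \<mu> = indicator (Omega M) \<mu> * sqrt (wrapped_normal s M \<mu>) * (T \<mu> $ i - statistic_mean s M T i)"

definition prior_weight :: "real \<Rightarrow> real \<Rightarrow> real \<Rightarrow> real" where
  "prior_weight s M \<mu> = indicator (Omega M) \<mu> * wrapped_normal s M \<mu>"

text \<open>
  A statistic is measurable on the interval only; its extension by zero is measurable on the line.
\<close>

definition zero_off :: "real \<Rightarrow> (real \<Rightarrow> real ^ 'p::finite) \<Rightarrow> real \<Rightarrow> real ^ 'p" where
  "zero_off M T \<mu> = indicator (Omega M) \<mu> *\<^sub>R T \<mu>"

lemma
  assumes s: "0 < s" and M: "0 < M"
  shows prior_weight_measurable [measurable]: "prior_weight s M \<in> borel_measurable borel"
    and prior_weight_nonneg: "0 \<le> prior_weight s M \<mu>"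
    and integrable_prior_weight: "integrable lborel (prior_weight s M)"
    and integral_prior_weight: "(LBINT \<mu>. prior_weight s M \<mu>) = 1"
proof -
  have [measurable]: "wrapped_normal s M \<in> borel_measurable borel" using s M by simp
  show m[measurable]: "prior_weight s M \<in> borel_measurable borel"
    unfolding prior_weight_def[abs_def] by measurable
  show nn: "0 \<le> prior_weight s M \<mu>" for \<mu>
    using wrapped_normal_pos[OF s M, of \<mu>] by (simp add: prior_weight_def)
  have "(\<integral>\<^sup>+\<mu>. ennreal (prior_weight s M \<mu>) \<partial>lborel) = 1"
    using nn_integral_wrapped_normal[OF s M, of 0]
    by (simp add: prior_weight_def ennreal_mult' ennreal_indicator)
  then show "integrable lborel (prior_weight s M)" "(LBINT \<mu>. prior_weight s M \<mu>) = 1"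
    using nn by (auto intro!: integrableI_nonneg simp: integral_eq_nn_integral)
qed

lemma integral_posterior_weight:
  assumes s: "0 < s" and M: "0 < M"
  shows "(LBINT \<mu>. prior_weight s M \<mu> * wrapped_normal 1 M (x - \<mu>)) = wrapped_marginal s M x"
proof -
  have [measurable]: "wrapped_normal 1 M \<in> borel_measurable borel" "prior_weight s M \<in> borel_measurable borel"
    using s M by auto
  have nn: "0 \<le> prior_weight s M \<mu> * wrapped_normal 1 M (x - \<mu>)" for \<mu>
    using prior_weight_nonneg[OF s M, of \<mu>] wrapped_normal_pos[of 1 M "x - \<mu>"] M by simp
  have "(\<integral>\<^sup>+\<mu>. ennreal (prior_weight s M \<mu> * wrapped_normal 1 M (x - \<mu>)) \<partial>lborel)
      = (\<integral>\<^sup>+\<mu>. indicator (Omega M) \<mu> * ennreal (wrapped_normal 1 M (x - \<mu>) * wrapped_normal s M \<mu>) \<partial>lborel)"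
    by (intro nn_integral_cong) (auto simp: prior_weight_def indicator_def mult.commute)
  also have "\<dots> = ennreal (wrapped_marginal s M x)"
    by (rule nn_integral_wrapped_marginal[OF s M])
  finally show "(LBINT \<mu>. prior_weight s M \<mu> * wrapped_normal 1 M (x - \<mu>)) = wrapped_marginal s M x"
    using nn wrapped_marginal_pos[OF s M, of x]
    by (simp add: integral_eq_nn_integral)
qed

lemma
  assumes M: "0 < M"
  shows integrable_cyclic_kernel: "integrable lborel (\<lambda>x. indicator (Omega M) x * wrapped_normal 1 M (x - \<mu>))"
    and integral_cyclic_kernel: "(LBINT x. indicator (Omega M) x * wrapped_normal 1 M (x - \<mu>)) = 1"
proof -
  have [measurable]: "wrapped_normal 1 M \<in> borel_measurable borel"
    using M by auto
  have nn: "0 \<le> indicator (Omega M) x * wrapped_normal 1 M (x - \<mu>)" for x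
    using wrapped_normal_pos[of 1 M "x - \<mu>"] M by simp
  have "(\<integral>\<^sup>+x. ennreal (indicator (Omega M) x * wrapped_normal 1 M (x - \<mu>)) \<partial>lborel) = 1"
    using nn_integral_wrapped_normal[of 1 M \<mu>] M
    by (simp add: ennreal_mult' ennreal_indicator)
  then show "integrable lborel (\<lambda>x. indicator (Omega M) x * wrapped_normal 1 M (x - \<mu>))"
    "(LBINT x. indicator (Omega M) x * wrapped_normal 1 M (x - \<mu>)) = 1"
    using nn by (auto intro!: integrableI_nonneg simp: integral_eq_nn_integral)
qed

text \<open>
  Fubini and the normalisation of the cyclic kernel: averaging over \<open>X\<close> returns the prior integral.
\<close>

lemma integral_posterior_average:
  assumes s: "0 < s" and M: "0 < M" and h: "integrable lborel h"
  shows "integrable lborel (\<lambda>x. indicator (Omega M) x * (LBINT \<mu>. h \<mu> * wrapped_normal 1 M (x - \<mu>)))"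
    and "(LBINT x. indicator (Omega M) x * (LBINT \<mu>. h \<mu> * wrapped_normal 1 M (x - \<mu>))) = (LBINT \<mu>. h \<mu>)"
proof -
  have [measurable]: "wrapped_normal 1 M \<in> borel_measurable borel" "h \<in> borel_measurable lborel"
    using M h by auto
  let ?f = "\<lambda>\<mu> x. h \<mu> * (indicator (Omega M) x * wrapped_normal 1 M (x - \<mu>))"
  have nn: "0 \<le> indicator (Omega M) x * wrapped_normal 1 M (x - \<mu>)" for x \<mu>
    using wrapped_normal_pos[of 1 M "x - \<mu>"] M by simp
  have f: "integrable (lborel \<Otimes>\<^sub>M lborel) (\<lambda>(\<mu>, x). ?f \<mu> x)"
  proof (rule lborel_pair.Fubini_integrable)
    have "(LBINT x. norm (?f \<mu> x)) = \<bar>h \<mu>\<bar>" for \<mu>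
      unfolding real_norm_def abs_mult[of "h \<mu>"] abs_of_nonneg[OF nn]
      by (simp add: integral_cyclic_kernel[OF M])
    then show "integrable lborel (\<lambda>\<mu>. LBINT x. norm (case (\<mu>, x) of (\<mu>, x) \<Rightarrow> ?f \<mu> x))"
      using h by simp
    show "AE \<mu> in lborel. integrable lborel (\<lambda>x. case (\<mu>, x) of (\<mu>, x) \<Rightarrow> ?f \<mu> x)"
      using integrable_cyclic_kernel[OF M] by simp
  qed measurable
  have eq: "(LBINT \<mu>. ?f \<mu> x) = indicator (Omega M) x * (LBINT \<mu>. h \<mu> * wrapped_normal 1 M (x - \<mu>))" for x
    by (simp add: mult.left_commute[of "h _"])
  show "integrable lborel (\<lambda>x. indicator (Omega M) x * (LBINT \<mu>. h \<mu> * wrapped_normal 1 M (x - \<mu>)))"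
    using lborel_pair.integrable_snd[OF f] unfolding eq .
  show "(LBINT x. indicator (Omega M) x * (LBINT \<mu>. h \<mu> * wrapped_normal 1 M (x - \<mu>))) = (LBINT \<mu>. h \<mu>)"
    using lborel_pair.Fubini_integral[OF f] unfolding eq by (simp add: integral_cyclic_kernel[OF M])
qed

lemma sqrt_factor_merge:
  fixes W :: real
  assumes "0 \<le> W"
  shows "sqrt W * a * (sqrt W * b) = W * (a * b)" "sqrt W * a * sqrt W = W * a"
    "k * sqrt W / f * (sqrt W * b) = W * k * b / f"
proof -
  have sq: "sqrt W * sqrt W = W" using assms by simp
  have "sqrt W * a * (sqrt W * b) = (sqrt W * sqrt W) * (a * b)" by (simp only: ac_simps)
  then show "sqrt W * a * (sqrt W * b) = W * (a * b)" unfolding sq .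
  have "sqrt W * a * sqrt W = (sqrt W * sqrt W) * a" by (simp only: ac_simps)
  then show "sqrt W * a * sqrt W = W * a" unfolding sq .
  have "k * sqrt W / f * (sqrt W * b) = (sqrt W * sqrt W) * k * b / f"
    by (simp only: times_divide_eq_left times_divide_eq_right ac_simps)
  then show "k * sqrt W / f * (sqrt W * b) = W * k * b / f" unfolding sq .
qed

context
  fixes s M :: real and T :: "real \<Rightarrow> real ^ 'p::finite"
  assumes s: "0 < s" and M: "0 < M"
    and T: "T \<in> borel_measurable (restrict_space borel (Omega M))"
    and ev: "\<forall>\<^sub>F \<eta> in nhds 0. set_integrable lborel (Omega M) (\<lambda>\<mu>. wrapped_gaussian s M \<mu> * exp (\<eta> \<bullet> T \<mu>))"
begin

lemma zero_off_measurable: "zero_off M T \<in> borel_measurable borel"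
  using T unfolding zero_off_def[abs_def] by (subst (asm) borel_measurable_restrict_space_iff) auto

lemma prior_weight_exp:
  "indicator (Omega M) \<mu> *\<^sub>R (wrapped_gaussian s M \<mu> * exp (\<theta> \<bullet> T \<mu>)) = prior_weight s M \<mu> * exp (\<theta> \<bullet> zero_off M T \<mu>)"
  by (simp add: prior_weight_def zero_off_def wrapped_gaussian_eq[OF s] indicator_def)

lemma log_partition_eq:
  "log_partition M (wrapped_gaussian s M) T \<theta> = ln (LBINT \<mu>. prior_weight s M \<mu> * exp (\<theta> \<bullet> zero_off M T \<mu>))"
  by (simp only: log_partition_def set_lebesgue_integral_def prior_weight_exp)

lemma log_partition_0: "log_partition M (wrapped_gaussian s M) T 0 = 0"
  unfolding log_partition_eq by (simp add: integral_prior_weight[OF s M])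

lemma statistic_exp_moment:
  "\<exists>c>0. integrable lborel (\<lambda>\<mu>. prior_weight s M \<mu> * exp (c * norm (zero_off M T \<mu>)))"
  using ev unfolding set_integrable_def prior_weight_exp
  by (intro exp_moment_norm zero_off_measurable) (auto simp: prior_weight_measurable prior_weight_nonneg s M)

lemma statistic_moments:
  "integrable lborel (\<lambda>\<mu>. prior_weight s M \<mu> * zero_off M T \<mu> $ i)"
  "integrable lborel (\<lambda>\<mu>. prior_weight s M \<mu> * (zero_off M T \<mu> $ i * zero_off M T \<mu> $ j))"
  using statistic_exp_moment exp_moment_poly_integrable[OF prior_weight_measurable[OF s M] zero_off_measurable]
  by blast+

lemma statistic_mean_eq: "statistic_mean s M T i = (LBINT \<mu>. prior_weight s M \<mu> * zero_off M T \<mu> $ i)"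
  unfolding statistic_mean_def
  by (intro Bochner_Integration.integral_cong refl) (simp add: prior_weight_def zero_off_def indicator_def)

lemma score_mult: "score s M T i \<mu> * score s M T j \<mu> = prior_weight s M \<mu> *
  ((zero_off M T \<mu> $ i - statistic_mean s M T i) * (zero_off M T \<mu> $ j - statistic_mean s M T j))"
proof -
  have nn: "0 \<le> wrapped_normal s M \<mu>" using wrapped_normal_pos[OF s M, of \<mu>] by simp
  then show ?thesis
    by (simp add: score_def prior_weight_def zero_off_def indicator_def sqrt_factor_merge(1)[OF nn])
qed

lemma integrable_score_mult: "integrable lborel (\<lambda>\<mu>. score s M T i \<mu> * score s M T j \<mu>)"
proof -
  note Q = statistic_moments integrable_prior_weight[OF s M]
  let ?a = "statistic_mean s M T i" and ?b = "statistic_mean s M T j"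
  have "integrable lborel (\<lambda>\<mu>. prior_weight s M \<mu> * (zero_off M T \<mu> $ i * zero_off M T \<mu> $ j)
      - ?b * (prior_weight s M \<mu> * zero_off M T \<mu> $ i) - ?a * (prior_weight s M \<mu> * zero_off M T \<mu> $ j)
      + ?a * ?b * prior_weight s M \<mu>)"
    using Q by simp
  then show ?thesis unfolding score_mult by (simp add: algebra_simps)
qed

lemma score_measurable: "score s M T i \<in> borel_measurable borel"
proof -
  have [measurable]: "zero_off M T \<in> borel_measurable borel" "wrapped_normal s M \<in> borel_measurable borel"
    using zero_off_measurable s M by auto
  have "score s M T i = (\<lambda>\<mu>. indicator (Omega M) \<mu> * sqrt (wrapped_normal s M \<mu>) * (zero_off M T \<mu> $ i - statistic_mean s M T i))"
    by (auto simp: score_def zero_off_def indicator_def)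
  then show ?thesis by simp
qed

lemma score_L2: "score s M T i \<in> L2 lborel"
  using integrable_score_mult[of i i] score_measurable[of i] by (simp add: L2_def power2_eq_square)

lemma score_mean_zero: "l2_inner lborel (score s M T i) (wrapped_hermite s M 0) = 0"
proof -
  note Q = statistic_moments integrable_prior_weight[OF s M]
  have nn: "0 \<le> wrapped_normal s M \<mu>" for \<mu> using wrapped_normal_pos[OF s M, of \<mu>] by simp
  have "l2_inner lborel (score s M T i) (wrapped_hermite s M 0)
      = (LBINT \<mu>. prior_weight s M \<mu> * zero_off M T \<mu> $ i - statistic_mean s M T i * prior_weight s M \<mu>)"
  proof -
    have "score s M T i \<mu> * wrapped_hermite s M 0 \<mu> = prior_weight s M \<mu> * (zero_off M T \<mu> $ i - statistic_mean s M T i)" for \<mu>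
      using nn by (simp add: score_def wrapped_hermite_def hermite_eq_poly prior_weight_def zero_off_def
          indicator_def sqrt_factor_merge(2)[OF nn])
    then have "l2_inner lborel (score s M T i) (wrapped_hermite s M 0)
        = (LBINT \<mu>. prior_weight s M \<mu> * (zero_off M T \<mu> $ i - statistic_mean s M T i))"
      by (simp only: l2_inner_def)
    then show ?thesis by (simp only: right_diff_distrib mult.commute[of "statistic_mean s M T i"])
  qed
  also have "\<dots> = statistic_mean s M T i - statistic_mean s M T i * 1"
    using Q by (simp add: statistic_mean_eq integral_prior_weight[OF s M])
  finally show ?thesis by simp
qed

lemma has_mixed_deriv_weighted:
  assumes k[measurable]: "k \<in> borel_measurable borel" and kb: "\<And>\<mu>. 0 \<le> k \<mu>" "\<And>\<mu>. k \<mu> \<le> K"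
    and pos: "0 < (LBINT \<mu>. prior_weight s M \<mu> * k \<mu>)"
  defines "W \<equiv> (LBINT \<mu>. prior_weight s M \<mu> * k \<mu>)"
    and "A \<equiv> \<lambda>i \<mu>. zero_off M T \<mu> $ i - statistic_mean s M T i"
  shows "has_mixed_deriv i j (\<lambda>\<theta>. ln (LBINT \<mu>. prior_weight s M \<mu> * k \<mu> * exp (\<theta> \<bullet> zero_off M T \<mu>)))
    ((LBINT \<mu>. prior_weight s M \<mu> * k \<mu> * (A i \<mu> * A j \<mu>)) / W
      - (LBINT \<mu>. prior_weight s M \<mu> * k \<mu> * A i \<mu>) * (LBINT \<mu>. prior_weight s M \<mu> * k \<mu> * A j \<mu>) / W\<^sup>2)"
    and "\<forall>\<^sub>F \<theta> in nhds 0. 0 < (LBINT \<mu>. prior_weight s M \<mu> * k \<mu> * exp (\<theta> \<bullet> zero_off M T \<mu>))"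
proof -
  obtain c where c: "0 < c" "integrable lborel (\<lambda>\<mu>. prior_weight s M \<mu> * exp (c * norm (zero_off M T \<mu>)))"
    using statistic_exp_moment by blast
  have [measurable]: "zero_off M T \<in> borel_measurable borel" "prior_weight s M \<in> borel_measurable borel"
    using zero_off_measurable s M by auto
  have w0: "0 \<le> prior_weight s M \<mu> * k \<mu>" for \<mu> using prior_weight_nonneg[OF s M] kb by simp
  have int: "integrable lborel (\<lambda>\<mu>. prior_weight s M \<mu> * k \<mu> * exp (c * norm (zero_off M T \<mu>)))"
  proof -
    have "integrable lborel (\<lambda>\<mu>. prior_weight s M \<mu> * exp (c * norm (zero_off M T \<mu>)) * k \<mu>)"
      by (rule integrable_mult_bounded[where g="\<lambda>_. 1" and C=K]) (use c kb in auto)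
    then show ?thesis by (simp add: ac_simps)
  qed
  show "has_mixed_deriv i j (\<lambda>\<theta>. ln (LBINT \<mu>. prior_weight s M \<mu> * k \<mu> * exp (\<theta> \<bullet> zero_off M T \<mu>)))
    ((LBINT \<mu>. prior_weight s M \<mu> * k \<mu> * (A i \<mu> * A j \<mu>)) / W
      - (LBINT \<mu>. prior_weight s M \<mu> * k \<mu> * A i \<mu>) * (LBINT \<mu>. prior_weight s M \<mu> * k \<mu> * A j \<mu>) / W\<^sup>2)"
    unfolding A_def W_def by (rule has_mixed_deriv_log_partition[OF _ _ w0 c(1) int pos]) auto
  have "\<forall>\<^sub>F \<theta> in nhds 0. norm \<theta> \<le> c"
    unfolding eventually_nhds_metric using c by (intro exI[of _ c]) auto
  then show "\<forall>\<^sub>F \<theta> in nhds 0. 0 < (LBINT \<mu>. prior_weight s M \<mu> * k \<mu> * exp (\<theta> \<bullet> zero_off M T \<mu>))"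
    by eventually_elim (rule exp_moment_pos(2)[OF _ _ w0 int pos], auto)
qed

lemma has_mixed_deriv_prior_log_partition:
  "has_mixed_deriv i j (log_partition M (wrapped_gaussian s M) T)
    (l2_inner lborel (score s M T i) (score s M T j))"
proof -
  note Q = statistic_moments integrable_prior_weight[OF s M]
  have z: "(LBINT \<mu>. prior_weight s M \<mu> * (zero_off M T \<mu> $ i - statistic_mean s M T i)) = 0"
    using Q by (simp add: right_diff_distrib statistic_mean_eq integral_prior_weight[OF s M])
  show ?thesis
    using has_mixed_deriv_weighted(1)[of "\<lambda>_. 1" 1 i j]
    by (simp add: integral_prior_weight[OF s M] z log_partition_eq[abs_def] l2_inner_def score_mult)
qed

theorem fisher_info_mu_eq:
  "fisher_info_mu M (wrapped_gaussian s M) T 0 $ i $ j = l2_inner lborel (score s M T i) (score s M T j)"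
proof -
  let ?C = "l2_inner lborel (score s M T i) (score s M T j)"
  have hess: "hessian (\<lambda>\<theta>. ln (exp_family M (wrapped_gaussian s M) T \<theta> \<mu>)) 0 $ i $ j = - ?C" for \<mu>
  proof -
    have "ln (exp_family M (wrapped_gaussian s M) T \<theta> \<mu>)
        = ln (wrapped_normal s M \<mu>) + \<theta> \<bullet> T \<mu> - log_partition M (wrapped_gaussian s M) T \<theta>" for \<theta>
      using wrapped_normal_pos[OF s M, of \<mu>]
      by (simp add: exp_family_def wrapped_gaussian_eq[OF s] ln_mult)
    then show ?thesis
      using has_mixed_deriv_hessian[OF has_mixed_deriv_diff[OF has_mixed_deriv_linear has_mixed_deriv_prior_log_partition]]
      by simp
  qed
  have "fisher_info_mu M (wrapped_gaussian s M) T 0 $ i $ j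
      = - (LBINT \<mu>. - ?C * prior_weight s M \<mu>)"
  proof -
    have e0: "exp_family M (wrapped_gaussian s M) T 0 \<mu> = wrapped_normal s M \<mu>" for \<mu>
      unfolding exp_family_def log_partition_0 by (simp add: wrapped_gaussian_eq[OF s])
    show ?thesis
      unfolding fisher_info_mu_def fisher_info_def vec_lambda_beta hess set_lebesgue_integral_def e0
      by (intro arg_cong[where f=uminus] Bochner_Integration.integral_cong refl)
        (simp add: prior_weight_def)
  qed
  then show ?thesis by (simp add: integral_prior_weight[OF s M])
qed

lemma kernel_op_score:
  "kernel_op (wrapped_kernel s M) (score s M T i) x
    = indicator (Omega M) x / sqrt (wrapped_marginal s M x) *
      (LBINT \<mu>. prior_weight s M \<mu> * wrapped_normal 1 M (x - \<mu>) * (zero_off M T \<mu> $ i - statistic_mean s M T i))"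
proof -
  have nn: "0 \<le> wrapped_normal s M \<mu>" for \<mu> using wrapped_normal_pos[OF s M, of \<mu>] by simp
  have "wrapped_kernel s M x \<mu> * score s M T i \<mu> = indicator (Omega M) x / sqrt (wrapped_marginal s M x) *
      (prior_weight s M \<mu> * wrapped_normal 1 M (x - \<mu>) * (zero_off M T \<mu> $ i - statistic_mean s M T i))" for \<mu>
    using nn by (simp add: wrapped_kernel_def score_def zero_off_def prior_weight_def indicator_def
        sqrt_factor_merge(3)[OF nn])
  then show ?thesis unfolding kernel_op_def l2_inner_def by simp
qed

text \<open>
  The Hessian of \<open>ln f\<^sub>\<eta>(x)\<close> is the posterior covariance of \<open>T\<close> given \<open>X = x\<close> minus the prior covariance.
  Averaged over \<open>X\<close>, the second moment in the posterior covariance cancels the prior covariance, and what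
  remains is the covariance of the posterior means. The operator sends a score to the centred posterior mean
  times \<open>sqrt f\<^sub>0\<close>.
\<close>

theorem fisher_info_X_eq:
  "fisher_info_X M (wrapped_gaussian s M) T 0 $ i $ j
    = l2_inner lborel (kernel_op (wrapped_kernel s M) (score s M T i))
        (kernel_op (wrapped_kernel s M) (score s M T j))"
proof -
  let ?C = "l2_inner lborel (score s M T i) (score s M T j)"
  let ?w = "prior_weight s M" and ?K = "\<lambda>x \<mu>. wrapped_normal 1 M (x - \<mu>)" and ?f = "wrapped_marginal s M"
  let ?A = "\<lambda>i \<mu>. zero_off M T \<mu> $ i - statistic_mean s M T i"
  let ?k = "\<lambda>i. kernel_op (wrapped_kernel s M) (score s M T i)"
  define P where "P x = (LBINT \<mu>. ?w \<mu> * ?K x \<mu> * (?A i \<mu> * ?A j \<mu>))" for x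
  define n where "n i x = (LBINT \<mu>. ?w \<mu> * ?K x \<mu> * ?A i \<mu>)" for i x
  have fpos: "0 < ?f x" for x by (rule wrapped_marginal_pos[OF s M])
  have [measurable]: "wrapped_normal 1 M \<in> borel_measurable borel" using M by simp
  have K: "(\<lambda>\<mu>. ?K x \<mu>) \<in> borel_measurable borel" "0 \<le> ?K x \<mu>" "?K x \<mu> \<le> wrapped_peak 1 M" for x \<mu>
    using M wrapped_normal_pos[of 1 M "x - \<mu>"] by (auto intro: wrapped_normal_le_peak)
  have fpos': "0 < (LBINT \<mu>. ?w \<mu> * ?K x \<mu>)" for x
    using fpos by (simp add: integral_posterior_weight[OF s M])
  have marg: "marginal_family M (wrapped_gaussian s M) T \<theta> x
      = (LBINT \<mu>. ?w \<mu> * ?K x \<mu> * exp (\<theta> \<bullet> zero_off M T \<mu>)) * exp (- log_partition M (wrapped_gaussian s M) T \<theta>)" for \<theta> x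
  proof -
    have "marginal_family M (wrapped_gaussian s M) T \<theta> x
        = (LBINT \<mu>. ?w \<mu> * ?K x \<mu> * exp (\<theta> \<bullet> zero_off M T \<mu>) * exp (- log_partition M (wrapped_gaussian s M) T \<theta>))"
      unfolding marginal_family_def marginal_density_def set_lebesgue_integral_def
      by (intro Bochner_Integration.integral_cong refl)
        (simp add: exp_family_def cyclic_kernel_eq wrapped_gaussian_eq[OF s] prior_weight_def zero_off_def
          indicator_def exp_diff exp_minus divide_inverse)
    then show ?thesis by simp
  qed
  have hess: "hessian (\<lambda>\<theta>. ln (marginal_family M (wrapped_gaussian s M) T \<theta> x)) 0 $ i $ j
      = P x / ?f x - n i x * n j x / (?f x)\<^sup>2 - ?C" for x
  proof (rule has_mixed_deriv_hessian, rule has_mixed_deriv_cong)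
    show "has_mixed_deriv i j (\<lambda>\<theta>. ln (LBINT \<mu>. ?w \<mu> * ?K x \<mu> * exp (\<theta> \<bullet> zero_off M T \<mu>))
        - log_partition M (wrapped_gaussian s M) T \<theta>) (P x / ?f x - n i x * n j x / (?f x)\<^sup>2 - ?C)"
      unfolding P_def n_def integral_posterior_weight[OF s M, of x, symmetric]
      by (rule has_mixed_deriv_diff[OF has_mixed_deriv_weighted(1)[OF K fpos'] has_mixed_deriv_prior_log_partition])
    show "\<forall>\<^sub>F \<theta> in nhds 0. ln (LBINT \<mu>. ?w \<mu> * ?K x \<mu> * exp (\<theta> \<bullet> zero_off M T \<mu>))
        - log_partition M (wrapped_gaussian s M) T \<theta> = ln (marginal_family M (wrapped_gaussian s M) T \<theta> x)"
      using has_mixed_deriv_weighted(2)[OF K fpos'[of x]]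
      by eventually_elim (simp add: marg ln_mult)
  qed
  have marg0: "marginal_family M (wrapped_gaussian s M) T 0 x = ?f x" for x
    unfolding marg by (simp add: log_partition_0 integral_posterior_weight[OF s M])
  have kk: "?k i x * ?k j x = indicator (Omega M) x * (n i x * n j x / ?f x)" for x
    unfolding kernel_op_score n_def[symmetric] using fpos[of x] by (auto simp: indicator_def)
  have intK: "integrable lborel (\<lambda>x. ?k i x * ?k j x)"
    by (intro L2_mult_integrable kernel_op_L2_norm wrapped_kernel_hs s M score_L2)
  have Pe: "P x = (LBINT \<mu>. (score s M T i \<mu> * score s M T j \<mu>) * ?K x \<mu>)" for x
    unfolding P_def score_mult by (simp add: ac_simps)
  note avP = integral_posterior_average[OF s M integrable_score_mult[of i j], folded Pe]
  note avf = integral_posterior_average[OF s M integrable_prior_weight[OF s M], unfolded integral_posterior_weight[OF s M] integral_prior_weight[OF s M]]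
  have "fisher_info_X M (wrapped_gaussian s M) T 0 $ i $ j
      = - (LBINT x. indicator (Omega M) x * P x - ?k i x * ?k j x - ?C * (indicator (Omega M) x * ?f x))"
  proof -
    have pt: "indicator (Omega M) x *\<^sub>R ((P x / ?f x - n i x * n j x / (?f x)\<^sup>2 - ?C) * ?f x)
        = indicator (Omega M) x * P x - ?k i x * ?k j x - ?C * (indicator (Omega M) x * ?f x)" for x
      unfolding kk using fpos[of x] by (simp add: left_diff_distrib right_diff_distrib power2_eq_square)
    show ?thesis
      unfolding fisher_info_X_def fisher_info_def set_lebesgue_integral_def vec_lambda_beta hess marg0 pt ..
  qed
  also have "\<dots> = - (?C - (LBINT x. ?k i x * ?k j x) - ?C * 1)"
    using avP avf intK by (simp add: l2_inner_def)
  finally show ?thesis by (simp add: l2_inner_def)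
qed

end

section \<open>The efficiency bound and its attainment\<close>

lemma quadratic_form_sum:
  fixes A :: "real ^ 'p ^ 'p::finite"
  shows "a \<bullet> (A *v a) = (\<Sum>i\<in>UNIV. \<Sum>j\<in>UNIV. a $ i * a $ j * A $ i $ j)"
  by (simp add: inner_vec_def matrix_vector_mult_def sum_distrib_left ac_simps)

lemma quadratic_form_perturb:
  fixes A B :: "real ^ 'p ^ 'p::finite"
  shows "\<bar>a \<bullet> (A *v a) - a \<bullet> (B *v a)\<bar> \<le> (\<Sum>i\<in>UNIV. \<Sum>j\<in>UNIV. \<bar>A $ i $ j - B $ i $ j\<bar>) * (a \<bullet> a)"
proof -
  have "a \<bullet> (A *v a) - a \<bullet> (B *v a) = (\<Sum>i\<in>UNIV. \<Sum>j\<in>UNIV. a $ i * a $ j * (A $ i $ j - B $ i $ j))"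
    by (simp add: quadratic_form_sum sum_subtractf right_diff_distrib)
  also have "\<bar>\<dots>\<bar> \<le> (\<Sum>i\<in>UNIV. \<Sum>j\<in>UNIV. \<bar>a $ i * a $ j * (A $ i $ j - B $ i $ j)\<bar>)"
    by (intro order_trans[OF sum_abs] sum_mono sum_abs)
  also have "\<dots> \<le> (\<Sum>i\<in>UNIV. \<Sum>j\<in>UNIV. \<bar>A $ i $ j - B $ i $ j\<bar> * (a \<bullet> a))"
  proof (intro sum_mono)
    fix i j :: 'p
    have "\<bar>a $ i\<bar> * \<bar>a $ j\<bar> \<le> norm a * norm a"
      by (intro mult_mono component_le_norm_cart) auto
    then have "\<bar>a $ i\<bar> * \<bar>a $ j\<bar> \<le> a \<bullet> a" by (simp add: dot_square_norm power2_eq_square)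
    then show "\<bar>a $ i * a $ j * (A $ i $ j - B $ i $ j)\<bar> \<le> \<bar>A $ i $ j - B $ i $ j\<bar> * (a \<bullet> a)"
      unfolding abs_mult by (subst mult.commute) (intro mult_left_mono, auto)
  qed
  finally show ?thesis by (simp add: sum_distrib_right)
qed

definition score_comb :: "real \<Rightarrow> real \<Rightarrow> (real \<Rightarrow> real ^ 'p::finite) \<Rightarrow> real ^ 'p \<Rightarrow> real \<Rightarrow> real" where
  "score_comb s M T a \<mu> = (\<Sum>i\<in>UNIV. a $ i * score s M T i \<mu>)"

text \<open>
  The squared operator norm of the wrapped channel on the relevant functions, estimated by the Gaussian
  contraction factor and two distances that vanish as \<open>M\<close> grows.
\<close>

definition efficiency_bound :: "real \<Rightarrow> nat \<Rightarrow> real \<Rightarrow> real" where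
  "efficiency_bound s p M =
     (sqrt (1 / (1 + 1 / s\<^sup>2) ^ p + (l2_norm lborel (\<lambda>x. wrapped_hermite s M 0 x - hermite_fun s 0 x))\<^sup>2)
      + hs_norm (\<lambda>x y. wrapped_kernel s M x y - gauss_kernel s x y))\<^sup>2"

lemma contraction_power:
  assumes "0 < s"
  shows "(s / sqrt (1 + s\<^sup>2)) ^ (2 * p) = 1 / (1 + 1 / s\<^sup>2) ^ p"
proof -
  have "(s / sqrt (1 + s\<^sup>2))\<^sup>2 = 1 / (1 + 1 / s\<^sup>2)"
    using assms by (simp add: power_divide field_simps add_pos_nonneg)
  then show ?thesis by (simp only: power_mult power_one_over)
qed

lemma tendsto_efficiency_bound:
  assumes s: "0 < s"
  shows "(efficiency_bound s p \<longlongrightarrow> 1 / (1 + 1 / s\<^sup>2) ^ p) at_top"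
proof -
  let ?g = "1 / (1 + 1 / s\<^sup>2) ^ p"
  have "0 \<le> ?g" by simp
  have "(efficiency_bound s p \<longlongrightarrow> (sqrt (?g + 0\<^sup>2) + 0)\<^sup>2) at_top"
    unfolding efficiency_bound_def[abs_def]
    by (intro tendsto_intros tendsto_wrapped_hermite tendsto_wrapped_kernel s)
  then show ?thesis using \<open>0 \<le> ?g\<close> by simp
qed

context
  fixes s M :: real and T :: "real \<Rightarrow> real ^ 'p::finite"
  assumes s: "0 < s" and M: "0 < M"
    and T: "T \<in> borel_measurable (restrict_space borel (Omega M))"
    and ev: "\<forall>\<^sub>F \<eta> in nhds 0. set_integrable lborel (Omega M) (\<lambda>\<mu>. wrapped_gaussian s M \<mu> * exp (\<eta> \<bullet> T \<mu>))"
begin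

lemma score_comb_L2: "score_comb s M T a \<in> L2 lborel"
  unfolding score_comb_def[abs_def] by (intro L2_sum L2_scale score_L2[OF s M T ev])

lemma quadratic_form_mu:
  "a \<bullet> (fisher_info_mu M (wrapped_gaussian s M) T 0 *v a) = (l2_norm lborel (score_comb s M T a))\<^sup>2"
  unfolding quadratic_form_sum fisher_info_mu_eq[OF s M T ev] score_comb_def[abs_def]
  by (rule l2_norm_sq_sum[symmetric]) (rule score_L2[OF s M T ev])

lemma quadratic_form_X:
  "a \<bullet> (fisher_info_X M (wrapped_gaussian s M) T 0 *v a)
    = (l2_norm lborel (kernel_op (wrapped_kernel s M) (score_comb s M T a)))\<^sup>2"
proof -
  have "kernel_op (wrapped_kernel s M) (score_comb s M T a)
      = (\<lambda>x. \<Sum>i\<in>UNIV. a $ i * kernel_op (wrapped_kernel s M) (score s M T i) x)"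
    unfolding score_comb_def[abs_def] by (intro kernel_op_sum wrapped_kernel_hs s M score_L2 T ev)
  moreover have "(l2_norm lborel (\<lambda>x. \<Sum>i\<in>UNIV. a $ i * kernel_op (wrapped_kernel s M) (score s M T i) x))\<^sup>2
     = a \<bullet> (fisher_info_X M (wrapped_gaussian s M) T 0 *v a)"
    unfolding quadratic_form_sum fisher_info_X_eq[OF s M T ev]
    by (intro l2_norm_sq_sum kernel_op_L2_norm wrapped_kernel_hs s M score_L2 T ev)
  ultimately show ?thesis by simp
qed

lemma rel_efficiency_le:
  assumes "a \<noteq> 0"
  shows "rel_efficiency M (wrapped_gaussian s M) T 0
    \<le> (l2_norm lborel (kernel_op (wrapped_kernel s M) (score_comb s M T a)))\<^sup>2 / (l2_norm lborel (score_comb s M T a))\<^sup>2"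
  unfolding rel_efficiency_def quadratic_form_mu quadratic_form_X
  by (rule cINF_lower) (use assms in \<open>auto intro!: bdd_belowI2[where m=0]\<close>)

text \<open>
  The upper half of the min-max principle, with a test direction \<open>a\<close> chosen by counting dimensions. Orthogonality
  to the Hermite function of index \<open>0\<close> is not imposed on \<open>a\<close>: centring gives exact orthogonality to
  \<open>wrapped_hermite s M 0\<close>, which is \<open>sqrt g\<^sub>0\<close>, and the distance between the two functions enters the bound.
\<close>

theorem rel_efficiency_le_bound:
  "rel_efficiency M (wrapped_gaussian s M) T 0 \<le> efficiency_bound s CARD('p) M"
proof -
  let ?p = "CARD('p)" and ?r = "s / sqrt (1 + s\<^sup>2)"
  let ?e = "hermite_fun s"
  \<comment> \<open>errors from replacing the carrier and the kernel by their limits\<close>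
  define eps where "eps = l2_norm lborel (\<lambda>x. wrapped_hermite s M 0 x - ?e 0 x)"
  define del where "del = hs_norm (\<lambda>x y. wrapped_kernel s M x y - gauss_kernel s x y)"
  define v where "v j = (\<chi> i. l2_inner lborel (score s M T i) (?e j))" for j
  define S where "S = v ` {1..<?p}"
  \<comment> \<open>fewer conditions than coefficients leave a nonzero solution\<close>
  have "dim S \<le> card S" unfolding S_def by (intro dim_le_card') auto
  also have "card S \<le> card {1..<?p}" unfolding S_def by (rule card_image_le) simp
  also have "\<dots> < ?p" by simp
  finally have "dim S < DIM(real ^ 'p)" by simp
  from orthogonal_to_subspace_exists[OF this] obtain a where a: "a \<noteq> 0"
    and orth: "\<And>y. y \<in> span S \<Longrightarrow> orthogonal a y" by blast
  define u where "u = score_comb s M T a"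
  have u: "u \<in> L2 lborel" unfolding u_def by (rule score_comb_L2)
  have inner_u: "l2_inner lborel u g = (\<Sum>i\<in>UNIV. a $ i * l2_inner lborel (score s M T i) g)" if "g \<in> L2 lborel" for g
    unfolding u_def score_comb_def[abs_def] by (intro l2_inner_sum_left score_L2[OF s M T ev] that)
  have e: "?e j \<in> L2 lborel" for j by (rule hermite_fun_L2[OF s])
  have h: "wrapped_hermite s M 0 \<in> L2 lborel" by (rule wrapped_hermite_L2[OF s M])
  have zero: "l2_inner lborel u (?e j) = 0" if "1 \<le> j" "j < ?p" for j
  proof -
    have "v j \<in> span S" unfolding S_def using that by (intro span_base) auto
    from orth[OF this] show ?thesis
      by (simp add: inner_u[OF e] orthogonal_def inner_vec_def v_def)
  qed
  have "l2_inner lborel u (wrapped_hermite s M 0) = 0"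
    by (simp add: inner_u[OF h] score_mean_zero[OF s M T ev])
  then have "\<bar>l2_inner lborel u (?e 0)\<bar> = \<bar>l2_inner lborel (\<lambda>x. wrapped_hermite s M 0 x - ?e 0 x) u\<bar>"
    using l2_inner_diff_left[OF h e u, of 0] by (simp add: l2_inner_commute[of _ u])
  also have "\<dots> \<le> eps * l2_norm lborel u"
    unfolding eps_def by (intro l2_cauchy_schwarz L2_diff h e u)
  finally have "\<bar>l2_inner lborel u (?e 0)\<bar>\<^sup>2 \<le> (eps * l2_norm lborel u)\<^sup>2"
    by (intro power_mono) auto
  moreover have "(\<Sum>j<?p. (l2_inner lborel u (?e j))\<^sup>2) = (l2_inner lborel u (?e 0))\<^sup>2"
  proof -
    have "(\<Sum>j<?p. (l2_inner lborel u (?e j))\<^sup>2) = (\<Sum>j\<in>{0}. (l2_inner lborel u (?e j))\<^sup>2)"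
      using zero by (intro sum.mono_neutral_right) auto
    then show ?thesis by simp
  qed
  ultimately have "(l2_norm lborel (kernel_op (gauss_kernel s) u))\<^sup>2
      \<le> ?r ^ (2 * ?p) * (l2_norm lborel u)\<^sup>2 + (eps * l2_norm lborel u)\<^sup>2"
    using gauss_channel_contraction[OF s refl refl u, of ?p] by simp
  also have "\<dots> = (1 / (1 + 1 / s\<^sup>2) ^ ?p + eps\<^sup>2) * (l2_norm lborel u)\<^sup>2"
    unfolding contraction_power[OF s] by (simp only: power_mult_distrib distrib_right)
  finally have "l2_norm lborel (kernel_op (gauss_kernel s) u)
      \<le> sqrt ((1 / (1 + 1 / s\<^sup>2) ^ ?p + eps\<^sup>2) * (l2_norm lborel u)\<^sup>2)"
    by (rule real_le_rsqrt)
  also have "\<dots> = sqrt (1 / (1 + 1 / s\<^sup>2) ^ ?p + eps\<^sup>2) * l2_norm lborel u"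
    by (simp add: real_sqrt_mult)
  finally have "l2_norm lborel (kernel_op (wrapped_kernel s M) u)
      \<le> (sqrt (1 / (1 + 1 / s\<^sup>2) ^ ?p + eps\<^sup>2) + del) * l2_norm lborel u"
    using kernel_op_perturb[OF wrapped_kernel_hs[OF s M] gauss_kernel_hs[OF s refl refl] u]
    by (simp add: del_def distrib_right)
  then have "(l2_norm lborel (kernel_op (wrapped_kernel s M) u))\<^sup>2
      \<le> ((sqrt (1 / (1 + 1 / s\<^sup>2) ^ ?p + eps\<^sup>2) + del) * l2_norm lborel u)\<^sup>2"
    by (intro power_mono) auto
  also have "\<dots> = efficiency_bound s ?p M * (l2_norm lborel u)\<^sup>2"
    by (simp only: power_mult_distrib efficiency_bound_def eps_def del_def)
  finally have "(l2_norm lborel (kernel_op (wrapped_kernel s M) u))\<^sup>2 / (l2_norm lborel u)\<^sup>2 \<le> efficiency_bound s ?p M"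
    by (cases "l2_norm lborel u = 0") (auto simp: divide_le_eq efficiency_bound_def)
  then show ?thesis using rel_efficiency_le[OF a] by (simp add: u_def)
qed

end

section \<open>The Hermite statistics\<close>

lemma continuous_hermite: "continuous_on A (hermite j)"
  unfolding hermite_eq_poly[abs_def] by (intro continuous_intros) auto

lemma continuous_hermite_statistic: "s \<noteq> 0 \<Longrightarrow> continuous_on A (hermite_statistic s idx)"
  unfolding hermite_statistic_def[abs_def]
  by (intro continuous_on_vec_lambda continuous_on_compose2[OF continuous_hermite[of UNIV]] continuous_intros) auto

lemma hermite_statistic_measurable:
  "s \<noteq> 0 \<Longrightarrow> hermite_statistic s idx \<in> borel_measurable (restrict_space borel (Omega M))"
  by (intro measurable_restrict_space1 borel_measurable_continuous_onI continuous_hermite_statistic)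

lemma hermite_statistic_integrable:
  assumes s: "0 < s" and M: "0 < M"
  shows "set_integrable lborel (Omega M) (\<lambda>\<mu>. wrapped_gaussian s M \<mu> * exp (\<eta> \<bullet> hermite_statistic s idx \<mu>))"
proof -
  let ?f = "\<lambda>\<mu>. exp (\<eta> \<bullet> hermite_statistic s idx \<mu>)"
  have c: "continuous_on A ?f" for A
    using s by (intro continuous_intros continuous_hermite_statistic) auto
  have "compact (?f ` Omega M)"
    by (intro compact_continuous_image c) (simp add: Omega_def)
  then have "bounded (?f ` Omega M)" by (rule compact_imp_bounded)
  then obtain B where B: "\<And>\<mu>. \<mu> \<in> Omega M \<Longrightarrow> norm (?f \<mu>) \<le> B"
    by (auto simp: bounded_iff)
  have [measurable]: "?f \<in> borel_measurable borel" by (intro borel_measurable_continuous_onI c)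
  have [measurable]: "wrapped_normal s M \<in> borel_measurable borel" using s M by simp
  show ?thesis
    unfolding set_integrable_def wrapped_gaussian_eq[OF s]
  proof -
    have "integrable lborel (\<lambda>\<mu>. prior_weight s M \<mu> * (indicator (Omega M) \<mu> * ?f \<mu>))"
      by (rule integrable_mult_bounded[where g="\<lambda>_. 1" and C="\<bar>B\<bar>"])
        (use B integrable_prior_weight[OF s M] prior_weight_measurable[OF s M]
          in \<open>auto simp: indicator_def intro: order_trans[OF _ abs_ge_self]\<close>)
    moreover have "(\<lambda>\<mu>. prior_weight s M \<mu> * (indicator (Omega M) \<mu> * ?f \<mu>))
        = (\<lambda>\<mu>. indicator (Omega M) \<mu> *\<^sub>R (wrapped_normal s M \<mu> * ?f \<mu>))"
      by (auto simp: prior_weight_def indicator_def)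
    ultimately show "integrable lborel (\<lambda>\<mu>. indicator (Omega M) \<mu> *\<^sub>R (wrapped_normal s M \<mu> * ?f \<mu>))"
      by simp
  qed
qed

text \<open>
  Read as an identity between Hermite functions, the hypothesis allows each coefficient to be extracted by
  orthonormality; the constant is a multiple of the Hermite polynomial of index \<open>0\<close>.
\<close>

lemma hermite_independent:
  fixes a :: "real ^ 'p::finite"
  assumes idx: "bij_betw idx UNIV {1..CARD('p)}"
    and zero: "\<And>x. (\<Sum>i\<in>UNIV. a $ i * hermite (idx i) x) = c"
  shows "a = 0"
proof (rule vec_eq_iff[THEN iffD2], intro allI)
  fix k
  let ?h = "hermite_fun 1"
  have L: "?h j \<in> L2 lborel" for j by (rule hermite_fun_L2) simp
  have inj: "idx i = idx k \<longleftrightarrow> i = k" for i using idx by (auto simp: bij_betw_def inj_on_def)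
  have "idx k \<in> {1..CARD('p)}" using idx by (auto simp: bij_betw_def)
  then have k: "idx k \<noteq> 0" by simp
  have "(\<lambda>x. \<Sum>i\<in>UNIV. a $ i * ?h (idx i) x) = (\<lambda>x. c * ?h 0 x)"
  proof
    fix x
    have "(\<Sum>i\<in>UNIV. a $ i * ?h (idx i) x) = sqrt (std_normal_density x) * (\<Sum>i\<in>UNIV. a $ i * hermite (idx i) x)"
      by (simp add: hermite_fun_def sum_distrib_left ac_simps)
    then show "(\<Sum>i\<in>UNIV. a $ i * ?h (idx i) x) = c * ?h 0 x"
      unfolding zero by (simp add: hermite_fun_def hermite_eq_poly)
  qed
  then have "l2_inner lborel (\<lambda>x. \<Sum>i\<in>UNIV. a $ i * ?h (idx i) x) (?h (idx k)) = l2_inner lborel (\<lambda>x. c * ?h 0 x) (?h (idx k))"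
    by simp
  then have "(\<Sum>i\<in>UNIV. a $ i * (if i = k then 1 else 0)) = 0"
    using k by (simp add: l2_inner_sum_left L l2_inner_scale_left hermite_fun_orthonormal inj)
  then show "a $ k = (0 :: real ^ 'p) $ k" by (simp add: if_distrib cong: if_cong)
qed

text \<open>
  If the Fisher information annihilates \<open>a\<close>, then \<open>a \<bullet> T\<close> is constant almost everywhere on an interval.
  As a polynomial with infinitely many zeros, its deviation from that constant vanishes identically.
\<close>

theorem hermite_statistic_admissible:
  fixes idx :: "'p::finite \<Rightarrow> nat"
  assumes s: "0 < s" and M: "0 < M" and idx: "bij_betw idx UNIV {1..CARD('p)}"
  shows "admissible_statistic M (wrapped_gaussian s M) (hermite_statistic s idx)"
proof -
  let ?T = "hermite_statistic s idx"
  have T: "?T \<in> borel_measurable (restrict_space borel (Omega M))"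
    using s by (intro hermite_statistic_measurable) auto
  have ev: "\<forall>\<^sub>F \<eta> in nhds 0. set_integrable lborel (Omega M) (\<lambda>\<mu>. wrapped_gaussian s M \<mu> * exp (\<eta> \<bullet> ?T \<mu>))"
    by (intro always_eventually allI hermite_statistic_integrable s M)
  let ?A = "fisher_info_mu M (wrapped_gaussian s M) ?T 0"
  have "a = 0" if "?A *v a = 0" for a
  proof -
    let ?m = "statistic_mean s M ?T"
    define q where "q = (\<Sum>i\<in>UNIV. smult (a $ i / sqrt (fact (idx i))) (hermite_poly (idx i))) - [:\<Sum>i\<in>UNIV. a $ i * ?m i:]"
    have q: "poly q x = (\<Sum>i\<in>UNIV. a $ i * hermite (idx i) x) - (\<Sum>i\<in>UNIV. a $ i * ?m i)" for x
      by (simp add: q_def poly_sum hermite_eq_poly)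
    have comb: "score_comb s M ?T a x = indicator (Omega M) x * sqrt (wrapped_normal s M x) * poly q (x / s)" for x
      unfolding q sum_subtractf[symmetric]
      by (simp add: score_comb_def score_def hermite_statistic_def sum_distrib_left right_diff_distrib ac_simps)
    have "(l2_norm lborel (score_comb s M ?T a))\<^sup>2 = 0"
      using quadratic_form_mu[OF s M T ev, of a] that by simp
    then have "(LBINT x. (score_comb s M ?T a x)\<^sup>2) = 0" by (simp add: l2_norm_sq)
    then have "AE x in lborel. (score_comb s M ?T a x)\<^sup>2 = 0"
      using L2_integrable[OF score_comb_L2[OF s M T ev, of a]]
      by (subst (asm) integral_nonneg_eq_0_iff_AE) auto
    then have ae: "AE x in lborel. x \<in> Omega M \<longrightarrow> poly q (x / s) = 0"
      by eventually_elim (use wrapped_normal_pos[OF s M] in \<open>auto simp: comb less_imp_neq[THEN not_sym]\<close>)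
    have "q = 0"
    proof (rule ccontr)
      assume "q \<noteq> 0"
      then have "finite {x. poly q x = 0}" by (rule poly_roots_finite)
      then have "finite ((\<lambda>x. s * x) ` {x. poly q x = 0})" by (rule finite_imageI)
      moreover have "{x. poly q (x / s) = 0} \<subseteq> (\<lambda>x. s * x) ` {x. poly q x = 0}"
        using s by (auto intro!: image_eqI[of _ _ "_ / s"])
      ultimately have fin: "finite {x. poly q (x / s) = 0}" by (rule finite_subset[rotated])
      then have "{x. poly q (x / s) = 0} \<in> null_sets lborel"
        by (intro finite_imp_null_set_lborel)
      then have "AE x in lborel. x \<notin> {x. poly q (x / s) = 0}" by (rule AE_not_in)
      with ae have "AE x in lborel. x \<notin> Omega M" by eventually_elim auto
      then have "Omega M \<in> null_sets lborel" by (subst AE_iff_null_sets) auto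
      then have "emeasure lborel (Omega M) = 0" by (rule null_setsD1)
      then show False using M by (simp add: Omega_def)
    qed
    then have "(\<Sum>i\<in>UNIV. a $ i * hermite (idx i) x) = (\<Sum>i\<in>UNIV. a $ i * ?m i)" for x
      using q[of x] by simp
    then show "a = 0" by (rule hermite_independent[OF idx])
  qed
  then have "invertible ?A"
    unfolding invertible_left_inverse matrix_left_invertible_ker by blast
  then show ?thesis using T ev by (simp add: admissible_statistic_def)
qed

lemma wrapped_hermite_0_norm:
  assumes s: "0 < s" and M: "0 < M"
  shows "l2_norm lborel (wrapped_hermite s M 0) = 1"
proof -
  have "(wrapped_hermite s M 0 x)\<^sup>2 = prior_weight s M x" for x
    using wrapped_normal_pos[OF s M, of x]
    by (simp add: wrapped_hermite_def prior_weight_def hermite_eq_poly indicator_def)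
  then show ?thesis by (simp add: l2_norm_def integral_prior_weight[OF s M])
qed

lemma hermite_statistic_mean:
  assumes s: "0 < s" and M: "0 < M"
  shows "statistic_mean s M (hermite_statistic s idx) i
    = l2_inner lborel (wrapped_hermite s M (idx i)) (wrapped_hermite s M 0)"
proof -
  have nn: "0 \<le> wrapped_normal s M \<mu>" for \<mu> using wrapped_normal_pos[OF s M, of \<mu>] by simp
  have "wrapped_hermite s M (idx i) \<mu> * wrapped_hermite s M 0 \<mu>
      = indicator (Omega M) \<mu> * wrapped_normal s M \<mu> * hermite_statistic s idx \<mu> $ i" for \<mu>
    using nn by (simp add: wrapped_hermite_def hermite_eq_poly[of 0] hermite_statistic_def indicator_def
        sqrt_factor_merge(2)[OF nn])
  then show ?thesis by (simp only: l2_inner_def statistic_mean_def)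
qed

lemma hermite_score:
  "score s M (hermite_statistic s idx) i = (\<lambda>\<mu>. wrapped_hermite s M (idx i) \<mu>
    - statistic_mean s M (hermite_statistic s idx) i * wrapped_hermite s M 0 \<mu>)"
  by (auto simp: score_def wrapped_hermite_def hermite_statistic_def hermite_eq_poly[of 0] algebra_simps)

lemma tendsto_hermite_score:
  fixes idx :: "'p::finite \<Rightarrow> nat"
  assumes s: "0 < s" and i: "idx i \<noteq> 0"
  shows "((\<lambda>M. l2_norm lborel (\<lambda>x. score s M (hermite_statistic s idx) i x - hermite_fun s (idx i) x)) \<longlongrightarrow> 0) at_top"
proof (rule Lim_null_comparison)
  let ?m = "\<lambda>M. statistic_mean s M (hermite_statistic s idx) i"
  let ?d = "\<lambda>M. l2_norm lborel (\<lambda>x. wrapped_hermite s M (idx i) x - hermite_fun s (idx i) x)"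
  have L2ev: "\<forall>\<^sub>F M in at_top. wrapped_hermite s M j \<in> L2 lborel" for j
    using eventually_gt_at_top[of 0] by eventually_elim (rule wrapped_hermite_L2[OF s])
  have "((\<lambda>M. l2_inner lborel (wrapped_hermite s M (idx i)) (wrapped_hermite s M 0))
      \<longlongrightarrow> l2_inner lborel (hermite_fun s (idx i)) (hermite_fun s 0)) at_top"
    by (intro tendsto_l2_inner L2ev hermite_fun_L2 tendsto_wrapped_hermite s)
  then have "((\<lambda>M. l2_inner lborel (wrapped_hermite s M (idx i)) (wrapped_hermite s M 0)) \<longlongrightarrow> 0) at_top"
    using i by (simp add: hermite_fun_orthonormal[OF s])
  moreover have "\<forall>\<^sub>F M in at_top. l2_inner lborel (wrapped_hermite s M (idx i)) (wrapped_hermite s M 0) = ?m M"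
    using eventually_gt_at_top[of 0] by eventually_elim (simp add: hermite_statistic_mean[OF s])
  ultimately have m: "(?m \<longlongrightarrow> 0) at_top" by (rule Lim_transform_eventually)
  show "\<forall>\<^sub>F M in at_top. norm (l2_norm lborel (\<lambda>x. score s M (hermite_statistic s idx) i x - hermite_fun s (idx i) x))
      \<le> ?d M + \<bar>?m M\<bar>"
    using eventually_gt_at_top[of 0]
  proof eventually_elim
    case (elim M)
    have "(\<lambda>x. score s M (hermite_statistic s idx) i x - hermite_fun s (idx i) x)
        = (\<lambda>x. (wrapped_hermite s M (idx i) x - hermite_fun s (idx i) x) + (- ?m M) * wrapped_hermite s M 0 x)"
      by (auto simp: hermite_score)
    moreover have "l2_norm lborel (\<lambda>x. (- ?m M) * wrapped_hermite s M 0 x) = \<bar>?m M\<bar>"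
      unfolding l2_norm_scale wrapped_hermite_0_norm[OF s elim] by simp
    ultimately show ?case
      using l2_norm_triangle[OF L2_diff[OF wrapped_hermite_L2[OF s elim] hermite_fun_L2[OF s]]
          L2_scale[OF wrapped_hermite_L2[OF s elim]], of "idx i" "idx i" "- ?m M" 0]
      by (simp only: real_norm_def abs_of_nonneg[OF l2_norm_nonneg])
  qed
  show "((\<lambda>M. ?d M + \<bar>?m M\<bar>) \<longlongrightarrow> 0) at_top"
    by (rule tendsto_eq_intros tendsto_wrapped_hermite[OF s] m refl | simp)+
qed

context
  fixes s :: real and idx :: "'p::finite \<Rightarrow> nat"
  assumes s: "0 < s" and idx: "bij_betw idx UNIV {1..CARD('p)}"
begin

lemma idx_range: "1 \<le> idx i" "idx i \<le> CARD('p)"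
  using idx by (auto simp: bij_betw_def)

lemma idx_inj: "idx i = idx j \<longleftrightarrow> i = j"
  using idx by (auto simp: bij_betw_def inj_on_def)

lemma hermite_score_L2: "\<forall>\<^sub>F M in at_top. score s M (hermite_statistic s idx) i \<in> L2 lborel"
  using eventually_gt_at_top[of 0]
  by eventually_elim (auto simp: hermite_score intro!: L2_diff L2_scale wrapped_hermite_L2 s)

lemma tendsto_fisher_info_mu_entry:
  "((\<lambda>M. fisher_info_mu M (wrapped_gaussian s M) (hermite_statistic s idx) 0 $ i $ j)
    \<longlongrightarrow> (if i = j then 1 else 0)) at_top"
proof -
  let ?S = "\<lambda>M. score s M (hermite_statistic s idx)"
  have "((\<lambda>M. l2_inner lborel (?S M i) (?S M j)) \<longlongrightarrow> l2_inner lborel (hermite_fun s (idx i)) (hermite_fun s (idx j))) at_top"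
    using idx_range[of i] idx_range[of j]
    by (intro tendsto_l2_inner hermite_score_L2 hermite_fun_L2 tendsto_hermite_score s) auto
  moreover have "\<forall>\<^sub>F M in at_top. l2_inner lborel (?S M i) (?S M j)
      = fisher_info_mu M (wrapped_gaussian s M) (hermite_statistic s idx) 0 $ i $ j"
    using eventually_gt_at_top[of 0]
  proof eventually_elim
    case (elim M)
    show ?case using hermite_statistic_admissible[OF s elim idx]
      by (intro fisher_info_mu_eq[symmetric] s elim) (auto simp: admissible_statistic_def)
  qed
  ultimately show ?thesis
    by (simp add: hermite_fun_orthonormal[OF s] idx_inj Lim_transform_eventually)
qed

lemma tendsto_fisher_info_X_entry:
  "((\<lambda>M. fisher_info_X M (wrapped_gaussian s M) (hermite_statistic s idx) 0 $ i $ j)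
    \<longlongrightarrow> (if i = j then 1 / (1 + 1 / s\<^sup>2) ^ idx i else 0)) at_top"
proof -
  let ?S = "\<lambda>M i. kernel_op (wrapped_kernel s M) (score s M (hermite_statistic s idx) i)"
  let ?E = "\<lambda>i. kernel_op (gauss_kernel s) (hermite_fun s (idx i))"
  let ?\<tau> = "sqrt (1 + s\<^sup>2)"
  have tau: "0 < ?\<tau>" using s by (simp add: add_pos_nonneg)
  have hs: "\<forall>\<^sub>F M in at_top. hs_kernel (wrapped_kernel s M)"
    using eventually_gt_at_top[of 0] by eventually_elim (rule wrapped_kernel_hs[OF s])
  have Sev: "\<forall>\<^sub>F M in at_top. ?S M i \<in> L2 lborel" for i
    using hs hermite_score_L2[of i] by eventually_elim (rule kernel_op_L2_norm)
  have lim: "((\<lambda>M. l2_norm lborel (\<lambda>x. ?S M i x - ?E i x)) \<longlongrightarrow> 0) at_top" for i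
    using idx_range[of i]
    by (intro tendsto_kernel_op hs hermite_score_L2 gauss_kernel_hs[OF s refl refl] hermite_fun_L2
        tendsto_wrapped_kernel tendsto_hermite_score s) auto
  have "((\<lambda>M. l2_inner lborel (?S M i) (?S M j)) \<longlongrightarrow> l2_inner lborel (?E i) (?E j)) at_top"
    by (intro tendsto_l2_inner Sev lim kernel_op_L2_norm gauss_kernel_hs[OF s refl refl] hermite_fun_L2 s)
  moreover have "l2_inner lborel (?E i) (?E j) = (if i = j then 1 / (1 + 1 / s\<^sup>2) ^ idx i else 0)"
  proof -
    have "l2_inner lborel (?E i) (?E j) = (s / ?\<tau>) ^ idx i * ((s / ?\<tau>) ^ idx j
        * l2_inner lborel (hermite_fun ?\<tau> (idx j)) (hermite_fun ?\<tau> (idx i)))"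
      unfolding gauss_kernel_hermite[OF s refl refl] l2_inner_scale_left
      by (subst l2_inner_commute) (simp only: l2_inner_scale_left)
    also have "\<dots> = (if i = j then (s / ?\<tau>) ^ (2 * idx i) else 0)"
      by (simp add: hermite_fun_orthonormal[OF tau] idx_inj eq_commute[of j i] mult_2 power_add)
    finally show ?thesis unfolding contraction_power[OF s] .
  qed
  moreover have "\<forall>\<^sub>F M in at_top. l2_inner lborel (?S M i) (?S M j)
      = fisher_info_X M (wrapped_gaussian s M) (hermite_statistic s idx) 0 $ i $ j"
    using eventually_gt_at_top[of 0]
  proof eventually_elim
    case (elim M)
    show ?case using hermite_statistic_admissible[OF s elim idx]
      by (intro fisher_info_X_eq[symmetric] s elim) (auto simp: admissible_statistic_def)
  qed
  ultimately show ?thesis by (simp add: Lim_transform_eventually)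
qed

text \<open>
  Entrywise convergence of the two matrices bounds the quadratic forms uniformly on the unit sphere, which
  gives the lower bound; the upper bound is the one valid for all statistics.
\<close>

lemma tendsto_rel_efficiency_hermite:
  "((\<lambda>M. rel_efficiency M (wrapped_gaussian s M) (hermite_statistic s idx) 0)
    \<longlongrightarrow> 1 / (1 + 1 / s\<^sup>2) ^ CARD('p)) at_top"
proof -
  let ?X = "\<lambda>M. fisher_info_X M (wrapped_gaussian s M) (hermite_statistic s idx) 0"
  let ?Y = "\<lambda>M. fisher_info_mu M (wrapped_gaussian s M) (hermite_statistic s idx) 0"
  let ?g = "1 / (1 + 1 / s\<^sup>2) ^ CARD('p)"
  define D :: "real ^ 'p ^ 'p" where "D = (\<chi> i j. if i = j then 1 / (1 + 1 / s\<^sup>2) ^ idx i else 0)"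
  define dX where "dX M = (\<Sum>i\<in>UNIV. \<Sum>j\<in>UNIV. \<bar>?X M $ i $ j - D $ i $ j\<bar>)" for M
  define dY where "dY M = (\<Sum>i\<in>UNIV. \<Sum>j\<in>UNIV. \<bar>?Y M $ i $ j - (mat 1 :: real ^ 'p ^ 'p) $ i $ j\<bar>)" for M
  have g: "0 < ?g" by (simp add: add_pos_nonneg)
  have "((\<lambda>M. ?X M $ i $ j - D $ i $ j) \<longlongrightarrow> 0) at_top" for i j
    using tendsto_fisher_info_X_entry[of i j] by (simp add: D_def Lim_null[symmetric])
  then have dX: "(dX \<longlongrightarrow> 0) at_top"
    unfolding dX_def[abs_def] by (intro tendsto_null_sum tendsto_rabs_zero)
  have "((\<lambda>M. ?Y M $ i $ j - (mat 1 :: real ^ 'p ^ 'p) $ i $ j) \<longlongrightarrow> 0) at_top" for i j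
    using tendsto_fisher_info_mu_entry[of i j] by (simp add: mat_def Lim_null[symmetric])
  then have dY: "(dY \<longlongrightarrow> 0) at_top"
    unfolding dY_def[abs_def] by (intro tendsto_null_sum tendsto_rabs_zero)
  have Dg: "?g * (a \<bullet> a) \<le> a \<bullet> (D *v a)" for a
  proof -
    have "?g * (a \<bullet> a) = (\<Sum>i\<in>UNIV. a $ i * a $ i * ?g)"
      unfolding inner_vec_def sum_distrib_left by (simp add: mult.commute)
    also have "\<dots> \<le> (\<Sum>i\<in>UNIV. a $ i * a $ i * (1 / (1 + 1 / s\<^sup>2) ^ idx i))"
    proof (intro sum_mono mult_left_mono)
      fix i
      have "(1 + 1 / s\<^sup>2) ^ idx i \<le> (1 + 1 / s\<^sup>2) ^ CARD('p)"
        using idx_range(2)[of i] by (intro power_increasing) auto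
      then show "?g \<le> 1 / (1 + 1 / s\<^sup>2) ^ idx i"
        by (intro divide_left_mono mult_pos_pos zero_less_power) (auto simp: add_pos_nonneg)
    qed auto
    also have "\<dots> = a \<bullet> (D *v a)"
      unfolding quadratic_form_sum
      by (intro sum.cong refl) (simp add: D_def if_distrib[of "\<lambda>x. _ * x"] sum.delta cong: if_cong)
    finally show ?thesis .
  qed
  show ?thesis
  proof (rule tendsto_sandwich)
    show "\<forall>\<^sub>F M in at_top. (?g - dX M) / (1 + dY M) \<le> rel_efficiency M (wrapped_gaussian s M) (hermite_statistic s idx) 0"
      using order_tendstoD(2)[OF dX g] order_tendstoD(2)[OF dY zero_less_one]
    proof eventually_elim
      case (elim M)
      show ?case
        unfolding rel_efficiency_def
      proof (rule cINF_greatest)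
        have "axis undefined (1 :: real) \<noteq> (0 :: real ^ 'p)" by (simp add: axis_eq_0_iff)
        then show "{a :: real ^ 'p. a \<noteq> 0} \<noteq> {}" by blast
        fix a :: "real ^ 'p" assume "a \<in> {a. a \<noteq> 0}"
        then have aa: "0 < a \<bullet> a" by simp
        have X: "(?g - dX M) * (a \<bullet> a) \<le> a \<bullet> (?X M *v a)"
          using quadratic_form_perturb[of a "?X M" D] Dg[of a]
          unfolding dX_def[symmetric] by (simp add: left_diff_distrib abs_le_iff)
        have Y: "a \<bullet> (?Y M *v a) \<le> (1 + dY M) * (a \<bullet> a)" "(1 - dY M) * (a \<bullet> a) \<le> a \<bullet> (?Y M *v a)"
          using quadratic_form_perturb[of a "?Y M" "mat 1"]
          unfolding dY_def[symmetric] by (auto simp: distrib_right left_diff_distrib abs_le_iff)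
        have "0 < (1 - dY M) * (a \<bullet> a)" using elim aa by simp
        then have Ypos: "0 < a \<bullet> (?Y M *v a)" using Y by linarith
        have "(?g - dX M) / (1 + dY M) = ((?g - dX M) * (a \<bullet> a)) / ((1 + dY M) * (a \<bullet> a))"
          using aa by simp
        also have "\<dots> \<le> (a \<bullet> (?X M *v a)) / (a \<bullet> (?Y M *v a))"
        proof (rule frac_le)
          have "0 \<le> (?g - dX M) * (a \<bullet> a)" using elim aa by simp
          then show "0 \<le> a \<bullet> (?X M *v a)" using X by linarith
        qed (use X Y Ypos in auto)
        finally show "(?g - dX M) / (1 + dY M) \<le> (a \<bullet> (?X M *v a)) / (a \<bullet> (?Y M *v a))" .
      qed
    qed
    show "\<forall>\<^sub>F M in at_top. rel_efficiency M (wrapped_gaussian s M) (hermite_statistic s idx) 0 \<le> efficiency_bound s CARD('p) M"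
      using eventually_gt_at_top[of 0]
    proof eventually_elim
      case (elim M)
      show ?case using hermite_statistic_admissible[OF s elim idx]
        by (intro rel_efficiency_le_bound s elim) (auto simp: admissible_statistic_def)
    qed
    have "((\<lambda>M. (?g - dX M) / (1 + dY M)) \<longlongrightarrow> (?g - 0) / (1 + 0)) at_top"
      by (intro tendsto_intros dX dY) auto
    then show "((\<lambda>M. (?g - dX M) / (1 + dY M)) \<longlongrightarrow> ?g) at_top" by simp
    show "(efficiency_bound s CARD('p) \<longlongrightarrow> ?g) at_top" by (rule tendsto_efficiency_bound[OF s])
  qed
qed

end

theorem theorem5:
  fixes \<sigma> :: real
  assumes "\<sigma> > 0"
  shows "(\<exists>r :: real \<Rightarrow> real. (r \<longlongrightarrow> 0) at_top \<and>
            (\<forall>M>0. \<forall>T :: real \<Rightarrow> real ^ 'p::finite.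
               admissible_statistic M (wrapped_gaussian \<sigma> M) T \<longrightarrow>
               rel_efficiency M (wrapped_gaussian \<sigma> M) T 0
                 \<le> 1 / (1 + 1 / \<sigma>\<^sup>2) ^ CARD('p) + r M)) \<and>
         (\<forall>idx :: 'p \<Rightarrow> nat. bij_betw idx UNIV {1..CARD('p)} \<longrightarrow>
            (\<forall>M>0. admissible_statistic M (wrapped_gaussian \<sigma> M) (hermite_statistic \<sigma> idx)) \<and>
            ((\<lambda>M. rel_efficiency M (wrapped_gaussian \<sigma> M) (hermite_statistic \<sigma> idx) 0)
               \<longlongrightarrow> 1 / (1 + 1 / \<sigma>\<^sup>2) ^ CARD('p)) at_top \<and>
            ((\<lambda>M. fisher_info_mu M (wrapped_gaussian \<sigma> M) (hermite_statistic \<sigma> idx) 0)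
               \<longlongrightarrow> mat 1) at_top \<and>
            ((\<lambda>M. fisher_info_X M (wrapped_gaussian \<sigma> M) (hermite_statistic \<sigma> idx) 0)
               \<longlongrightarrow> (\<chi> i j. if i = j then 1 / (1 + 1 / \<sigma>\<^sup>2) ^ idx i else 0)) at_top)"
proof (intro conjI exI[of _ "\<lambda>M. efficiency_bound \<sigma> CARD('p) M - 1 / (1 + 1 / \<sigma>\<^sup>2) ^ CARD('p)"] allI impI)
  show "((\<lambda>M. efficiency_bound \<sigma> CARD('p) M - 1 / (1 + 1 / \<sigma>\<^sup>2) ^ CARD('p)) \<longlongrightarrow> 0) at_top"
    using tendsto_efficiency_bound[OF assms] by (rule Lim_null[THEN iffD1])
next
  fix M :: real and T :: "real \<Rightarrow> real ^ 'p"
  assume "0 < M" and "admissible_statistic M (wrapped_gaussian \<sigma> M) T"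
  then have "rel_efficiency M (wrapped_gaussian \<sigma> M) T 0 \<le> efficiency_bound \<sigma> CARD('p) M"
    by (intro rel_efficiency_le_bound assms) (auto simp: admissible_statistic_def)
  then show "rel_efficiency M (wrapped_gaussian \<sigma> M) T 0
      \<le> 1 / (1 + 1 / \<sigma>\<^sup>2) ^ CARD('p) + (efficiency_bound \<sigma> CARD('p) M - 1 / (1 + 1 / \<sigma>\<^sup>2) ^ CARD('p))"
    by simp
next
  fix idx :: "'p \<Rightarrow> nat" assume idx: "bij_betw idx UNIV {1..CARD('p)}"
  show "admissible_statistic M (wrapped_gaussian \<sigma> M) (hermite_statistic \<sigma> idx)" if "0 < M" for M
    by (rule hermite_statistic_admissible[OF assms that idx])
  show "((\<lambda>M. rel_efficiency M (wrapped_gaussian \<sigma> M) (hermite_statistic \<sigma> idx) 0)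
      \<longlongrightarrow> 1 / (1 + 1 / \<sigma>\<^sup>2) ^ CARD('p)) at_top"
    by (rule tendsto_rel_efficiency_hermite[OF assms idx])
  show "((\<lambda>M. fisher_info_mu M (wrapped_gaussian \<sigma> M) (hermite_statistic \<sigma> idx) 0) \<longlongrightarrow> mat 1) at_top"
    by (intro vec_tendstoI) (use tendsto_fisher_info_mu_entry[OF assms idx] in \<open>simp add: mat_def\<close>)
  show "((\<lambda>M. fisher_info_X M (wrapped_gaussian \<sigma> M) (hermite_statistic \<sigma> idx) 0)
      \<longlongrightarrow> (\<chi> i j. if i = j then 1 / (1 + 1 / \<sigma>\<^sup>2) ^ idx i else 0)) at_top"
    by (intro vec_tendstoI) (use tendsto_fisher_info_X_entry[OF assms idx] in simp)
qed

end
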